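(* Let $\mathcal X$ be a complex Banach space, $s<0$, $0<p<\infty$ and $1\le q<\infty$. Then $$F^s_{p,q}(\mathcal X)=H^p\cdot F^s_{\infty,q}(\mathcal X).$$ Moreover, for every $f\in F^s_{p,q}(\mathcal X)$ the factorization $f=gh$ (with $g\in H^p$, $h\in F^s_{\infty,q}(\mathcal X)$ and $\|g\|_{H^p}\|h\|_{F^s_{\infty,q}(\mathcal X)}\le C\|f\|_{F^s_{p,q}(\mathcal X)}$, $C$ independent of $f$) can be chosen with $g$ an outer function.
   Context: Notation: $\mathbb D=\{w\in\mathbb C:|w|<1\}$, $\mathbb T=\{\zeta\in\mathbb C:|\zeta|=1\}$, $\zeta_x=e^{2\pi i x}$ ($x\in\mathbb R$); integrals $\int_{\mathbb T}\cdots\,dx$ are with respect to normalized arc length (total mass $1$), and for an arc $I\subset\mathbb T$, $|I|$ is its normalized length. For a complex Banach space $\mathcal X$, $\mathcal A(\mathcal X)$ is the space of analytic functions $\mathbb D\to\mathcal X$. For $0<p<\infty$, $H^p(\mathcal X)$ is the space of $f\in\mathcal A(\mathcal X)$ with $\|f\|_{H^p(\mathcal X)}=\sup_{0<r<1}\big(\int_{\mathbb T}\|f(r\zeta_x)\|_{\mathcal X}^p\,dx\big)^{1/p}<\infty$; $H^p=H^p(\mathbb C)$. An outer function is one of the form $g(w)=\lambda\exp\big(\int_{\mathbb T}\frac{\zeta_x+w}{\zeta_x-w}\log u(\zeta_x)\,dx\big)$ with $|\lambda|=1$, $u\ge0$, $\log u\in L^1(\mathbb T)$. Dyadic arcs $\mathcal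 D(\mathbb T)$: images under $x\mapsto\zeta_x$ of the intervals $[2^{-j}k,2^{-j}(k+1))$, $j\ge0$, $0\le k\le 2^j-1$. Stolz angle: $\Gamma(\zeta_x)$ is the convex hull of $\{\zeta_x\}\cup\{w:|w|=1/2\}$. Tent over $E\subset\mathbb T$: $T(E)=\mathbb D\setminus\bigcup_{\zeta\notin E}\Gamma(\zeta)$. For measurable $F:\mathbb D\to\mathbb C$ and $0<q<\infty$, $A_qF(\zeta_x)=\big(\int_{\Gamma(\zeta_x)}|F(z)|^q(1-|z|)^{-2}\,dA(z)\big)^{1/q}$. Tent spaces: for $0<p<\infty$, $T_{p,q}$ consists of $F$ with $\|F\|_{T_{p,q}}=\|A_qF\|_{L^p(\mathbb T)}<\infty$; $T_{\infty,q}$ consists of $F$ with $\|F\|_{T_{\infty,q}}^q=\sup_{I\in\mathcal D(\mathbb T)}\frac1{|I|}\int_{T(I)}|F(z)|^q(1-|z|)^{-1}dA(z)<\infty$. $T_{p,q}(\mathcal X)$ ($0<p\le\infty$) is the set of strongly measurable $F:\mathbb D\to\mathcal X$ with $\|F(\cdot)\|_{\mathcal X}\in T_{p,q}$, normed by $\|F\|_{T_{p,q}(\mathcal X)}=\|\,\|F\|_{\mathcal X}\|_{T_{p,q}}$. Triebel–Lizorkin spaces for $s<0$, $0<p\le\infty$, $1\le q<\infty$: $F^s_{p,q}(\mathcal X)$ is the space of $f\in\mathcal A(\mathcal X)$ with $\|f\|_{F^s_{p,q}(\mathcal X)}:=\|(1-|z|)^{-s}f(z)\|_{T_{p,q}(\mathcal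 X)}<\infty$ (this is the paper's definition $\|(1-|z|)^{\alpha-s}D^\alpha f\|_{T_{p,q}(\mathcal X)}$ with the admissible choice $\alpha=0$); $F^s_{p,q}=F^s_{p,q}(\mathbb C)$. Product notation: for (quasi-)normed spaces $X,X_1,X_2$ of functions on $\mathbb D$, $X\subset X_1\cdot X_2$ means every $f\in X$ can be written $f=f_1f_2$ with $f_i\in X_i$ and $\sup_{f\ne0}\inf_{f_1f_2=f}\|f_1\|_{X_1}\|f_2\|_{X_2}/\|f\|_X<\infty$; $X_1\cdot X_2\subset X$ means $f_1f_2\in X$ for all $f_i\in X_i$ with $\|f_1f_2\|_X\le C\|f_1\|_{X_1}\|f_2\|_{X_2}$; $X=X_1\cdot X_2$ means both. Products of a scalar and a vector-valued function are pointwise. *)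

theory Defs
  imports "HOL-Analysis.Analysis"
begin

class complex_banach = banach +
  fixes scaleC :: "complex \<Rightarrow> 'a \<Rightarrow> 'a" (infixr \<open>*\<^sub>C\<close> 75)
  assumes scaleC_add_right: "a *\<^sub>C (x + y) = a *\<^sub>C x + a *\<^sub>C y"
    and scaleC_add_left: "(a + b) *\<^sub>C x = a *\<^sub>C x + b *\<^sub>C x"
    and scaleC_scaleC: "a *\<^sub>C (b *\<^sub>C x) = (a * b) *\<^sub>C x"
    and scaleC_one: "1 *\<^sub>C x = x"
    and scaleC_of_real: "complex_of_real r *\<^sub>C x = r *\<^sub>R x"
    and norm_scaleC: "norm (a *\<^sub>C x) = cmod a * norm x"

instantiation complex :: complex_banach
begin
definition scaleC_complex :: "complex \<Rightarrow> complex \<Rightarrow> complex" where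
  "scaleC_complex a x = a * x"
instance
  by standard (auto simp: scaleC_complex_def algebra_simps norm_mult scaleR_conv_of_real)
end

definition disc :: "complex set" where "disc = ball 0 1"

definition zeta :: "real \<Rightarrow> complex" where "zeta x = exp (2 * pi * \<i> * complex_of_real x)"

definition analytic_disc :: "(complex \<Rightarrow> 'a::complex_banach) \<Rightarrow> bool" where
  "analytic_disc f \<longleftrightarrow>
     (\<forall>z\<in>disc. \<exists>v. ((\<lambda>w. inverse (w - z) *\<^sub>C (f w - f z)) \<longlongrightarrow> v) (at z))"

text \<open>Real powers on extended nonnegative reals (t > 0).\<close>
definition ennpow :: "ennreal \<Rightarrow> real \<Rightarrow> ennreal" where
  "ennpow a t = (if a = top then top else ennreal (enn2real a powr t))"

definition Hp_integral :: "real \<Rightarrow> (complex \<Rightarrow> 'a::real_normed_vector) \<Rightarrow> real \<Rightarrow> ennreal" where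
  "Hp_integral p f r = (\<integral>\<^sup>+ x\<in>{0..1}. ennreal (norm (f (complex_of_real r * zeta x)) powr p) \<partial>lborel)"

definition Hp_sup :: "real \<Rightarrow> (complex \<Rightarrow> 'a::real_normed_vector) \<Rightarrow> ennreal" where
  "Hp_sup p f = (SUP r\<in>{0<..<1}. Hp_integral p f r)"

definition in_Hp :: "real \<Rightarrow> (complex \<Rightarrow> complex) \<Rightarrow> bool" where
  "in_Hp p f \<longleftrightarrow> analytic_disc f \<and> Hp_sup p f < top"

definition Hp_norm :: "real \<Rightarrow> (complex \<Rightarrow> 'a::real_normed_vector) \<Rightarrow> real" where
  "Hp_norm p f = enn2real (ennpow (Hp_sup p f) (1 / p))"

definition outer :: "(complex \<Rightarrow> complex) \<Rightarrow> bool" where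
  "outer g \<longleftrightarrow> (\<exists>(c::complex) (u::complex \<Rightarrow> real).
      cmod c = 1 \<and> (\<forall>\<zeta>\<in>sphere 0 1. 0 \<le> u \<zeta>) \<and>
      integrable (lebesgue_on {0..1}) (\<lambda>x. ln (u (zeta x))) \<and>
      (\<forall>w\<in>disc. g w = c * exp (LINT x|lebesgue_on {0..1}.
            ((zeta x + w) / (zeta x - w)) * complex_of_real (ln (u (zeta x))))))"

definition stolz :: "complex \<Rightarrow> complex set" where
  "stolz \<zeta> = convex hull (insert \<zeta> (sphere 0 (1/2)))"

definition tent :: "complex set \<Rightarrow> complex set" where
  "tent E = disc - (\<Union>\<zeta>\<in>sphere 0 1 - E. stolz \<zeta>)"

definition dyadic_arc :: "nat \<Rightarrow> nat \<Rightarrow> complex set" where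
  "dyadic_arc j k = zeta ` {real k / 2 ^ j ..< (real k + 1) / 2 ^ j}"

text \<open>Aq_q q F z is the q-th power of A_q F at z.\<close>
definition Aq_q :: "real \<Rightarrow> (complex \<Rightarrow> 'a::real_normed_vector) \<Rightarrow> complex \<Rightarrow> ennreal" where
  "Aq_q q F \<zeta> = (\<integral>\<^sup>+ z\<in>stolz \<zeta>. ennreal (norm (F z) powr q / (1 - cmod z)^2) \<partial>lborel)"

definition tent_int :: "real \<Rightarrow> real \<Rightarrow> (complex \<Rightarrow> 'a::real_normed_vector) \<Rightarrow> ennreal" where
  "tent_int p q F = (\<integral>\<^sup>+ x\<in>{0..1}. ennpow (Aq_q q F (zeta x)) (p / q) \<partial>lborel)"

definition tent_norm :: "real \<Rightarrow> real \<Rightarrow> (complex \<Rightarrow> 'a::real_normed_vector) \<Rightarrow> real" where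
  "tent_norm p q F = enn2real (ennpow (tent_int p q F) (1 / p))"

definition tent_inf_sup :: "real \<Rightarrow> (complex \<Rightarrow> 'a::real_normed_vector) \<Rightarrow> ennreal" where
  "tent_inf_sup q F = (SUP (j, k)\<in>{(j, k). k < 2 ^ j}.
      ennreal (2 ^ j) * (\<integral>\<^sup>+ z\<in>tent (dyadic_arc j k). ennreal (norm (F z) powr q / (1 - cmod z)) \<partial>lborel))"

definition tent_inf_norm :: "real \<Rightarrow> (complex \<Rightarrow> 'a::real_normed_vector) \<Rightarrow> real" where
  "tent_inf_norm q F = enn2real (ennpow (tent_inf_sup q F) (1 / q))"

section \<open>Triebel--Lizorkin spaces (s < 0, alpha = 0)\<close>

definition TL_weight :: "real \<Rightarrow> (complex \<Rightarrow> 'a::complex_banach) \<Rightarrow> complex \<Rightarrow> 'a" where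
  "TL_weight s f z = (1 - cmod z) powr (- s) *\<^sub>R f z"

definition in_F :: "real \<Rightarrow> real \<Rightarrow> real \<Rightarrow> (complex \<Rightarrow> 'a::complex_banach) \<Rightarrow> bool" where
  "in_F s p q f \<longleftrightarrow> analytic_disc f \<and> tent_int p q (TL_weight s f) < top"

definition F_norm :: "real \<Rightarrow> real \<Rightarrow> real \<Rightarrow> (complex \<Rightarrow> 'a::complex_banach) \<Rightarrow> real" where
  "F_norm s p q f = tent_norm p q (TL_weight s f)"

definition in_Finf :: "real \<Rightarrow> real \<Rightarrow> (complex \<Rightarrow> 'a::complex_banach) \<Rightarrow> bool" where
  "in_Finf s q f \<longleftrightarrow> analytic_disc f \<and> tent_inf_sup q (TL_weight s f) < top"

definition Finf_norm :: "real \<Rightarrow> real \<Rightarrow> (complex \<Rightarrow> 'a::complex_banach) \<Rightarrow> real" where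
  "Finf_norm s q f = tent_inf_norm q (TL_weight s f)"

end

theory Submission
  imports Defs "HOL-Complex_Analysis.Complex_Analysis"
begin

text \<open>
  Factorization. Let \<open>\<Phi> = (A\<^sub>q F)\<^sup>q\<close> with \<open>F = (1 - |z|)\<^bsup>-s\<^esup> f\<close>, and let \<open>V\<close> be \<open>\<Phi>\<^bsup>p/(2q)\<^esup>\<close> plus a small
  constant, so that \<open>V \<in> L\<^sup>2\<close>. Take for \<open>g\<close> the outer function whose boundary modulus is
  the power \<open>2/p\<close> of a maximal function of \<open>V\<close>. The \<open>L\<^sup>2\<close> maximal theorem bounds \<open>g\<close> in \<open>H\<^sup>p\<close>, and \<open>|g(w)|\<^bsup>p/2\<^esup>\<close>
  dominates the mean of \<open>V\<close> over \<open>J\<^sub>w = {\<zeta>. w \<in> \<Gamma>(\<zeta>)}\<close>. By Jensen, \<open>|g(w)|\<^bsup>-q\<^esup>\<close> is at most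
  a constant times the mean of \<open>1/\<Phi>\<close> over \<open>J\<^sub>w\<close>. Since \<open>w \<in> T(I)\<close> means \<open>J\<^sub>w \<subseteq> I\<close>,
  Fubini shows that the tent integral of \<open>|F/g|\<^sup>q\<close> over \<open>T(I)\<close> is at most a constant times
  the integral of \<open>\<Phi>/\<Phi>\<close> over \<open>I\<close>.

  Products. Tents over dyadic arcs do not see the Stolz angles at dyadic points, so the norm of
  \<open>T\<^bsub>\<infinity>,q\<^esub>\<close> is not a Carleson norm in general; for analytic \<open>h\<close> it is, by a Phragmen-Lindelof
  argument in these cones. With the resulting Carleson measure \<open>\<mu>\<close>, the balayage
  \<open>S\<gamma>(v) = \<integral> \<gamma>(z) K\<^sub>z(v) d\<mu>(z)\<close> satisfies \<open>(S\<gamma>)\<^sup>2 \<le> 8 S(\<gamma> S\<gamma>)\<close>, which bootstraps the Carleson embedding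
  to \<open>\<parallel>S\<gamma>\<parallel> \<le> C \<parallel>N\<gamma>\<parallel>\<close> in \<open>L\<^sup>n\<close> for every \<open>n = 2\<^sup>j\<close>, where \<open>N\<close> is the nontangential maximal
  function. For \<open>\<gamma> = |g|\<^bsup>p/n\<^esup>\<close> with \<open>n > p/q\<close>, the pointwise bound \<open>|g|\<^sup>q \<le> (Ng)\<^bsup>q - p/n\<^esup> \<gamma>\<close>
  and Hoelder's inequality reach every \<open>p\<close>.
\<close>

section \<open>Vector-valued analytic functions\<close>

text \<open>Duality is no option, since p may lie below 1 and q is arbitrary; the estimates rest on
  squares instead. The maximal theorem and the balayage bound both come from one inequality,
  \<open>square_balayage_le\<close>, followed by Cauchy-Schwarz and the cancellation of a common
  factor. Cancelling demands finiteness beforehand, which explains the cut-offs and limiting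
  arguments around these estimates. Small powers such as |g|^(p/2) are used because they are
  subharmonic whatever the zeros of g and bring every p back to L^2. The Phragmen-Lindelof step
  works because a dyadic point c = m/2^i with m odd is flanked by tents of every smaller scale,
  which bound h on the sides of a cone at c, and is the midpoint of a larger arc, whose tent bounds
  h on the outer end. Only at the vertex does a crude growth bound have to do. The values of f enter
  mostly through their norms; where analyticity matters, a functional norming at one point reduces
  the claim to a scalar function.\<close>

lemma bounded_bilinear_scaleC: "bounded_bilinear (scaleC :: complex \<Rightarrow> 'a::complex_banach \<Rightarrow> 'a)"
proof
  fix a a' :: complex and b b' :: 'a and r :: real
  show "(a + a') *\<^sub>C b = a *\<^sub>C b + a' *\<^sub>C b" by (rule scaleC_add_left)
  show "a *\<^sub>C (b + b') = a *\<^sub>C b + a *\<^sub>C b'" by (rule scaleC_add_right)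
  show "(r *\<^sub>R a) *\<^sub>C b = r *\<^sub>R (a *\<^sub>C b)"
    by (simp add: scaleR_conv_of_real scaleC_scaleC[symmetric] scaleC_of_real)
  show "a *\<^sub>C (r *\<^sub>R b) = r *\<^sub>R (a *\<^sub>C b)"
    by (simp add: scaleC_of_real[symmetric] scaleC_scaleC mult.commute)
  show "\<exists>K. \<forall>a (b::'a). norm (a *\<^sub>C b) \<le> norm a * norm b * K"
    by (rule exI[of _ 1]) (simp add: norm_scaleC)
qed

interpretation scaleC: bounded_bilinear "scaleC :: complex \<Rightarrow> 'a::complex_banach \<Rightarrow> 'a"
  by (rule bounded_bilinear_scaleC)

lemma open_disc [simp]: "open disc"
  by (simp add: disc_def)

lemma mem_disc [simp]: "z \<in> disc \<longleftrightarrow> cmod z < 1"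
  by (simp add: disc_def)

lemma analytic_disc_complex_iff: "analytic_disc (g :: complex \<Rightarrow> complex) \<longleftrightarrow> g holomorphic_on disc"
proof -
  have "(\<exists>v. ((\<lambda>w. inverse (w - z) *\<^sub>C (g w - g z)) \<longlongrightarrow> v) (at z)) \<longleftrightarrow> g field_differentiable (at z)" for z
    by (simp add: scaleC_complex_def field_differentiable_def has_field_derivative_iff divide_inverse mult.commute)
  then show ?thesis
    unfolding analytic_disc_def holomorphic_on_def using at_within_open[OF _ open_disc] by metis
qed

lemma analytic_disc_imp_continuous_on:
  assumes "analytic_disc f" shows "continuous_on disc f"
proof -
  have "isCont f z" if z: "z \<in> disc" for z
  proof -
    obtain v where v: "((\<lambda>w. inverse (w - z) *\<^sub>C (f w - f z)) \<longlongrightarrow> v) (at z)"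
      using assms z unfolding analytic_disc_def by blast
    have "((\<lambda>w. f z + (w - z) *\<^sub>C (inverse (w - z) *\<^sub>C (f w - f z))) \<longlongrightarrow> f z + (z - z) *\<^sub>C v) (at z)"
      by (rule tendsto_add[OF tendsto_const scaleC.tendsto[OF tendsto_diff[OF tendsto_ident_at tendsto_const] v]])
    moreover have "\<forall>\<^sub>F w in at z. f z + (w - z) *\<^sub>C (inverse (w - z) *\<^sub>C (f w - f z)) = f w"
      using eventually_neq_at_within[of z z UNIV]
      by eventually_elim (simp add: scaleC_scaleC scaleC_one)
    ultimately have "(f \<longlongrightarrow> f z + (z - z) *\<^sub>C v) (at z)"
      by (rule Lim_transform_eventually)
    then show ?thesis by (simp add: isCont_def scaleC.zero_left)
  qed
  then show ?thesis using continuous_at_imp_continuous_on by blast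
qed

lemma analytic_disc_scaleC:
  assumes "analytic_disc g" "analytic_disc f" shows "analytic_disc (\<lambda>z. g z *\<^sub>C f z)"
  unfolding analytic_disc_def
proof
  fix z assume z: "z \<in> disc"
  obtain v where v: "((\<lambda>w. inverse (w - z) *\<^sub>C (f w - f z)) \<longlongrightarrow> v) (at z)"
    using assms z unfolding analytic_disc_def by blast
  obtain u where u: "((\<lambda>w. inverse (w - z) *\<^sub>C (g w - g z)) \<longlongrightarrow> u) (at z)"
    using assms z unfolding analytic_disc_def by blast
  have c: "(g \<longlongrightarrow> g z) (at z)"
    using analytic_disc_imp_continuous_on[OF assms(1)] z continuous_on_eq_continuous_at[OF open_disc] isCont_def by blast
  have "((\<lambda>w. g w *\<^sub>C (inverse (w - z) *\<^sub>C (f w - f z)) + (inverse (w - z) *\<^sub>C (g w - g z)) *\<^sub>C f z)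
     \<longlongrightarrow> g z *\<^sub>C v + u *\<^sub>C f z) (at z)"
    by (rule tendsto_add[OF scaleC.tendsto[OF c v] scaleC.tendsto[OF u tendsto_const]])
  moreover have "g w *\<^sub>C (inverse (w - z) *\<^sub>C (f w - f z)) + (inverse (w - z) *\<^sub>C (g w - g z)) *\<^sub>C f z
     = inverse (w - z) *\<^sub>C (g w *\<^sub>C f w - g z *\<^sub>C f z)" for w
    by (simp add: scaleC_complex_def scaleC_scaleC scaleC.diff_right scaleC.diff_left algebra_simps)
  ultimately show "\<exists>v. ((\<lambda>w. inverse (w - z) *\<^sub>C (g w *\<^sub>C f w - g z *\<^sub>C f z)) \<longlongrightarrow> v) (at z)"
    by auto
qed

section \<open>Norming functionals\<close>

definition sublinear :: "('a::real_vector \<Rightarrow> real) \<Rightarrow> bool" where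
  "sublinear p \<longleftrightarrow> (\<forall>x y. p (x + y) \<le> p x + p y) \<and> (\<forall>t\<ge>0. \<forall>x. p (t *\<^sub>R x) = t * p x)"

lemma sublinear_zero: "sublinear p \<Longrightarrow> p 0 = 0"
  unfolding sublinear_def using scaleR_zero_left[of "0::'a"] by (metis mult_zero_left order_refl)

lemma sublinear_ge: "sublinear p \<Longrightarrow> - p (- x) \<le> p x"
proof -
  assume p: "sublinear p"
  then have "p (x + - x) \<le> p x + p (- x)" unfolding sublinear_def by blast
  then show ?thesis using sublinear_zero[OF p] by simp
qed

text \<open>The value of p is lowered along the direction y as far as sublinearity permits. A
  minimal p equals its own r, and the last inequality then says that p is superadditive. Applied to
  the norm, the same construction prescribes the value at one vector.\<close>

lemma sublinear_directional:
  fixes p :: "'a::real_vector \<Rightarrow> real" and y :: 'a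
  assumes p: "sublinear p"
  defines "r \<equiv> \<lambda>x. INF t\<in>{0..}. p (x + t *\<^sub>R y) - t * p y"
  shows "sublinear r" and "r x \<le> p x" and "r x \<le> p (x + y) - p y"
proof -
  have add: "p (a + b) \<le> p a + p b" and sc: "t \<ge> 0 \<Longrightarrow> p (t *\<^sub>R a) = t * p a" for a b t
    using p by (auto simp: sublinear_def)
  have lb: "p (x + t *\<^sub>R y) - t * p y \<ge> - p (- x)" if "t \<ge> 0" for t x
    using add[of "- x" "x + t *\<^sub>R y"] sc[OF that, of y] by (simp add: algebra_simps)
  have bdd: "bdd_below ((\<lambda>t. p (x + t *\<^sub>R y) - t * p y) ` {0..})" for x
    using lb by (intro bdd_belowI2[of _ "- p (- x)"]) auto
  have le: "r x \<le> p (x + t *\<^sub>R y) - t * p y" if "t \<ge> 0" for x t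
    unfolding r_def using that by (intro cINF_lower bdd) auto
  have ge: "m \<le> r x" if "\<And>t. t \<ge> 0 \<Longrightarrow> m \<le> p (x + t *\<^sub>R y) - t * p y" for m x
    unfolding r_def using that by (intro cINF_greatest) auto
  show "r x \<le> p x" using le[of 0 x] by simp
  show "r x \<le> p (x + y) - p y" using le[of 1 x] by simp
  have "r (a + b) \<le> r a + r b" for a b
  proof -
    have "r (a + b) - r a \<le> p (b + t *\<^sub>R y) - t * p y" if t: "t \<ge> 0" for t
    proof -
      have "r (a + b) - (p (b + t *\<^sub>R y) - t * p y) \<le> r a"
      proof (rule ge)
        fix s :: real assume s: "s \<ge> 0"
        have "r (a + b) \<le> p ((a + b) + (s + t) *\<^sub>R y) - (s + t) * p y" using le s t by simp
        also have "\<dots> \<le> p (a + s *\<^sub>R y) + p (b + t *\<^sub>R y) - (s + t) * p y"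
          using add[of "a + s *\<^sub>R y" "b + t *\<^sub>R y"] by (simp add: algebra_simps)
        finally show "r (a + b) - (p (b + t *\<^sub>R y) - t * p y) \<le> p (a + s *\<^sub>R y) - s * p y"
          by (simp add: algebra_simps)
      qed
      then show ?thesis by simp
    qed
    then have "r (a + b) - r a \<le> r b" by (rule ge)
    then show ?thesis by simp
  qed
  moreover have sc1: "r (c *\<^sub>R a) \<le> c * r a" if c: "c > 0" for c a
  proof -
    have "r (c *\<^sub>R a) / c \<le> r a"
    proof (rule ge)
      fix t :: real assume t: "t \<ge> 0"
      have "r (c *\<^sub>R a) \<le> p (c *\<^sub>R a + (c * t) *\<^sub>R y) - (c * t) * p y" using le t c by simp
      also have "\<dots> = c * (p (a + t *\<^sub>R y) - t * p y)"
        using sc[of c "a + t *\<^sub>R y"] c by (simp add: algebra_simps)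
      finally show "r (c *\<^sub>R a) / c \<le> p (a + t *\<^sub>R y) - t * p y"
        using c by (simp add: field_simps)
    qed
    then show ?thesis using c by (simp add: field_simps)
  qed
  moreover have "r (c *\<^sub>R a) = c * r a" if c: "c > 0" for c a
    using sc1[OF c, of a] sc1[of "inverse c" "c *\<^sub>R a"] c by (simp add: field_simps)
  moreover have "r 0 = 0"
  proof (rule antisym)
    show "r 0 \<le> 0" using le[of 0 0] sublinear_zero[OF p] by simp
    show "0 \<le> r 0" using sc by (intro ge) simp
  qed
  ultimately show "sublinear r"
    unfolding sublinear_def by (auto simp: less_eq_real_def)
qed

text \<open>A minimal sublinear functional is linear, and minimal ones exist by Zorn's lemma.\<close>

lemma Hahn_Banach_norming_real:
  fixes x0 :: "'a::real_normed_vector"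
  obtains l where "linear l" "\<And>x. l x \<le> norm x" "l x0 = norm x0"
proof -
  \<comment> \<open>Zorn's lemma is applied below \<open>p0\<close> and not below the norm: since
    \<open>p0 (- x0) <= - norm x0\<close>, every linear functional under \<open>p0\<close> is
    norming at \<open>x0\<close>.\<close>
  define p0 where "p0 x = (INF t\<in>{0..}. norm (x + t *\<^sub>R x0) - t * norm x0)" for x
  have sn: "sublinear (norm :: 'a \<Rightarrow> real)"
    by (auto simp: sublinear_def norm_triangle_ineq)
  note p0 = sublinear_directional[OF sn, where y=x0, folded p0_def]
  define A where "A = {p. sublinear p \<and> (\<forall>x. p x \<le> p0 x)}"
  \<comment> \<open>The order is reversed: upper bounds of chains are pointwise infima, and a
    maximal element is a minimal functional.\<close>
  define R where "R = (\<lambda>p q :: 'a \<Rightarrow> real. \<forall>x. q x \<le> p x)"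
  have "\<exists>m\<in>A. \<forall>a\<in>A. R m a \<longrightarrow> a = m"
  proof (rule predicate_Zorn)
    show "partial_order_on A (relation_of R A)"
      unfolding partial_order_on_def preorder_on_def refl_on_def trans_def antisym_def relation_of_def R_def
      by (auto intro: order_trans simp: fun_eq_iff) (metis order_antisym)
    fix C assume C: "C \<in> Chains (relation_of R A)"
    have CA: "C \<subseteq> A" and ch: "\<And>p q. p \<in> C \<Longrightarrow> q \<in> C \<Longrightarrow> (\<forall>x. p x \<le> q x) \<or> (\<forall>x. q x \<le> p x)"
      using C unfolding Chains_def relation_of_def R_def by auto
    show "\<exists>u\<in>A. \<forall>a\<in>C. R a u"
    proof (cases "C = {}")
      case True
      have "p0 \<in> A" using p0(1) by (simp add: A_def)
      then show ?thesis using True by auto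
    next
      case ne: False
      define u where "u = (\<lambda>x. INF p\<in>C. p x)"
      have bdd: "bdd_below ((\<lambda>p. p x) ` C)" for x
      proof (rule bdd_belowI2)
        fix p assume "p \<in> C"
        then have "sublinear p" "p (- x) \<le> p0 (- x)" using CA by (auto simp: A_def)
        then show "- p0 (- x) \<le> p x" using sublinear_ge[of p x] by linarith
      qed
      have le: "u x \<le> p x" if "p \<in> C" for p x
        unfolding u_def by (intro cINF_lower bdd that)
      have ge: "m \<le> u x" if "\<And>p. p \<in> C \<Longrightarrow> m \<le> p x" for m x
        unfolding u_def using that ne by (intro cINF_greatest) auto
      have "u (x + y) \<le> u x + u y" for x y
      proof -
        have "u (x + y) - u x \<le> p y" if p: "p \<in> C" for p
        proof -
          have "u (x + y) - p y \<le> u x"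
          proof (rule ge)
            fix q assume q: "q \<in> C"
            obtain r where r: "r \<in> C" "\<And>x. r x \<le> p x" "\<And>x. r x \<le> q x"
              using ch[OF p q] p q by blast
            have "sublinear r" using r CA by (auto simp: A_def)
            then have "r (x + y) \<le> r x + r y" by (simp add: sublinear_def)
            then show "u (x + y) - p y \<le> q x" using le[OF r(1), of "x + y"] r(2)[of y] r(3)[of x] by linarith
          qed
          then show ?thesis by simp
        qed
        then have "u (x + y) - u x \<le> u y" by (rule ge)
        then show ?thesis by simp
      qed
      moreover have "u (t *\<^sub>R x) = t * u x" if "t \<ge> 0" for t x
      proof -
        have "u (t *\<^sub>R x) = (INF p\<in>C. t * p x)"
          unfolding u_def using CA that by (intro INF_cong) (auto simp: A_def sublinear_def)
        also have "\<dots> = t * u x"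
          unfolding u_def
        proof (cases "t = 0")
          case False
          then have t: "t > 0" using that by simp
          show "(INF p\<in>C. t * p x) = t * (INF p\<in>C. p x)"
          proof (rule antisym)
            have "bdd_below ((\<lambda>p. t * p x) ` C)"
              by (rule bdd_belowI2[of _ "t * u x"]) (use le t in auto)
            then have "(INF p\<in>C. t * p x) / t \<le> p x" if "p \<in> C" for p
              using cINF_lower[of "\<lambda>p. t * p x" C p] that t by (simp add: field_simps)
            then have "(INF p\<in>C. t * p x) / t \<le> u x" by (rule ge)
            then show "(INF p\<in>C. t * p x) \<le> t * (INF p\<in>C. p x)"
              using t by (simp add: u_def field_simps)
            show "t * (INF p\<in>C. p x) \<le> (INF p\<in>C. t * p x)"
              using ne le t by (intro cINF_greatest) (auto simp: u_def)
          qed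
        qed (use ne in auto)
        finally show ?thesis .
      qed
      ultimately have "sublinear u" by (simp add: sublinear_def)
      moreover have "u x \<le> p0 x" for x
      proof -
        obtain p where "p \<in> C" using ne by auto
        then show ?thesis using le[of p x] CA by (auto simp: A_def intro: order_trans)
      qed
      ultimately have "u \<in> A" by (simp add: A_def)
      then show ?thesis using le by (auto simp: R_def)
    qed
  qed
  then obtain l where l: "l \<in> A" and min: "\<And>a. a \<in> A \<Longrightarrow> (\<And>x. a x \<le> l x) \<Longrightarrow> a = l"
    by (auto simp: R_def)
  have sl: "sublinear l" and ll: "l x \<le> p0 x" for x using l by (auto simp: A_def)
  have super: "l x + l y \<le> l (x + y)" for x y
  proof -
    \<comment> \<open>By minimality, lowering l once more along y cannot change it, and
      \<open>r = l\<close> is superadditivity.\<close>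
    define r where "r x = (INF t\<in>{0..}. l (x + t *\<^sub>R y) - t * l y)" for x
    note r = sublinear_directional[OF sl, where y=y, folded r_def]
    have "r z \<le> p0 z" for z using r(2)[of z] ll[of z] by simp
    then have "r \<in> A" using r(1) by (simp add: A_def)
    then have "r = l" using min r(2) by blast
    then show ?thesis using r(3)[of x] by simp
  qed
  have ladd: "l (x + y) = l x + l y" for x y
    using super[of x y] sl by (auto simp: sublinear_def intro: antisym)
  have lneg: "l (- x) = - l x" for x
    using ladd[of x "- x"] sublinear_zero[OF sl] by simp
  have lsc: "l (t *\<^sub>R x) = t * l x" for t x
  proof (cases "t \<ge> 0")
    case False
    moreover have "\<forall>t\<ge>0. \<forall>x. l (t *\<^sub>R x) = t * l x" using sl by (simp add: sublinear_def)
    ultimately have "l ((- t) *\<^sub>R x) = (- t) * l x" by (metis linorder_le_cases neg_0_le_iff_le)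
    then show ?thesis using lneg[of "t *\<^sub>R x"] by simp
  qed (use sl in \<open>auto simp: sublinear_def\<close>)
  have "linear l" by (rule linearI) (auto simp: ladd lsc)
  moreover have le: "l x \<le> norm x" for x using ll[of x] p0(2)[of x] by simp
  moreover have "l x0 = norm x0"
  proof (rule antisym[OF le])
    have "l (- x0) \<le> - norm x0" using ll[of "- x0"] p0(3)[of "- x0"] by simp
    then show "norm x0 \<le> l x0" using lneg[of x0] by simp
  qed
  ultimately show thesis using that by blast
qed

text \<open>Brings a vector-valued function down to a scalar one at a chosen point:
  \<open>l (h z)\<close> is holomorphic, dominated by the norm of \<open>h z\<close> everywhere, and
  equal to it at the point for which l was chosen.\<close>

lemma Hahn_Banach_norming:
  fixes x0 :: "'a::complex_banach"
  obtains l :: "'a \<Rightarrow> complex" where "\<And>x y. l (x + y) = l x + l y" "\<And>a x. l (a *\<^sub>C x) = a * l x"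
    "\<And>x. cmod (l x) \<le> norm x" "l x0 = norm x0"
proof -
  obtain f :: "'a \<Rightarrow> real" where f: "linear f" "\<And>x. f x \<le> norm x" "f x0 = norm x0"
    using Hahn_Banach_norming_real by blast
  interpret f: linear f by fact
  \<comment> \<open>The usual complexification of a real functional; the minus sign makes
    \<open>l (\<i> *\<^sub>C x) = \<i> * l x\<close>.\<close>
  define l where "l x = Complex (f x) (- f (\<i> *\<^sub>C x))" for x
  have add: "l (x + y) = l x + l y" for x y
    by (simp add: l_def complex_eq_iff f.add scaleC_add_right)
  have i: "l (a *\<^sub>C x) = a * l x" for a x
  proof -
    have a: "a *\<^sub>C x = Re a *\<^sub>R x + Im a *\<^sub>R (\<i> *\<^sub>C x)"
      by (subst complex_eq[of a])
        (simp add: scaleC_add_left scaleC_of_real scaleC_scaleC[symmetric] mult.commute[of \<i>])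
    have ii: "\<i> *\<^sub>C (\<i> *\<^sub>C x) = - x"
      using scaleC.minus_left[of 1 x] by (simp add: scaleC_scaleC scaleC_one)
    show ?thesis
      by (simp add: l_def complex_eq_iff a f.add f.scale scaleC_add_right scaleC.scaleR_right ii f.neg f.diff algebra_simps)
  qed
  have "cmod (l x) \<le> norm x" for x
  proof (cases "l x = 0")
    case False
    \<comment> \<open>A rotation after which l is real and positive, so that it coincides with the
      real functional f there.\<close>
    define a where "a = cnj (l x) / cmod (l x)"
    have "l (a *\<^sub>C x) = cmod (l x)"
      using False by (simp add: i a_def complex_norm_square[symmetric] power2_eq_square field_simps mult.commute[of "cnj _"])
    then have "f (a *\<^sub>C x) = cmod (l x)" by (simp add: l_def complex_eq_iff)
    moreover have "norm (a *\<^sub>C x) = norm x" using False by (simp add: norm_scaleC a_def norm_divide)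
    ultimately show ?thesis using f(2)[of "a *\<^sub>C x"] by simp
  qed auto
  moreover have "l x0 = norm x0"
  proof -
    have le: "cmod (l x0) \<le> norm x0" by fact
    have R: "Re (l x0) = norm x0" by (simp add: l_def f)
    then have "cmod (l x0) = \<bar>Re (l x0)\<bar>" using le abs_Re_le_cmod[of "l x0"] by auto
    then have "(Im (l x0))\<^sup>2 = 0" using cmod_power2[of "l x0"] by simp
    then have "Im (l x0) = 0" by simp
    then show ?thesis using R by (simp add: complex_eq_iff)
  qed
  ultimately show thesis using that add i by blast
qed

lemma analytic_disc_functional:
  fixes l :: "'a::complex_banach \<Rightarrow> complex"
  assumes l: "\<And>x y. l (x + y) = l x + l y" "\<And>a x. l (a *\<^sub>C x) = a * l x" "\<And>x. cmod (l x) \<le> norm x"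
    and f: "analytic_disc f"
  shows "(\<lambda>z. l (f z)) holomorphic_on disc"
proof -
  have sc: "l (r *\<^sub>R x) = r *\<^sub>R l x" for r x
    using l(2)[of "of_real r" x] by (simp add: scaleC_of_real scaleR_conv_of_real)
  interpret l: bounded_linear l
    by (rule bounded_linear_intro[where K=1]) (auto simp: l sc)
  have "analytic_disc (\<lambda>z. l (f z))"
    unfolding analytic_disc_def
  proof
    fix z assume "z \<in> disc"
    then obtain v where "((\<lambda>w. inverse (w - z) *\<^sub>C (f w - f z)) \<longlongrightarrow> v) (at z)"
      using f unfolding analytic_disc_def by blast
    then have "((\<lambda>w. l (inverse (w - z) *\<^sub>C (f w - f z))) \<longlongrightarrow> l v) (at z)" by (rule l.tendsto)
    then show "\<exists>v. ((\<lambda>w. inverse (w - z) *\<^sub>C (l (f w) - l (f z))) \<longlongrightarrow> v) (at z)"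
      by (auto simp: l(2) l.diff scaleC_complex_def)
  qed
  then show ?thesis by (simp add: analytic_disc_complex_iff)
qed

section \<open>The circle and the Poisson kernel\<close>

text \<open>Normalized arc length in the coordinate x. The closed interval meets the point 1 of the
  circle twice, at x = 0 and x = 1, which is visible only in \<open>dyadic_arc_iff\<close>.\<close>

definition circ :: "real measure" where "circ = restrict_space lborel {0..1}"

lemma space_circ [simp]: "space circ = {0..1}"
  by (simp add: circ_def space_restrict_space)

lemma sets_circ [measurable_cong]: "sets circ = sets (restrict_space borel {0..1})"
  by (simp add: circ_def sets_restrict_space)

lemma measurable_circ: "f \<in> borel \<rightarrow>\<^sub>M N \<Longrightarrow> f \<in> circ \<rightarrow>\<^sub>M N"
  unfolding circ_def by (rule measurable_restrict_space1) simp

lemma emeasure_space_circ [simp]: "emeasure circ {0..1} = 1"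
  by (simp add: circ_def emeasure_restrict_space)

interpretation circ: finite_measure circ
  by (rule finite_measureI) simp

lemma nn_integral_circ: "(\<integral>\<^sup>+x\<in>{0..1}. f x \<partial>lborel) = (\<integral>\<^sup>+x. f x \<partial>circ)"
  by (simp add: circ_def nn_integral_restrict_space)

lemma nn_integral_const_circ [simp]: "(\<integral>\<^sup>+x. c \<partial>circ) = c"
  by simp

section \<open>The parametrization of the circle and its metric\<close>

lemma continuous_on_zeta [continuous_intros]: "continuous_on A f \<Longrightarrow> continuous_on A (\<lambda>x. zeta (f x))"
  unfolding zeta_def by (intro continuous_intros)

lemma measurable_zeta [measurable]: "zeta \<in> borel_measurable borel"
  by (intro borel_measurable_continuous_onI continuous_intros)

lemma measurable_circ_id [measurable]: "(\<lambda>x. x) \<in> borel_measurable circ"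
  by (rule measurable_circ) simp

lemma norm_zeta [simp]: "cmod (zeta x) = 1"
  by (simp add: zeta_def)

lemma zeta_neq_0 [simp]: "zeta x \<noteq> 0"
  by (metis norm_zeta norm_zero zero_neq_one)

lemma zeta_add_int [simp]: "zeta (x + of_int k) = zeta x"
proof -
  have "zeta (x + of_int k) = zeta x * exp (of_real (2 * of_int k * pi) * \<i>)"
    by (simp only: zeta_def exp_add[symmetric]) (simp add: algebra_simps)
  moreover have "exp (complex_of_real (2 * of_int k * pi) * \<i>) = 1"
    by (rule exp_integer_2pi) simp
  ultimately show ?thesis by simp
qed

lemma norm_zeta_diff: "cmod (zeta x - zeta y) = 2 * \<bar>sin (pi * (x - y))\<bar>"
proof -
  have "zeta x - zeta y = zeta y * (exp (\<i> * of_real (2 * pi * (x - y))) - 1)"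
    by (simp add: zeta_def exp_add[symmetric] algebra_simps)
  then have "cmod (zeta x - zeta y) = cmod (exp (\<i> * of_real (2 * pi * (x - y))) - 1)"
    by (simp add: norm_mult)
  also have "\<dots> = 2 * \<bar>sin (2 * pi * (x - y) / 2)\<bar>" by (rule dist_exp_i_1)
  finally show ?thesis by simp
qed

lemma norm_zeta_diff_le: "cmod (zeta x - zeta y) \<le> 2 * pi * \<bar>x - y\<bar>"
  unfolding norm_zeta_diff using abs_sin_x_le_abs_x[of "pi * (x - y)"] by (simp add: abs_mult)

text \<open>Jordan's inequality, from concavity of the sine.\<close>

lemma sin_ge_linear:
  fixes t :: real assumes "0 \<le> t" "t \<le> pi / 2" shows "2 / pi * t \<le> sin t"
proof -
  have c: "convex_on {0..pi/2} (\<lambda>x. - sin x)"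
    by (rule f''_ge0_imp_convex[where f' = "\<lambda>x. - cos x" and f'' = sin])
      (auto intro!: derivative_eq_intros sin_ge_zero)
  have "- sin ((1 - 2 / pi * t) *\<^sub>R 0 + (2 / pi * t) *\<^sub>R (pi / 2))
      \<le> (1 - 2 / pi * t) * (- sin 0) + (2 / pi * t) * (- sin (pi / 2))"
    using assms by (intro convex_onD[OF c]) (auto simp: field_simps)
  then show ?thesis by (simp add: field_simps)
qed

text \<open>Together with \<open>norm_zeta_diff_le7\<close> this makes chords and parameter
  distances comparable, with factors 4 and 7; the assumption excludes going round the circle the
  long way.\<close>

lemma norm_zeta_diff_ge: assumes "\<bar>x - y\<bar> \<le> 1 / 2" shows "4 * \<bar>x - y\<bar> \<le> cmod (zeta x - zeta y)"
proof -
  have "2 / pi * (pi * \<bar>x - y\<bar>) \<le> sin (pi * \<bar>x - y\<bar>)"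
    using assms by (intro sin_ge_linear) auto
  moreover have "\<bar>sin (pi * \<bar>u\<bar>)\<bar> = \<bar>sin (pi * u)\<bar>" for u
    by (cases "u \<ge> 0") auto
  then have "sin (pi * \<bar>x - y\<bar>) \<le> \<bar>sin (pi * (x - y))\<bar>" by (metis abs_ge_self)
  ultimately show ?thesis by (simp add: norm_zeta_diff)
qed

lemma zeta_surj: assumes "cmod z = 1" obtains x where "x \<in> {a..<a+1}" "z = zeta x"
proof -
  define t where "t = Arg z / (2 * pi)"
  have "z \<noteq> 0" using assms by auto
  then have z: "z = zeta t"
    using Arg_eq[of z] assms by (simp add: zeta_def t_def)
  define x where "x = t - of_int \<lfloor>t - a\<rfloor>"
  have "x \<in> {a..<a+1}" unfolding x_def by (auto; linarith)
  moreover have "zeta x = zeta t" using zeta_add_int[of t "- \<lfloor>t - a\<rfloor>"] by (simp add: x_def)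
  ultimately show thesis using that z by metis
qed

lemma polar_zeta: obtains x where "x \<in> {a..<a+1}" "z = complex_of_real (cmod z) * zeta x"
proof (cases "z = 0")
  case True
  then show thesis using that[of a] by simp
next
  case False
  then have "cmod (sgn z) = 1" by (simp add: norm_sgn)
  then obtain x where x: "x \<in> {a..<a+1}" "sgn z = zeta x" by (rule zeta_surj[where a=a])
  then have "z = complex_of_real (cmod z) * zeta x"
    using False by (simp add: sgn_eq[of z] x(2)[symmetric])
  then show thesis using that x by blast
qed

lemma zeta_coordinates_dist:
  assumes "cmod z < 1" "z = of_real (cmod z) * zeta x"
  shows "cmod (z - zeta x) = 1 - cmod z"
proof -
  have "z - zeta x = of_real (cmod z - 1) * zeta x" by (subst (1) assms(2)) (simp add: algebra_simps)
  then show ?thesis using assms(1) by (simp add: norm_mult del: of_real_diff)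
qed

lemma norm_zeta_diff_le7: "cmod (zeta x - zeta y) \<le> 7 * \<bar>x - y\<bar>"
proof -
  have "2 * pi * \<bar>x - y\<bar> \<le> 7 * \<bar>x - y\<bar>" using pi_approx by (intro mult_right_mono) auto
  then show ?thesis using norm_zeta_diff_le order_trans by blast
qed

section \<open>Cauchy's and Poisson's integral formulas\<close>

lemma continuous_integrable_circ:
  fixes f :: "real \<Rightarrow> 'b::euclidean_space"
  assumes "continuous_on {0..1} f"
  shows "integrable circ f" "(LINT x|circ. f x) = integral {0..1} f"
proof -
  have "set_integrable lborel {0..1} f" using assms by (rule borel_integrable_atLeastAtMost')
  then show "integrable circ f" "(LINT x|circ. f x) = integral {0..1} f"
    using set_borel_integral_eq_integral[of "{0..1}" f]
    by (auto simp: circ_def integrable_restrict_space integral_restrict_space set_integrable_def set_lebesgue_integral_def)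
qed

text \<open>The point w may sit off the centre c, because \<open>area_mean_value\<close> moves the
  centre while w stays fixed.\<close>

lemma Cauchy_circ:
  assumes "k holomorphic_on cball c r" "cmod (w - c) < r"
  shows "(LINT x|circ. of_real r * zeta x / (c + of_real r * zeta x - w) * k (c + of_real r * zeta x)) = k w"
proof -
  have r: "r > 0" using assms(2) norm_ge_zero[of "w - c"] by linarith
  let ?F = "\<lambda>x. of_real r * zeta x / (c + of_real r * zeta x - w) * k (c + of_real r * zeta x)"
  have vd: "vector_derivative (circlepath c r) (at x) = 2 * of_real pi * \<i> * (of_real r * zeta x)" for x
    by (simp add: vector_derivative_circlepath zeta_def)
  have cp: "circlepath c r x = c + of_real r * zeta x" for x
    by (simp add: circlepath zeta_def)
  have "((\<lambda>u. k u / (u - w)) has_contour_integral (2 * of_real pi * \<i> * k w)) (circlepath c r)"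
    by (rule Cauchy_integral_circlepath_simple[OF assms])
  then have "((\<lambda>x. k (circlepath c r x) / (circlepath c r x - w) * vector_derivative (circlepath c r) (at x))
     has_integral (2 * of_real pi * \<i> * k w)) {0..1}"
    by (simp add: has_contour_integral)
  then have "((\<lambda>x. k (circlepath c r x) / (circlepath c r x - w) * vector_derivative (circlepath c r) (at x) / (2 * of_real pi * \<i>))
     has_integral (2 * of_real pi * \<i> * k w) / (2 * of_real pi * \<i>)) {0..1}"
    by (rule has_integral_divide)
  moreover have "k (c + of_real r * zeta x) / (c + of_real r * zeta x - w) * (2 * of_real pi * \<i> * (of_real r * zeta x)) / (2 * of_real pi * \<i>)
      = ?F x" for x by simp
  ultimately have "(?F has_integral k w) {0..1}"
    unfolding vd cp by (simp add: mult_ac)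
  moreover have "c + of_real r * zeta x \<noteq> w" for x
  proof
    assume "c + of_real r * zeta x = w"
    then have "cmod (w - c) = cmod (of_real r * zeta x)" by (auto simp: algebra_simps)
    then show False using assms(2) r by (simp add: norm_mult)
  qed
  then have "continuous_on {0..1} ?F"
    using r by (intro continuous_intros continuous_on_compose2[OF holomorphic_on_imp_continuous_on[OF assms(1)]])
      (auto simp: dist_norm norm_mult)
  then have "(LINT x|circ. ?F x) = integral {0..1} ?F" by (rule continuous_integrable_circ)
  ultimately show ?thesis using integral_unique[of ?F "k w" "{0..1}"] by simp
qed

definition pois :: "complex \<Rightarrow> real \<Rightarrow> real" where
  "pois w x = (1 - (cmod w)\<^sup>2) / (cmod (zeta x - w))\<^sup>2"

lemma zeta_neq: "cmod w < 1 \<Longrightarrow> zeta x \<noteq> w"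
  using norm_zeta[of x] by auto

lemma norm_zeta_minus_ge: "1 - cmod w \<le> cmod (zeta x - w)"
  using norm_triangle_ineq2[of "zeta x" w] by simp

lemma pois_nonneg: "cmod w < 1 \<Longrightarrow> 0 \<le> pois w x"
  by (simp add: pois_def power_le_one_iff abs_square_le_1)

lemma pois_le: assumes "cmod w < 1" shows "pois w x \<le> 2 / (1 - cmod w)"
proof -
  have "(1 - cmod w)\<^sup>2 \<le> (cmod (zeta x - w))\<^sup>2"
    using norm_zeta_minus_ge assms by (intro power_mono) auto
  then have "pois w x \<le> (1 - (cmod w)\<^sup>2) / (1 - cmod w)\<^sup>2"
    unfolding pois_def using assms by (intro divide_left_mono) (auto simp: abs_square_le_1 zero_less_mult_iff zeta_neq)
  also have "\<dots> = (1 + cmod w) / (1 - cmod w)"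
  proof -
    have "1 - (cmod w)\<^sup>2 = (1 + cmod w) * (1 - cmod w)" by (simp add: power2_eq_square algebra_simps)
    then show ?thesis using assms by (simp add: power2_eq_square)
  qed
  also have "\<dots> \<le> 2 / (1 - cmod w)" using assms by (intro divide_right_mono) auto
  finally show ?thesis .
qed

lemma pois_le2: assumes "cmod w < 1" shows "pois w x \<le> 2 * (1 - cmod w) / (cmod (zeta x - w))\<^sup>2"
proof -
  have "1 - (cmod w)\<^sup>2 = (1 + cmod w) * (1 - cmod w)" by (simp add: power2_eq_square algebra_simps)
  also have "\<dots> \<le> 2 * (1 - cmod w)" using assms by (intro mult_right_mono) auto
  finally show ?thesis unfolding pois_def by (intro divide_right_mono) auto
qed

lemma continuous_on_pois [continuous_intros]: "cmod w < 1 \<Longrightarrow> continuous_on A (pois w)"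
  unfolding pois_def by (intro continuous_intros) (auto simp: zeta_neq)

lemma measurable_pois [measurable (raw)]:
  assumes [measurable]: "f \<in> borel_measurable M" "g \<in> borel_measurable M"
  shows "(\<lambda>t. pois (f t) (g t)) \<in> borel_measurable M"
  unfolding pois_def by measurable

lemma pois_Re: assumes "cmod w < 1" shows "Re ((zeta x + w) / (zeta x - w)) = pois w x"
proof -
  have "(zeta x + w) / (zeta x - w) = (zeta x + w) * cnj (zeta x - w) / (cmod (zeta x - w))\<^sup>2"
    using complex_div_cnj[of "zeta x + w" "zeta x - w"] by simp
  then have "Re ((zeta x + w) / (zeta x - w)) = Re ((zeta x + w) * cnj (zeta x - w)) / (cmod (zeta x - w))\<^sup>2"
    by (metis Re_divide_of_real of_real_power)
  moreover have "Re ((zeta x + w) * cnj (zeta x - w)) = (cmod (zeta x))\<^sup>2 - (cmod w)\<^sup>2"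
    unfolding cmod_power2 by (simp add: algebra_simps power2_eq_square)
  ultimately show ?thesis by (simp add: pois_def)
qed

text \<open>For a mean over the circle of radius r, this turns integration over the argument of the
  pole into integration over the boundary variable, where the kernel has mass 1.\<close>

lemma pois_symm: "pois (of_real r * zeta x) y = pois (of_real r * zeta y) x"
proof -
  have "(cmod (zeta y - of_real r * zeta x))\<^sup>2 = (cmod (zeta x - of_real r * zeta y))\<^sup>2"
  proof -
    have n: "(Re (zeta t))\<^sup>2 + (Im (zeta t))\<^sup>2 = 1" for t
      using cmod_power2[of "zeta t"] by simp
    have "(cmod (zeta y - of_real r * zeta x))\<^sup>2 = ((Re (zeta y))\<^sup>2 + (Im (zeta y))\<^sup>2)
        + r\<^sup>2 * ((Re (zeta x))\<^sup>2 + (Im (zeta x))\<^sup>2) - 2 * r * (Re (zeta x) * Re (zeta y) + Im (zeta x) * Im (zeta y))" for x y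
      unfolding cmod_power2 by (simp add: power2_eq_square algebra_simps)
    then have F: "(cmod (zeta y - of_real r * zeta x))\<^sup>2 = 1 + r\<^sup>2 - 2 * r * (Re (zeta x) * Re (zeta y) + Im (zeta x) * Im (zeta y))" for x y
      by (simp add: n)
    show ?thesis unfolding F by (simp add: mult.commute)
  qed
  then show ?thesis by (simp add: pois_def norm_mult)
qed

lemma Poisson_formula:
  assumes k: "k holomorphic_on cball 0 1" and w: "cmod w < 1"
  shows "(LINT x|circ. of_real (pois w x) * k (zeta x)) = k w"
proof -
  \<comment> \<open>K is holomorphic on the closed disc and agrees with k at w; on the unit circle
    its extra factor turns the Cauchy kernel into the Poisson kernel.\<close>
  define K where "K u = k u * (1 - (cmod w)\<^sup>2) / (1 - cnj w * u)" for u
  have nz: "cnj w * u \<noteq> 1" if "cmod u \<le> 1" for u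
  proof
    assume "cnj w * u = 1"
    then have "cmod (cnj w * u) = 1" by simp
    moreover have "cmod (cnj w * u) \<le> cmod w" using that by (simp add: norm_mult mult_left_le)
    ultimately show False using w by linarith
  qed
  have "K holomorphic_on cball 0 1"
    unfolding K_def by (intro holomorphic_intros k) (auto simp: nz)
  then have "(LINT x|circ. of_real 1 * zeta x / (0 + of_real 1 * zeta x - w) * K (0 + of_real 1 * zeta x)) = K w"
    by (rule Cauchy_circ) (use w in auto)
  moreover have "K w = k w"
    using nz[of w] w complex_norm_square[of w] by (simp add: K_def mult.commute)
  moreover have "of_real 1 * zeta x / (0 + of_real 1 * zeta x - w) * K (0 + of_real 1 * zeta x)
     = of_real (pois w x) * k (zeta x)" for x
  proof -
    have cn: "cnj (zeta x) * zeta x = 1" using complex_norm_square[of "zeta x"] by (simp add: mult.commute)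
    have "1 - cnj w * zeta x = cnj (zeta x - w) * zeta x" using cn by (simp add: algebra_simps)
    moreover have "complex_of_real (pois w x) = (1 - (cmod w)\<^sup>2) / ((zeta x - w) * cnj (zeta x - w))"
      unfolding complex_norm_square[symmetric] by (simp add: pois_def)
    ultimately show ?thesis by (simp add: K_def)
  qed
  ultimately show ?thesis by simp
qed

lemma integral_pois: assumes "cmod w < 1" shows "(LINT x|circ. pois w x) = 1"
proof -
  have "(LINT x|circ. of_real (pois w x) * 1) = (1::complex)"
    by (rule Poisson_formula) (use assms in auto)
  then have "(LINT x|circ. complex_of_real (pois w x)) = 1" by simp
  then show ?thesis by (simp only: integral_complex_of_real) simp
qed

lemma integrable_pois: "cmod w < 1 \<Longrightarrow> integrable circ (pois w)"
  by (intro continuous_integrable_circ continuous_intros)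

lemma nn_integral_pois: assumes "cmod w < 1" shows "(\<integral>\<^sup>+x. pois w x \<partial>circ) = 1"
  using nn_integral_eq_integral[OF integrable_pois[OF assms]] pois_nonneg[OF assms]
  by (simp add: integral_pois[OF assms])

lemma integrable_pois_mult:
  assumes "cmod w < 1" and v: "integrable circ (v :: real \<Rightarrow> real)"
  shows "integrable circ (\<lambda>x. pois w x * v x)"
proof (rule Bochner_Integration.integrable_bound[OF integrable_mult_right[OF v, of "2 / (1 - cmod w)"]])
  have [measurable]: "v \<in> borel_measurable circ" using v by simp
  show "(\<lambda>x. pois w x * v x) \<in> borel_measurable circ" by measurable
  have "norm (pois w x * v x) \<le> norm (2 / (1 - cmod w) * v x)" for x
  proof -
    have "pois w x * \<bar>v x\<bar> \<le> 2 / (1 - cmod w) * \<bar>v x\<bar>"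
      by (intro mult_right_mono pois_le assms) auto
    then show ?thesis using pois_nonneg[OF assms(1)] assms(1) by (simp add: abs_mult)
  qed
  then show "AE x in circ. norm (pois w x * v x) \<le> norm (2 / (1 - cmod w) * v x)" by simp
qed

text \<open>Jensen's inequality for the probability density \<open>pois w\<close>: integrate the
  tangent of exp at the mean m. If the right side is infinite there is nothing to prove.\<close>

lemma exp_pois_le:
  assumes w: "cmod w < 1" and v: "integrable circ v"
  shows "ennreal (exp (LINT x|circ. pois w x * v x)) \<le> (\<integral>\<^sup>+x. ennreal (pois w x * exp (v x)) \<partial>circ)"
proof -
  define m where "m = (LINT x|circ. pois w x * v x)"
  have [measurable]: "v \<in> borel_measurable circ" using v by simp
  show ?thesis
  proof (cases "integrable circ (\<lambda>x. pois w x * exp (v x))")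
    case True
    have "(LINT x|circ. exp m * (pois w x * (1 - m) + pois w x * v x)) \<le> (LINT x|circ. pois w x * exp (v x))"
    proof (rule integral_mono[OF _ True])
      show "integrable circ (\<lambda>x. exp m * (pois w x * (1 - m) + pois w x * v x))"
        using integrable_pois[OF w] integrable_pois_mult[OF w v]
        by (intro integrable_mult_right Bochner_Integration.integrable_add integrable_mult_left)
      fix x
      have "exp m * (1 + (v x - m)) \<le> exp m * exp (v x - m)"
        by (intro mult_left_mono exp_ge_add_one_self) auto
      then have "pois w x * (exp m * (1 + (v x - m))) \<le> pois w x * exp (v x)"
        using pois_nonneg[OF w] by (intro mult_left_mono) (auto simp: exp_add[symmetric])
      then show "exp m * (pois w x * (1 - m) + pois w x * v x) \<le> pois w x * exp (v x)"
        by (simp add: algebra_simps)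
    qed
    moreover have "(LINT x|circ. exp m * (pois w x * (1 - m) + pois w x * v x)) = exp m"
      using integrable_pois[OF w] integrable_pois_mult[OF w v]
      by (simp add: integral_pois[OF w] m_def[symmetric] Bochner_Integration.integral_add)
    ultimately show ?thesis
      using nn_integral_eq_integral[OF True] pois_nonneg[OF w] by (simp add: m_def[symmetric] ennreal_leI)
  next
    case False
    then have "(\<integral>\<^sup>+x. ennreal (pois w x * exp (v x)) \<partial>circ) = \<infinity>"
      using pois_nonneg[OF w] by (auto simp: integrable_iff_bounded less_top[symmetric])
    then show ?thesis by simp
  qed
qed

section \<open>A Poisson-type maximal function\<close>

text \<open>Comparable to the Poisson kernel at height d above x, see \<open>ker_le_pois\<close> and
  \<open>pois_le_ker\<close>; in this form the triangle inequality for chords acts on it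
  directly.\<close>

definition ker :: "real \<Rightarrow> real \<Rightarrow> real \<Rightarrow> real" where
  "ker d x y = d / (d + cmod (zeta x - zeta y))\<^sup>2"

lemma ker_nonneg: "0 \<le> d \<Longrightarrow> 0 \<le> ker d x y"
  by (simp add: ker_def)

lemma ker_le: assumes "0 < d" shows "ker d x y \<le> 1 / d"
proof -
  have "d\<^sup>2 \<le> (d + cmod (zeta x - zeta y))\<^sup>2" using assms by (intro power_mono) auto
  then have "ker d x y \<le> d / d\<^sup>2" unfolding ker_def using assms by (intro divide_left_mono) (auto intro!: mult_pos_pos zero_less_power add_pos_nonneg)
  then show ?thesis using assms by (simp add: power2_eq_square)
qed

lemma measurable_ker [measurable (raw)]:
  assumes [measurable]: "d \<in> borel_measurable M" "f \<in> borel_measurable M" "g \<in> borel_measurable M"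
  shows "(\<lambda>t. ker (d t) (f t) (g t)) \<in> borel_measurable M"
  unfolding ker_def by measurable

lemma ker_le_pois:
  assumes "0 < d" "d \<le> 1" shows "ker d x y \<le> pois (of_real (1 - d) * zeta x) y"
proof -
  let ?w = "of_real (1 - d) * zeta x"
  have nw: "cmod ?w = 1 - d" using assms by (simp add: norm_mult del: of_real_diff)
  then have w: "cmod ?w < 1" using assms by simp
  have "cmod (zeta y - ?w) \<le> cmod (zeta y - zeta x) + cmod (of_real d * zeta x)"
    by (rule order_trans[OF _ norm_triangle_ineq]) (simp add: algebra_simps)
  then have le: "cmod (zeta y - ?w) \<le> d + cmod (zeta x - zeta y)"
    using assms by (simp add: norm_mult norm_minus_commute)
  have "d * d \<le> d * 1" using assms by (intro mult_left_mono) auto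
  then have "d \<le> 1 - (cmod ?w)\<^sup>2" unfolding nw using assms by (simp add: power2_eq_square algebra_simps)
  moreover have "(cmod (zeta y - ?w))\<^sup>2 \<le> (d + cmod (zeta x - zeta y))\<^sup>2" using le by (intro power_mono) auto
  moreover have "0 < (cmod (zeta y - ?w))\<^sup>2" using zeta_neq[OF w] by simp
  ultimately show ?thesis unfolding ker_def pois_def using assms by (intro frac_le) auto
qed

lemma nn_integral_ker_le: assumes "0 < d" "d \<le> 1" shows "(\<integral>\<^sup>+y. ker d x y \<partial>circ) \<le> 1"
proof -
  have "(\<integral>\<^sup>+y. ker d x y \<partial>circ) \<le> (\<integral>\<^sup>+y. pois (of_real (1 - d) * zeta x) y \<partial>circ)"
    using ker_le_pois[OF assms] by (intro nn_integral_mono ennreal_leI)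
  also have "\<dots> = 1" using assms by (intro nn_integral_pois) (simp add: norm_mult del: of_real_diff)
  finally show ?thesis .
qed

lemma ker_mono:
  assumes "0 < d" "cmod (zeta x - zeta y) \<le> 2 * cmod (zeta x - zeta z)"
  shows "ker d x z \<le> 4 * ker d x y"
proof -
  have "(d + cmod (zeta x - zeta y)) \<le> 2 * (d + cmod (zeta x - zeta z))" using assms by simp
  then have "(d + cmod (zeta x - zeta y))\<^sup>2 \<le> (2 * (d + cmod (zeta x - zeta z)))\<^sup>2"
    using assms by (intro power_mono) auto
  then have "(d + cmod (zeta x - zeta y))\<^sup>2 \<le> 4 * (d + cmod (zeta x - zeta z))\<^sup>2"
    by (simp add: power2_eq_square algebra_simps)
  moreover have "0 < (d + cmod (zeta x - t))\<^sup>2" for t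
    using assms by (intro zero_less_power add_pos_nonneg; simp)
  moreover have "d / Y \<le> 4 * (d / X)" if "X \<le> 4 * Y" "0 < X" "0 < Y" for X Y
  proof -
    have "4 * d / (4 * Y) \<le> 4 * d / X" using that assms by (intro divide_left_mono) auto
    then show ?thesis by simp
  qed
  ultimately show ?thesis unfolding ker_def by blast
qed

text \<open>The longer of the two legs from x and y to z is at least half the chord from x to y; in
  its kernel z may be replaced by the other point at the cost of a factor 4. The scales d and e are
  independent of each other, as a linearized maximal operator requires.\<close>

lemma ker_mult_le:
  assumes "0 < d" "0 < e"
  shows "ker d x z * ker e y z \<le> 4 * (ker d x y * ker e y z) + 4 * (ker e y x * ker d x z)"
proof (cases "cmod (zeta y - zeta z) \<le> cmod (zeta x - zeta z)")
  case True
  have "cmod (zeta x - zeta y) \<le> cmod (zeta x - zeta z) + cmod (zeta y - zeta z)"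
    using norm_triangle_ineq4[of "zeta x - zeta z" "zeta y - zeta z"] by simp
  then have "ker d x z * ker e y z \<le> 4 * ker d x y * ker e y z"
    using True assms by (intro mult_right_mono ker_mono ker_nonneg) auto
  moreover have "0 \<le> ker e y x * ker d x z" using assms by (simp add: ker_nonneg)
  ultimately show ?thesis by simp
next
  case False
  have "cmod (zeta y - zeta x) \<le> cmod (zeta y - zeta z) + cmod (zeta x - zeta z)"
    using norm_triangle_ineq4[of "zeta y - zeta z" "zeta x - zeta z"] by simp
  then have "ker d x z * ker e y z \<le> ker d x z * (4 * ker e y x)"
    using False assms by (intro mult_left_mono ker_mono ker_nonneg) auto
  moreover have "0 \<le> ker d x y * ker e y z" using assms by (simp add: ker_nonneg)
  ultimately show ?thesis by (simp add: mult.commute)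
qed

text \<open>Closes both quadratic arguments; its finiteness assumption is what the a priori bounds
  before each use provide.\<close>

lemma ennreal_le_of_square_le:
  fixes a c :: ennreal assumes "a\<^sup>2 \<le> c * a" "a < top" shows "a \<le> c"
proof (cases "a = 0")
  case False
  then have "a * a / a \<le> c * a / a" using assms by (intro divide_right_mono_ennreal) (simp add: power2_eq_square)
  then show ?thesis using False assms by (simp add: ennreal_times_divide[symmetric] ennreal_divide_self less_top)
qed simp

text \<open>This inequality plays the role of a T T* argument: it bounds the square of a balayage by
  another balayage, with no covering argument.\<close>

lemma square_balayage_le:
  fixes k :: "'a \<Rightarrow> 'b \<Rightarrow> ennreal"
  assumes "sigma_finite_measure M"
    and [measurable]: "G \<in> borel_measurable M" "(\<lambda>x. k x z) \<in> borel_measurable M"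
      "(\<lambda>(x, y). k x (\<pi> y)) \<in> borel_measurable (M \<Otimes>\<^sub>M M)"
    and k: "\<And>x y. k x z * k y z \<le> 4 * (k x (\<pi> y) * k y z) + 4 * (k y (\<pi> x) * k x z)"
  defines "B \<equiv> \<lambda>z. \<integral>\<^sup>+x. G x * k x z \<partial>M"
  shows "(B z)\<^sup>2 \<le> 8 * (\<integral>\<^sup>+x. G x * B (\<pi> x) * k x z \<partial>M)"
proof -
  interpret sigma_finite_measure M by fact
  interpret pair_sigma_finite M M ..
  have m1 [measurable]: "(\<lambda>p. k (snd p) (\<pi> (fst p))) \<in> borel_measurable (M \<Otimes>\<^sub>M M)"
    "(\<lambda>p. k (fst p) (\<pi> (snd p))) \<in> borel_measurable (M \<Otimes>\<^sub>M M)"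
    using assms(4) measurable_compose[OF measurable_pair_swap' assms(4)]
    by (simp_all add: case_prod_beta')
  have m2: "(\<lambda>y. k y (\<pi> x)) \<in> borel_measurable M" if "x \<in> space M" for x
    using measurable_compose[OF measurable_Pair1'[OF that] m1(1)] by simp
  have m3: "(\<lambda>y. k x (\<pi> y)) \<in> borel_measurable M" if "x \<in> space M" for x
    using measurable_compose[OF measurable_Pair1'[OF that] m1(2)] by simp
  have m4 [measurable]: "(\<lambda>x. B (\<pi> x)) \<in> borel_measurable M"
    unfolding B_def by measurable
  have "(B z)\<^sup>2 = (\<integral>\<^sup>+x. \<integral>\<^sup>+y. (G x * k x z) * (G y * k y z) \<partial>M \<partial>M)"
    by (simp add: B_def power2_eq_square nn_integral_cmult nn_integral_multc)
  also have "\<dots> \<le> (\<integral>\<^sup>+x. \<integral>\<^sup>+y. 4 * (G x * k x (\<pi> y) * (G y * k y z)) + 4 * (G x * k x z * (G y * k y (\<pi> x))) \<partial>M \<partial>M)"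
  proof (intro nn_integral_mono)
    fix x y
    have "(G x * k x z) * (G y * k y z) = (G x * G y) * (k x z * k y z)" by (simp add: ac_simps)
    also have "\<dots> \<le> (G x * G y) * (4 * (k x (\<pi> y) * k y z) + 4 * (k y (\<pi> x) * k x z))"
      by (intro mult_left_mono k) auto
    also have "\<dots> = 4 * (G x * k x (\<pi> y) * (G y * k y z)) + 4 * (G x * k x z * (G y * k y (\<pi> x)))"
      by (simp add: distrib_left ac_simps)
    finally show "(G x * k x z) * (G y * k y z) \<le> \<dots>" .
  qed
  also have "\<dots> = (\<integral>\<^sup>+x. 4 * (\<integral>\<^sup>+y. G x * k x (\<pi> y) * (G y * k y z) \<partial>M) + 4 * (\<integral>\<^sup>+y. G x * k x z * (G y * k y (\<pi> x)) \<partial>M) \<partial>M)"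
  proof (intro nn_integral_cong)
    fix x assume x: "x \<in> space M"
    note [measurable] = m2[OF x] m3[OF x]
    show "(\<integral>\<^sup>+y. 4 * (G x * k x (\<pi> y) * (G y * k y z)) + 4 * (G x * k x z * (G y * k y (\<pi> x))) \<partial>M)
      = 4 * (\<integral>\<^sup>+y. G x * k x (\<pi> y) * (G y * k y z) \<partial>M) + 4 * (\<integral>\<^sup>+y. G x * k x z * (G y * k y (\<pi> x)) \<partial>M)"
      by (subst nn_integral_add) (auto simp: nn_integral_cmult)
  qed
  also have "\<dots> = 4 * (\<integral>\<^sup>+x. \<integral>\<^sup>+y. G x * k x (\<pi> y) * (G y * k y z) \<partial>M \<partial>M)
     + 4 * (\<integral>\<^sup>+x. \<integral>\<^sup>+y. G x * k x z * (G y * k y (\<pi> x)) \<partial>M \<partial>M)"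
    by (subst nn_integral_add) (auto simp: nn_integral_cmult)
  \<comment> \<open>Here x carries the kernel that ends at \<open>\<pi> y\<close>, so it has to be
    integrated first.\<close>
  also have "(\<integral>\<^sup>+x. \<integral>\<^sup>+y. G x * k x (\<pi> y) * (G y * k y z) \<partial>M \<partial>M)
     = (\<integral>\<^sup>+y. \<integral>\<^sup>+x. G x * k x (\<pi> y) * (G y * k y z) \<partial>M \<partial>M)"
    by (rule Fubini') measurable
  also have "\<dots> = (\<integral>\<^sup>+x. G x * B (\<pi> x) * k x z \<partial>M)"
  proof (intro nn_integral_cong)
    fix y assume y: "y \<in> space M"
    note [measurable] = m2[OF y]
    have "(\<integral>\<^sup>+x. G x * k x (\<pi> y) * (G y * k y z) \<partial>M) = B (\<pi> y) * (G y * k y z)"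
      unfolding B_def by (rule nn_integral_multc) measurable
    then show "(\<integral>\<^sup>+x. G x * k x (\<pi> y) * (G y * k y z) \<partial>M) = G y * B (\<pi> y) * k y z"
      by (simp add: ac_simps)
  qed
  also have "(\<integral>\<^sup>+x. \<integral>\<^sup>+y. G x * k x z * (G y * k y (\<pi> x)) \<partial>M \<partial>M) = (\<integral>\<^sup>+x. G x * B (\<pi> x) * k x z \<partial>M)"
  proof (intro nn_integral_cong)
    fix y assume y: "y \<in> space M"
    note [measurable] = m2[OF y]
    have "(\<integral>\<^sup>+x. G y * k y z * (G x * k x (\<pi> y)) \<partial>M) = G y * k y z * B (\<pi> y)"
      unfolding B_def by (rule nn_integral_cmult) measurable
    then show "(\<integral>\<^sup>+x. G y * k y z * (G x * k x (\<pi> y)) \<partial>M) = G y * B (\<pi> y) * k y z"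
      by (simp add: ac_simps)
  qed
  also have "4 * (\<integral>\<^sup>+x. G x * B (\<pi> x) * k x z \<partial>M) + 4 * (\<integral>\<^sup>+x. G x * B (\<pi> x) * k x z \<partial>M)
     = 8 * (\<integral>\<^sup>+x. G x * B (\<pi> x) * k x z \<partial>M)"
    by (simp add: distrib_right[symmetric])
  finally show ?thesis .
qed

text \<open>\<open>B\<close> is the adjoint of the map from V to S, applied to S itself, so the
  integral of S^2 equals that of V B. The kernels have mass at most 1, hence
  \<open>square_balayage_le\<close> bounds the integral of B^2 by 8 times that of S B, so |B| \<le>
  8 |S| in L^2; Cauchy-Schwarz leaves |S| \<le> 8 |V|. The bound e from below on the scale secures
  finiteness and leaves no trace in the constant.\<close>

lemma linearized_maximal_L2:
  fixes V :: "real \<Rightarrow> ennreal" and d :: "real \<Rightarrow> real"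
  assumes V [measurable]: "V \<in> borel_measurable circ"
    and dm [measurable]: "d \<in> borel_measurable borel" and d: "0 < e" "\<And>x. e \<le> d x" "\<And>x. d x \<le> 1"
  defines "S \<equiv> \<lambda>x. \<integral>\<^sup>+y. ker (d x) x y * V y \<partial>circ"
  shows "(\<integral>\<^sup>+x. (S x)\<^sup>2 \<partial>circ) \<le> 64 * (\<integral>\<^sup>+x. (V x)\<^sup>2 \<partial>circ)"
proof (cases "(\<integral>\<^sup>+x. (V x)\<^sup>2 \<partial>circ) = top")
  case True
  then show ?thesis by (simp add: ennreal_mult_top)
next
  case False
  have d0: "0 < d x" for x using d(1) d(2)[of x] by linarith
  interpret pair_sigma_finite circ circ ..
  have [measurable]: "d \<in> borel_measurable circ" by (rule measurable_circ) simp
  have [measurable]: "S \<in> borel_measurable circ" unfolding S_def by measurable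
  define B where "B z = (\<integral>\<^sup>+x. S x * ennreal (ker (d x) x z) \<partial>circ)" for z
  have [measurable]: "B \<in> borel_measurable circ" unfolding B_def by measurable
  let ?v = "\<integral>\<^sup>+x. (V x)\<^sup>2 \<partial>circ" and ?s = "\<integral>\<^sup>+x. (S x)\<^sup>2 \<partial>circ" and ?b = "\<integral>\<^sup>+x. (B x)\<^sup>2 \<partial>circ"
  let ?c = "ennreal (1 / e)"
  \<comment> \<open>A crude bound, whose purpose is the finiteness of the square integrals of S and
    B.\<close>
  have kle: "ennreal (ker (d x) x y) \<le> ?c" for x y
  proof (rule ennreal_leI)
    have "ker (d x) x y \<le> 1 / d x" by (rule ker_le[OF d0])
    also have "\<dots> \<le> 1 / e" using d(1) d(2)[of x] by (intro divide_left_mono) auto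
    finally show "ker (d x) x y \<le> 1 / e" .
  qed
  have sq: "(\<integral>\<^sup>+x. f x \<partial>circ)\<^sup>2 \<le> (\<integral>\<^sup>+x. (f x)\<^sup>2 \<partial>circ)" if [measurable]: "f \<in> borel_measurable circ" for f
    using Cauchy_Schwarz_nn_integral[of f circ "\<lambda>_. 1"] by simp
  have Sle: "S x \<le> ?c * (\<integral>\<^sup>+x. V x \<partial>circ)" for x
    unfolding S_def by (subst nn_integral_cmult[symmetric]) (auto intro!: nn_integral_mono mult_right_mono kle)
  have Ble: "B z \<le> ?c * (\<integral>\<^sup>+x. S x \<partial>circ)" for z
    unfolding B_def by (subst nn_integral_cmult[symmetric]) (auto intro!: nn_integral_mono mult_left_mono kle simp: mult.commute[of ?c])
  have Vfin: "(\<integral>\<^sup>+x. V x \<partial>circ) < top"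
  proof -
    have "(\<integral>\<^sup>+x. V x \<partial>circ)\<^sup>2 < top" using sq[OF V] False by (simp add: less_top order_le_less_trans)
    then show ?thesis by (simp add: power2_eq_square ennreal_mult_less_top less_top[symmetric]) (metis ennreal_mult_eq_top_iff top.not_eq_extremum mult_eq_0_iff)
  qed
  have bound: "(\<integral>\<^sup>+x. f x \<partial>circ) < top" if "\<And>x. f x \<le> C" "C < top" for f C
  proof -
    have "(\<integral>\<^sup>+x. f x \<partial>circ) \<le> (\<integral>\<^sup>+x. C \<partial>circ)" by (intro nn_integral_mono that)
    then show ?thesis using that(2) by simp
  qed
  have ct: "?c * (\<integral>\<^sup>+x. V x \<partial>circ) < top" using Vfin by (simp add: ennreal_mult_less_top)
  have sfin: "?s < top"
    by (rule bound[OF power_mono[OF Sle]]) (use ct in \<open>auto simp: power2_eq_square ennreal_mult_less_top\<close>)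
  have "(\<integral>\<^sup>+x. S x \<partial>circ) < top" by (rule bound[OF Sle ct])
  then have ct2: "?c * (\<integral>\<^sup>+x. S x \<partial>circ) < top" by (simp add: ennreal_mult_less_top)
  have bfin: "?b < top"
    by (rule bound[OF power_mono[OF Ble]]) (use ct2 in \<open>auto simp: power2_eq_square ennreal_mult_less_top\<close>)
  have "(B z)\<^sup>2 \<le> 8 * (\<integral>\<^sup>+x. S x * B x * ennreal (ker (d x) x z) \<partial>circ)" for z
    unfolding B_def
  proof (rule square_balayage_le[where k="\<lambda>x z. ennreal (ker (d x) x z)" and \<pi>="\<lambda>x. x"])
    show "sigma_finite_measure circ" ..
    fix x y
    have "ennreal (ker (d x) x z * ker (d y) y z) \<le> ennreal (4 * (ker (d x) x y * ker (d y) y z) + 4 * (ker (d y) y x * ker (d x) x z))"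
      by (intro ennreal_leI ker_mult_le d0)
    then show "ennreal (ker (d x) x z) * ennreal (ker (d y) y z)
      \<le> 4 * (ennreal (ker (d x) x y) * ennreal (ker (d y) y z)) + 4 * (ennreal (ker (d y) y x) * ennreal (ker (d x) x z))"
      using d0 by (simp add: ennreal_mult'[symmetric] ennreal_plus[symmetric] ker_nonneg less_imp_le ennreal_numeral[symmetric] del: ennreal_plus ennreal_numeral)
  qed measurable
  then have "?b \<le> (\<integral>\<^sup>+z. 8 * (\<integral>\<^sup>+x. S x * B x * ennreal (ker (d x) x z) \<partial>circ) \<partial>circ)"
    by (intro nn_integral_mono)
  also have "\<dots> = 8 * (\<integral>\<^sup>+z. \<integral>\<^sup>+x. S x * B x * ennreal (ker (d x) x z) \<partial>circ \<partial>circ)"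
    by (rule nn_integral_cmult) measurable
  also have "(\<integral>\<^sup>+z. \<integral>\<^sup>+x. S x * B x * ennreal (ker (d x) x z) \<partial>circ \<partial>circ)
     = (\<integral>\<^sup>+x. \<integral>\<^sup>+z. S x * B x * ennreal (ker (d x) x z) \<partial>circ \<partial>circ)"
    by (rule Fubini') measurable
  also have "\<dots> = (\<integral>\<^sup>+x. S x * B x * (\<integral>\<^sup>+z. ennreal (ker (d x) x z) \<partial>circ) \<partial>circ)"
    by (intro nn_integral_cong nn_integral_cmult) measurable
  also have "\<dots> \<le> (\<integral>\<^sup>+x. S x * B x * 1 \<partial>circ)"
    by (intro nn_integral_mono mult_left_mono nn_integral_ker_le d0 d(3)) auto
  finally have "?b \<le> 8 * (\<integral>\<^sup>+x. S x * B x \<partial>circ)" by (simp add: mult_left_mono)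
  then have "?b\<^sup>2 \<le> (8 * (\<integral>\<^sup>+x. S x * B x \<partial>circ))\<^sup>2" by (intro power_mono) auto
  also have "\<dots> = 64 * (\<integral>\<^sup>+x. S x * B x \<partial>circ)\<^sup>2" by (simp add: power_mult_distrib)
  also have "\<dots> \<le> 64 * (?s * ?b)" by (intro mult_left_mono Cauchy_Schwarz_nn_integral) auto
  also have "\<dots> = (64 * ?s) * ?b" by (rule mult.assoc[symmetric])
  finally have bs: "?b \<le> 64 * ?s" by (rule ennreal_le_of_square_le[OF _ bfin])
  have "?s = (\<integral>\<^sup>+x. \<integral>\<^sup>+y. S x * (ker (d x) x y * V y) \<partial>circ \<partial>circ)"
  proof (intro nn_integral_cong)
    fix x
    have "(\<integral>\<^sup>+y. S x * (ker (d x) x y * V y) \<partial>circ) = S x * (\<integral>\<^sup>+y. ker (d x) x y * V y \<partial>circ)"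
      by (rule nn_integral_cmult) measurable
    also have "(\<integral>\<^sup>+y. ker (d x) x y * V y \<partial>circ) = S x" by (simp add: S_def)
    finally show "(S x)\<^sup>2 = (\<integral>\<^sup>+y. S x * (ker (d x) x y * V y) \<partial>circ)" by (simp add: power2_eq_square)
  qed
  also have "\<dots> = (\<integral>\<^sup>+y. \<integral>\<^sup>+x. S x * (ker (d x) x y * V y) \<partial>circ \<partial>circ)"
    by (rule Fubini') measurable
  also have "\<dots> = (\<integral>\<^sup>+y. V y * B y \<partial>circ)"
    unfolding B_def by (subst nn_integral_cmult[symmetric]) (auto intro!: nn_integral_cong simp: ac_simps)
  finally have "?s\<^sup>2 = (\<integral>\<^sup>+y. V y * B y \<partial>circ)\<^sup>2" by simp
  also have "\<dots> \<le> ?v * ?b" by (intro Cauchy_Schwarz_nn_integral) auto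
  also have "\<dots> \<le> ?v * (64 * ?s)" by (intro mult_left_mono bs) auto
  also have "\<dots> = (64 * ?v) * ?s" by (simp only: mult.assoc mult.left_commute)
  finally show ?thesis by (rule ennreal_le_of_square_le[OF _ sfin])
qed

text \<open>Dyadic scales represent all scales in (0, 1] up to a factor 2, by
  \<open>dyadic_scale\<close>, and a countable supremum stays measurable.\<close>

definition pmax :: "(real \<Rightarrow> ennreal) \<Rightarrow> real \<Rightarrow> ennreal" where
  "pmax V x = (SUP n. \<integral>\<^sup>+y. ennreal (ker (1 / 2 ^ n) x y) * V y \<partial>circ)"

lemma measurable_pmax [measurable]:
  assumes [measurable]: "V \<in> borel_measurable circ"
  shows "pmax V \<in> borel_measurable borel"
  unfolding pmax_def by measurable

lemma pmax_L2:
  assumes V [measurable]: "V \<in> borel_measurable circ"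
  shows "(\<integral>\<^sup>+x. (pmax V x)\<^sup>2 \<partial>circ) \<le> 64 * (\<integral>\<^sup>+x. (V x)\<^sup>2 \<partial>circ)"
proof -
  define T where "T n x = (\<integral>\<^sup>+y. ennreal (ker (1 / 2 ^ n) x y) * V y \<partial>circ)" for n :: nat and x
  have [measurable]: "T n \<in> borel_measurable borel" for n unfolding T_def by measurable
  define S where "S n x = Max ((\<lambda>i. T i x) ` {..n})" for n x
  have S_eq: "S n x = (SUP i\<in>{..n}. T i x)" for n x
    unfolding S_def by (rule Max_Sup) auto
  have [measurable]: "S n \<in> borel_measurable borel" for n unfolding S_eq by measurable
  have bound: "(\<integral>\<^sup>+x. (S n x)\<^sup>2 \<partial>circ) \<le> 64 * (\<integral>\<^sup>+x. (V x)\<^sup>2 \<partial>circ)" for n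
  proof -
    \<comment> \<open>The least maximizing index is a measurable choice of scale; with it the
      maximum over finitely many scales becomes the linear operator of
      \<open>linearized_maximal_L2\<close>.\<close>
    define \<kappa> where "\<kappa> x = (LEAST i. T i x = S n x)" for x
    have [measurable]: "\<kappa> \<in> measurable borel (count_space UNIV)" unfolding \<kappa>_def by measurable
    have ex: "\<exists>i\<le>n. T i x = S n x" for x
    proof -
      have "S n x \<in> (\<lambda>i. T i x) ` {..n}" unfolding S_def by (rule Max_in) auto
      then show ?thesis by (auto simp: eq_commute)
    qed
    have Tk: "T (\<kappa> x) x = S n x" for x
      unfolding \<kappa>_def using LeastI_ex[of "\<lambda>i. T i x = S n x"] ex by blast
    have kn: "\<kappa> x \<le> n" for x
      unfolding \<kappa>_def using ex[of x] Least_le[of "\<lambda>i. T i x = S n x"] le_trans by blast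
    have "(\<integral>\<^sup>+x. (\<integral>\<^sup>+y. ker (1 / 2 ^ \<kappa> x) x y * V y \<partial>circ)\<^sup>2 \<partial>circ) \<le> 64 * (\<integral>\<^sup>+x. (V x)\<^sup>2 \<partial>circ)"
    proof (rule linearized_maximal_L2[where e="1 / 2 ^ n" and d="\<lambda>x. 1 / 2 ^ \<kappa> x" and V=V])
      show "(\<lambda>x. 1 / 2 ^ \<kappa> x :: real) \<in> borel_measurable borel" by measurable
      show "1 / 2 ^ n \<le> (1 / 2 ^ \<kappa> x :: real)" for x
        using kn[of x] by (intro divide_left_mono power_increasing) auto
    qed auto
    then show ?thesis by (simp add: T_def[symmetric] Tk)
  qed
  have incS: "incseq (\<lambda>n. S n x)" for x
    unfolding incseq_def S_eq by (intro allI impI SUP_subset_mono) auto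
  have inc: "incseq (\<lambda>n x. (S n x)\<^sup>2)"
    using incS by (auto simp: incseq_def le_fun_def intro!: power_mono)
  have "(pmax V x)\<^sup>2 = (SUP n. (S n x)\<^sup>2)" for x
  proof -
    have "pmax V x = (SUP n. S n x)"
      unfolding pmax_def T_def[symmetric] S_eq
      by (rule antisym) (auto intro!: SUP_least intro: SUP_upper2 SUP_upper)
    moreover have "(SUP n. S n x)\<^sup>2 = (SUP n. (S n x)\<^sup>2)"
    proof (rule antisym)
      have "S n x * S m x \<le> (SUP n. (S n x)\<^sup>2)" for n m
      proof -
        have "S n x * S m x \<le> (S (max n m) x)\<^sup>2"
          unfolding power2_eq_square using incseqD[OF incS]
          by (intro mult_mono) auto
        also have "\<dots> \<le> (SUP n. (S n x)\<^sup>2)" by (rule SUP_upper) simp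
        finally show ?thesis .
      qed
      then show "(SUP n. S n x)\<^sup>2 \<le> (SUP n. (S n x)\<^sup>2)"
        unfolding power2_eq_square[of "SUP n. S n x"] SUP_mult_left_ennreal SUP_mult_right_ennreal by (intro SUP_least)
      show "(SUP n. (S n x)\<^sup>2) \<le> (SUP n. S n x)\<^sup>2"
        by (intro SUP_least power_mono SUP_upper) auto
    qed
    ultimately show ?thesis by simp
  qed
  then have "(\<integral>\<^sup>+x. (pmax V x)\<^sup>2 \<partial>circ) = (\<integral>\<^sup>+x. (SUP n. (S n x)\<^sup>2) \<partial>circ)" by simp
  also have "\<dots> = (SUP n. \<integral>\<^sup>+x. (S n x)\<^sup>2 \<partial>circ)"
    by (rule nn_integral_monotone_convergence_SUP[OF inc]) (rule measurable_circ, measurable)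
  also have "\<dots> \<le> 64 * (\<integral>\<^sup>+x. (V x)\<^sup>2 \<partial>circ)" by (intro SUP_least bound)
  finally show ?thesis .
qed

section \<open>Geometry of Stolz angles\<close>

lemma dyadic_scale:
  fixes d :: real assumes "0 < d" "d \<le> 1"
  obtains n :: nat where "1 / 2 ^ n \<le> d" "d \<le> 2 * (1 / 2 ^ n)"
proof -
  have "\<exists>n. (1 / 2) ^ n \<le> d"
    using real_arch_pow_inv[OF assms(1), of "1/2"] less_imp_le by auto
  then obtain n where n: "(1 / 2) ^ n \<le> d" "\<And>k. k < n \<Longrightarrow> \<not> (1 / 2) ^ k \<le> d"
    using exists_least_iff[of "\<lambda>n. (1 / 2) ^ n \<le> d"] by blast
  show thesis
  proof (cases n)
    case 0
    then show thesis using n assms by (intro that[of 0]) auto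
  next
    case (Suc k)
    then show thesis using n(1) n(2)[of k] by (intro that[of n]) (auto simp: power_one_over field_simps)
  qed
qed

text \<open>The right side is a union of discs whose centre and radius are affine in t, hence
  convex. Conversely each of its points lies on a segment from \<zeta> to the disc of radius 1/2,
  which is the convex hull of its boundary.\<close>

lemma stolz_iff: "z \<in> stolz \<zeta> \<longleftrightarrow> (\<exists>t\<in>{0..1}. cmod (z - of_real (1 - t) * \<zeta>) \<le> t / 2)"
proof
  let ?S = "{z. \<exists>t\<in>{0..1}. cmod (z - of_real (1 - t) * \<zeta>) \<le> t / 2}"
  have "convex ?S"
    unfolding convex_def
  proof (intro ballI allI impI)
    fix x y :: complex and u v :: real
    assume "x \<in> ?S" "y \<in> ?S" and uv: "0 \<le> u" "0 \<le> v" "u + v = 1"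
    then obtain s t where s: "s \<in> {0..1}" "cmod (x - of_real (1 - s) * \<zeta>) \<le> s / 2"
      and t: "t \<in> {0..1}" "cmod (y - of_real (1 - t) * \<zeta>) \<le> t / 2" by auto
    have "u * s + v * t \<le> u * 1 + v * 1" using s t uv by (intro add_mono mult_left_mono) auto
    moreover have "0 \<le> u * s + v * t" using s t uv by auto
    moreover have "cmod (u *\<^sub>R x + v *\<^sub>R y - of_real (1 - (u * s + v * t)) * \<zeta>) \<le> (u * s + v * t) / 2"
    proof -
      have e: "u *\<^sub>R x + v *\<^sub>R y - of_real (1 - (u * s + v * t)) * \<zeta>
        = of_real u * (x - of_real (1 - s) * \<zeta>) + of_real v * (y - of_real (1 - t) * \<zeta>)"
      proof -
        have v: "v = 1 - u" using uv by simp
        show ?thesis unfolding v by (simp add: scaleR_conv_of_real algebra_simps)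
      qed
      have "cmod \<dots> \<le> u * cmod (x - of_real (1 - s) * \<zeta>) + v * cmod (y - of_real (1 - t) * \<zeta>)"
        by (rule norm_triangle_le) (use uv in \<open>simp add: norm_mult\<close>)
      also have "\<dots> \<le> u * (s / 2) + v * (t / 2)" using s t uv by (intro add_mono mult_left_mono) auto
      finally show ?thesis unfolding e by (simp add: field_simps)
    qed
    ultimately show "u *\<^sub>R x + v *\<^sub>R y \<in> ?S" using uv by (auto intro!: bexI[of _ "u * s + v * t"])
  qed
  moreover have "insert \<zeta> (sphere 0 (1/2)) \<subseteq> ?S" by (auto intro: bexI[of _ 0] bexI[of _ 1])
  ultimately have "stolz \<zeta> \<subseteq> ?S" unfolding stolz_def by (intro hull_minimal)
  then show "z \<in> stolz \<zeta> \<Longrightarrow> \<exists>t\<in>{0..1}. cmod (z - of_real (1 - t) * \<zeta>) \<le> t / 2" by auto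
next
  assume "\<exists>t\<in>{0..1}. cmod (z - of_real (1 - t) * \<zeta>) \<le> t / 2"
  then obtain t where t: "0 \<le> t" "t \<le> 1" "cmod (z - of_real (1 - t) * \<zeta>) \<le> t / 2" by auto
  have cb: "b \<in> stolz \<zeta>" if "cmod b \<le> 1 / 2" for b
  proof -
    define e where "e = (if b = 0 then 1 else sgn b)"
    have e1: "cmod e = 1" by (simp add: e_def norm_sgn)
    have e2: "b = of_real (cmod b) * e" by (simp add: e_def sgn_eq)
    note e = e1 e2
    have m: "e / 2 \<in> stolz \<zeta>" "- e / 2 \<in> stolz \<zeta>"
      unfolding stolz_def using e by (auto intro!: hull_inc simp: norm_divide)
    have "(1 / 2 + cmod b) *\<^sub>R (e / 2) + (1 / 2 - cmod b) *\<^sub>R (- e / 2) \<in> stolz \<zeta>"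
      using that m unfolding stolz_def by (intro convexD[OF convex_convex_hull]) auto
    also have "(1 / 2 + cmod b) *\<^sub>R (e / 2) + (1 / 2 - cmod b) *\<^sub>R (- e / 2) = b"
      by (subst (3) e(2)) (simp add: scaleR_conv_of_real algebra_simps)
    finally show ?thesis .
  qed
  show "z \<in> stolz \<zeta>"
  proof (cases "t = 0")
    case True
    then show ?thesis using t unfolding stolz_def by (auto intro: hull_inc)
  next
    case False
    define b where "b = (z - of_real (1 - t) * \<zeta>) / of_real t"
    have "cmod b \<le> 1 / 2" using t False by (simp add: b_def norm_divide field_simps)
    then have "b \<in> stolz \<zeta>" by (rule cb)
    moreover have "\<zeta> \<in> stolz \<zeta>" unfolding stolz_def by (auto intro: hull_inc)
    ultimately have "(1 - t) *\<^sub>R \<zeta> + t *\<^sub>R b \<in> stolz \<zeta>"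
      using t unfolding stolz_def by (intro convexD[OF convex_convex_hull]) auto
    also have "(1 - t) *\<^sub>R \<zeta> + t *\<^sub>R b = z" using False by (simp add: b_def scaleR_conv_of_real)
    finally show ?thesis .
  qed
qed

text \<open>In the disc with parameter t, the distance to \<zeta> is at most 3t/2 and 1 - |z| is at
  least t/2.\<close>

lemma stolz_dist: assumes "cmod \<zeta> = 1" "z \<in> stolz \<zeta>" shows "cmod (z - \<zeta>) \<le> 3 * (1 - cmod z)"
proof -
  obtain t where t: "0 \<le> t" "t \<le> 1" "cmod (z - of_real (1 - t) * \<zeta>) \<le> t / 2"
    using assms stolz_iff by auto
  have "cmod (z - \<zeta>) \<le> cmod (z - of_real (1 - t) * \<zeta>) + cmod (of_real t * \<zeta>)"
    by (rule order_trans[OF _ norm_triangle_ineq4]) (simp add: algebra_simps)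
  also have "\<dots> \<le> t / 2 + t" using t assms by (simp add: norm_mult)
  finally have 1: "cmod (z - \<zeta>) \<le> 3 / 2 * t" by simp
  have "cmod z \<le> cmod (z - of_real (1 - t) * \<zeta>) + cmod (of_real (1 - t) * \<zeta>)"
    by (rule order_trans[OF _ norm_triangle_ineq]) simp
  also have "\<dots> \<le> t / 2 + (1 - t)" using t assms by (simp add: norm_mult del: of_real_diff)
  finally show ?thesis using 1 by argo
qed

lemma stolz_mem:
  assumes "cmod \<zeta> = 1" "cmod z \<le> 1" "cmod (z - of_real (cmod z) * \<zeta>) \<le> (1 - cmod z) / 2"
  shows "z \<in> stolz \<zeta>"
  unfolding stolz_iff using assms by (intro bexI[of _ "1 - cmod z"]) auto

lemma stolz_iff_combination:
  "z \<in> stolz \<zeta> \<longleftrightarrow> (\<exists>t\<in>{0..1}. \<exists>b\<in>cball 0 (1/2). z = of_real (1 - t) * \<zeta> + of_real t * b)"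
proof
  assume "z \<in> stolz \<zeta>"
  then obtain t where t: "0 \<le> t" "t \<le> 1" "cmod (z - of_real (1 - t) * \<zeta>) \<le> t / 2"
    using stolz_iff by auto
  define b where "b = (z - of_real (1 - t) * \<zeta>) / of_real t"
  have "cmod b \<le> 1 / 2" using t by (cases "t = 0") (auto simp: b_def norm_divide field_simps)
  moreover have "z = of_real (1 - t) * \<zeta> + of_real t * b" using t by (cases "t = 0") (auto simp: b_def)
  ultimately show "\<exists>t\<in>{0..1}. \<exists>b\<in>cball 0 (1/2). z = of_real (1 - t) * \<zeta> + of_real t * b"
    using t by (intro bexI[of _ t] bexI[of _ b]) auto
next
  assume "\<exists>t\<in>{0..1}. \<exists>b\<in>cball 0 (1/2). z = of_real (1 - t) * \<zeta> + of_real t * b"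
  then obtain t b where p: "t \<in> {0..1}" "cmod b \<le> 1 / 2" "z = of_real (1 - t) * \<zeta> + of_real t * b" by auto
  have "t * cmod b \<le> t * (1 / 2)" using p by (intro mult_left_mono) auto
  then show "z \<in> stolz \<zeta>"
    unfolding stolz_iff p(3) using p(1) by (intro bexI[OF _ p(1)]) (simp add: norm_mult)
qed

text \<open>Gives the joint measurability of \<open>st\<close> in both variables, on which Fubini's
  theorem depends.\<close>

lemma closed_stolz_graph: "closed {p. fst p \<in> {0..1} \<and> snd p \<in> stolz (zeta (fst p))}" (is "closed ?S")
proof -
  let ?f = "\<lambda>p. (fst p, of_real (1 - fst (snd p)) * zeta (fst p) + of_real (fst (snd p)) * snd (snd p))"
  have eq: "?S = ?f ` ({0..1} \<times> {0..1} \<times> cball 0 (1/2))"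
    by (force simp: stolz_iff_combination image_iff)
  have "compact (?f ` ({0..1} \<times> {0..1} \<times> cball 0 (1/2)))"
    by (intro compact_continuous_image compact_Times continuous_intros) auto
  then show ?thesis unfolding eq by (rule compact_imp_closed)
qed

text \<open>As a function of x with z = w fixed, this is the indicator of the set J_w of the
  overview.\<close>

definition st :: "real \<Rightarrow> complex \<Rightarrow> ennreal" where
  "st x z = indicator {p. fst p \<in> {0..1} \<and> snd p \<in> stolz (zeta (fst p))} (x, z)"

lemma measurable_st [measurable (raw)]:
  assumes [measurable]: "f \<in> borel_measurable M" "g \<in> borel_measurable M"
  shows "(\<lambda>t. st (f t) (g t)) \<in> borel_measurable M"
proof -
  have [measurable]: "{p. fst p \<in> {0..1} \<and> snd p \<in> stolz (zeta (fst p))} \<in> sets borel"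
    by (rule borel_closed[OF closed_stolz_graph])
  have "(\<lambda>t. (f t, g t)) \<in> M \<rightarrow>\<^sub>M borel" unfolding borel_prod[symmetric] by measurable
  then show ?thesis unfolding st_def by measurable
qed

lemma zeta_polar_dist: "cmod (of_real r * zeta x - of_real r * zeta y) = \<bar>r\<bar> * cmod (zeta x - zeta y)"
  by (simp add: right_diff_distrib[symmetric] norm_mult)

text \<open>Turning w through a parameter e moves it by at most 2 pi e, and the Stolz angle
  tolerates (1 - |w|)/2 by \<open>stolz_mem\<close>; 13 is an upper bound of 4 pi.\<close>

lemma nn_integral_st_ge:
  assumes "cmod w < 1" shows "ennreal ((1 - cmod w) / 13) \<le> (\<integral>\<^sup>+x. st x w \<partial>circ)"
proof -
  obtain x0 where x0: "x0 \<in> {0..<0+1}" "w = of_real (cmod w) * zeta x0" by (rule polar_zeta)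
  define e where "e = (1 - cmod w) / 13"
  have e: "0 < e" "e \<le> 1 / 13" using assms by (auto simp: e_def)
  \<comment> \<open>An interval on one side of \<open>x0\<close>, chosen so that it stays inside
    {0..1}.\<close>
  define I where "I = (if x0 + e \<le> 1 then {x0..x0 + e} else {x0 - e..x0})"
  have I01: "I \<subseteq> {0..1}" using x0 e by (auto simp: I_def)
  have "indicator I x \<le> st x w" if "x \<in> {0..1}" for x
  proof (cases "x \<in> I")
    case True
    have "cmod (w - of_real (cmod w) * zeta x) = cmod w * cmod (zeta x0 - zeta x)"
      by (subst (1) x0(2)) (simp add: zeta_polar_dist del: of_real_mult)
    also have "\<dots> \<le> 1 * (2 * pi * \<bar>x0 - x\<bar>)"
      using assms by (intro mult_mono norm_zeta_diff_le) auto
    also have "\<dots> \<le> 2 * pi * e" using True by (auto simp: I_def split: if_splits)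
    also have "\<dots> \<le> 2 * (13 / 4) * e" using e pi_approx by (intro mult_mono) auto
    also have "\<dots> = (1 - cmod w) / 2" by (simp add: e_def)
    finally have "w \<in> stolz (zeta x)" using assms by (intro stolz_mem) auto
    then show ?thesis using that by (simp add: st_def split: split_indicator)
  qed auto
  then have "(\<integral>\<^sup>+x. indicator I x \<partial>circ) \<le> (\<integral>\<^sup>+x. st x w \<partial>circ)" by (intro nn_integral_mono) simp
  moreover have "(\<integral>\<^sup>+x. indicator I x \<partial>circ) = ennreal e"
  proof -
    have [measurable]: "I \<in> sets borel" by (simp add: I_def)
    have "(\<integral>\<^sup>+x. indicator I x \<partial>circ) = (\<integral>\<^sup>+x. indicator I x * indicator {0..1} x \<partial>lborel)"
      by (simp add: nn_integral_circ[symmetric])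
    also have "\<dots> = (\<integral>\<^sup>+x. indicator I x \<partial>lborel)" using I01 by (intro nn_integral_cong) (auto split: split_indicator)
    also have "\<dots> = ennreal e" using e by (simp add: I_def)
    finally show ?thesis .
  qed
  ultimately show ?thesis by (simp add: e_def)
qed

section \<open>Densities\<close>

text \<open>The density of the measure whose Carleson norm defines \<open>T\<^bsub>\<infinity>,q\<^esub>\<close>.\<close>

definition dens :: "real \<Rightarrow> (complex \<Rightarrow> 'a::real_normed_vector) \<Rightarrow> complex \<Rightarrow> ennreal" where
  "dens q F z = indicator disc z * ennreal (norm (F z) powr q / (1 - cmod z))"

lemma measurable_dens [measurable]:
  assumes "continuous_on disc F" "0 < q" shows "dens q F \<in> borel_measurable borel"
proof -
  have "continuous_on disc (\<lambda>z. norm (F z) powr q / (1 - cmod z))"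
    using assms by (intro continuous_intros continuous_on_powr') auto
  then have [measurable]: "(\<lambda>z. indicator disc z *\<^sub>R (norm (F z) powr q / (1 - cmod z))) \<in> borel_measurable borel"
    by (intro borel_measurable_continuous_on_indicator) auto
  have eq: "dens q F = (\<lambda>z. ennreal (indicator disc z *\<^sub>R (norm (F z) powr q / (1 - cmod z))))"
    by (auto simp: dens_def fun_eq_iff split: split_indicator)
  show ?thesis unfolding eq by measurable
qed

lemma Aq_q_eq:
  assumes "x \<in> {0..1}"
  shows "Aq_q q F (zeta x) = (\<integral>\<^sup>+z. dens q F z * ennreal (1 / (1 - cmod z)) * st x z \<partial>lborel)"
  unfolding Aq_q_def
proof (intro nn_integral_cong)
  fix z
  show "ennreal (norm (F z) powr q / (1 - cmod z)\<^sup>2) * indicator (stolz (zeta x)) z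
    = dens q F z * ennreal (1 / (1 - cmod z)) * st x z"
  proof (cases "z \<in> stolz (zeta x)")
    case True
    then have "cmod (z - zeta x) \<le> 3 * (1 - cmod z)" by (intro stolz_dist) auto
    then have "0 \<le> 1 - cmod z" using norm_ge_zero[of "z - zeta x"] by argo
    \<comment> \<open>The Stolz angle contains its vertex; there both sides vanish, the left one
      because division by zero yields 0.\<close>
    then show ?thesis using True assms
      by (cases "cmod z = 1") (auto simp: dens_def st_def ennreal_mult'[symmetric] power2_eq_square)
  qed (use assms in \<open>simp add: st_def\<close>)
qed

lemma measurable_Aq_q [measurable]:
  assumes "continuous_on disc F" "0 < q" shows "(\<lambda>x. Aq_q q F (zeta x)) \<in> borel_measurable circ"
proof -
  note [measurable] = measurable_dens[OF assms]
  have "(\<lambda>x. \<integral>\<^sup>+z. dens q F z * ennreal (1 / (1 - cmod z)) * st x z \<partial>lborel) \<in> borel_measurable circ"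
    by measurable
  then show ?thesis by (subst measurable_cong[OF Aq_q_eq]) auto
qed

lemma nn_integral_Aq_q:
  assumes F: "continuous_on disc F" "0 < q" and [measurable]: "v \<in> borel_measurable circ"
  shows "(\<integral>\<^sup>+x. v x * Aq_q q F (zeta x) \<partial>circ)
    = (\<integral>\<^sup>+z. dens q F z * ennreal (1 / (1 - cmod z)) * (\<integral>\<^sup>+x. v x * st x z \<partial>circ) \<partial>lborel)"
proof -
  note [measurable] = measurable_dens[OF F]
  interpret pair_sigma_finite lborel circ ..
  have "(\<integral>\<^sup>+x. v x * Aq_q q F (zeta x) \<partial>circ)
    = (\<integral>\<^sup>+x. \<integral>\<^sup>+z. v x * (dens q F z * ennreal (1 / (1 - cmod z)) * st x z) \<partial>lborel \<partial>circ)"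
    by (intro nn_integral_cong) (simp add: Aq_q_eq nn_integral_cmult)
  also have "\<dots> = (\<integral>\<^sup>+z. \<integral>\<^sup>+x. v x * (dens q F z * ennreal (1 / (1 - cmod z)) * st x z) \<partial>circ \<partial>lborel)"
    by (rule Fubini') measurable
  also have "\<dots> = (\<integral>\<^sup>+z. \<integral>\<^sup>+x. dens q F z * ennreal (1 / (1 - cmod z)) * (v x * st x z) \<partial>circ \<partial>lborel)"
    by (intro nn_integral_cong) (simp add: ac_simps)
  also have "\<dots> = (\<integral>\<^sup>+z. dens q F z * ennreal (1 / (1 - cmod z)) * (\<integral>\<^sup>+x. v x * st x z \<partial>circ) \<partial>lborel)"
    by (intro nn_integral_cong nn_integral_cmult) measurable
  finally show ?thesis .
qed

section \<open>Outer functions\<close>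

lemma lebesgue_on_circ:
  fixes f :: "real \<Rightarrow> 'b::{banach, second_countable_topology}"
  assumes "f \<in> borel_measurable circ"
  shows "integrable (lebesgue_on {0..1}) f \<longleftrightarrow> integrable circ f"
    and "(LINT x|lebesgue_on {0..1}. f x) = (LINT x|circ. f x)"
proof -
  have "(\<lambda>x. indicator {0..1} x *\<^sub>R f x) \<in> borel_measurable lborel"
    using assms unfolding circ_def by (subst (asm) borel_measurable_restrict_space_iff) auto
  then show "integrable (lebesgue_on {0..1}) f \<longleftrightarrow> integrable circ f"
    "(LINT x|lebesgue_on {0..1}. f x) = (LINT x|circ. f x)"
    by (simp_all add: circ_def integrable_restrict_space integral_restrict_space integrable_completion integral_completion)
qed

section \<open>The Herglotz transform\<close>

definition herglotz :: "(real \<Rightarrow> real) \<Rightarrow> complex \<Rightarrow> complex" where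
  "herglotz L w = (LINT x|circ. (zeta x + w) / (zeta x - w) * of_real (L x))"

lemma integrable_bounded_mult:
  fixes L :: "real \<Rightarrow> real" and k :: "real \<Rightarrow> complex"
  assumes L: "integrable circ L" and k: "k \<in> borel_measurable borel" and "\<And>x. cmod (k x) \<le> K"
  shows "integrable circ (\<lambda>x. k x * of_real (L x))"
proof (rule Bochner_Integration.integrable_bound[OF integrable_mult_right[OF L, of K]])
  have [measurable]: "L \<in> borel_measurable circ" using L by simp
  have [measurable]: "k \<in> borel_measurable circ" by (rule measurable_circ[OF k])
  show "(\<lambda>x. k x * of_real (L x)) \<in> borel_measurable circ" by measurable
  have "0 \<le> K" using assms(3)[of 0] norm_ge_zero order_trans by blast
  then show "AE x in circ. norm (k x * of_real (L x)) \<le> norm (K * L x)"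
    using assms(3) by (auto simp: norm_mult abs_mult intro!: mult_right_mono)
qed

lemma herglotz_kernel_le: assumes "cmod w < 1" shows "cmod ((zeta x + w) / (zeta x - w)) \<le> 2 / (1 - cmod w)"
proof -
  have "cmod (zeta x + w) \<le> 2" using norm_triangle_ineq[of "zeta x" w] assms by simp
  then show ?thesis unfolding norm_divide using assms norm_zeta_minus_ge[of w x] by (intro frac_le) auto
qed

lemma integrable_herglotz:
  assumes "integrable circ L" "cmod w < 1"
  shows "integrable circ (\<lambda>x. (zeta x + w) / (zeta x - w) * of_real (L x))"
  by (rule integrable_bounded_mult[OF assms(1) _ herglotz_kernel_le[OF assms(2)]]) measurable

lemma Re_herglotz:
  assumes "integrable circ L" "cmod w < 1"
  shows "Re (herglotz L w) = (LINT x|circ. pois w x * L x)"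
proof -
  have "Re (herglotz L w) = (LINT x|circ. Re ((zeta x + w) / (zeta x - w) * of_real (L x)))"
    unfolding herglotz_def using integrable_herglotz[OF assms] by (simp add: integral_Re)
  moreover have "Re (z * of_real r) = Re z * r" for z r by simp
  then have "Re ((zeta x + w) / (zeta x - w) * of_real (L x)) = pois w x * L x" for x
    using pois_Re[OF assms(2)] by metis
  ultimately show ?thesis by simp
qed

text \<open>The difference quotient of the kernel misses its derivative by v - w times a kernel
  bounded by 4/d^3, so the derivative may be taken under the integral.\<close>

lemma herglotz_holomorphic:
  assumes L: "integrable circ L" shows "herglotz L holomorphic_on disc"
proof -
  have [measurable]: "L \<in> borel_measurable circ" using L by simp
  have "herglotz L field_differentiable at w" if "w \<in> disc" for w
  proof -
    define d where "d = 1 - cmod w"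
    have d: "d > 0" using that by (simp add: d_def)
    have ge: "d / 2 \<le> cmod (zeta x - v)" if "cmod (v - w) < d / 2" for v x
    proof -
      have "cmod v \<le> cmod w + d / 2" using norm_triangle_ineq2[of v w] that by linarith
      then show ?thesis using norm_zeta_minus_ge[of v x] d by (simp add: d_def field_simps)
    qed
    have gew: "d \<le> cmod (zeta x - w)" for x using norm_zeta_minus_ge[of w x] by (simp add: d_def)
    define D where "D = (LINT x|circ. 2 * zeta x / (zeta x - w)\<^sup>2 * of_real (L x))"
    define A where "A = (LINT x|circ. \<bar>L x\<bar>)"
    have est: "cmod ((herglotz L v - herglotz L w) / (v - w) - D) \<le> (4 / d ^ 3 * A) * cmod (v - w)"
      if v: "cmod (v - w) < d / 2" "v \<noteq> w" for v
    proof -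
      have cv: "cmod v < 1" using v norm_triangle_ineq2[of v w] d by (simp add: d_def)
      have cw: "cmod w < 1" using \<open>w \<in> disc\<close> by simp
      have i1: "integrable circ (\<lambda>x. 2 * zeta x / (zeta x - w)\<^sup>2 * of_real (L x))"
      proof (rule integrable_bounded_mult[OF L])
        show "(\<lambda>x. 2 * zeta x / (zeta x - w)\<^sup>2) \<in> borel_measurable borel" by measurable
        show "cmod (2 * zeta x / (zeta x - w)\<^sup>2) \<le> 2 / d\<^sup>2" for x
          using gew[of x] d by (auto simp: norm_divide norm_mult norm_power intro!: divide_left_mono power_mono mult_pos_pos zero_less_power)
      qed
      have ptw: "((zeta x + v) / (zeta x - v) * of_real (L x) - (zeta x + w) / (zeta x - w) * of_real (L x)) / (v - w)
          - 2 * zeta x / (zeta x - w)\<^sup>2 * of_real (L x)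
          = (v - w) * (2 * zeta x / ((zeta x - v) * (zeta x - w)\<^sup>2)) * of_real (L x)" for x
      proof -
        have alg: "((z + v) / (z - v) - (z + w) / (z - w)) / (v - w) - 2 * z / (z - w)\<^sup>2
          = (v - w) * (2 * z / ((z - v) * (z - w)\<^sup>2))" if "z \<noteq> v" "z \<noteq> w" for z
        proof -
          have n: "z - v \<noteq> 0" "z - w \<noteq> 0" "v - w \<noteq> 0" using that v by auto
          have "(z + v) / (z - v) - (z + w) / (z - w) = (v - w) * (2 * z / ((z - v) * (z - w)))"
            using n by (simp add: divide_simps) (simp add: algebra_simps)
          then have "((z + v) / (z - v) - (z + w) / (z - w)) / (v - w) = 2 * z / ((z - v) * (z - w))"
            using n by simp
          then show ?thesis using n by (simp add: divide_simps power2_eq_square) (simp add: algebra_simps)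
        qed
        have "(((zeta x + v) / (zeta x - v) - (zeta x + w) / (zeta x - w)) / (v - w) - 2 * zeta x / (zeta x - w)\<^sup>2) * of_real (L x)
          = (v - w) * (2 * zeta x / ((zeta x - v) * (zeta x - w)\<^sup>2)) * of_real (L x)"
          by (subst alg) (use zeta_neq cv cw in auto)
        then show ?thesis by (simp add: left_diff_distrib diff_divide_distrib)
      qed
      have "(herglotz L v - herglotz L w) / (v - w) - D
        = (LINT x|circ. ((zeta x + v) / (zeta x - v) * of_real (L x) - (zeta x + w) / (zeta x - w) * of_real (L x)) / (v - w)
          - 2 * zeta x / (zeta x - w)\<^sup>2 * of_real (L x))"
        unfolding herglotz_def D_def
        using integrable_herglotz[OF L cv] integrable_herglotz[OF L cw] i1
        by (simp add: Bochner_Integration.integral_diff)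
      also have "\<dots> = (LINT x|circ. (v - w) * (2 * zeta x / ((zeta x - v) * (zeta x - w)\<^sup>2)) * of_real (L x))"
        by (simp only: ptw)
      finally have eq: "(herglotz L v - herglotz L w) / (v - w) - D = \<dots>" .
      have "cmod (LINT x|circ. (v - w) * (2 * zeta x / ((zeta x - v) * (zeta x - w)\<^sup>2)) * of_real (L x))
        \<le> (LINT x|circ. (4 / d ^ 3 * cmod (v - w)) * \<bar>L x\<bar>)"
      proof (rule order_trans[OF integral_norm_bound integral_mono])
        have kb: "cmod ((v - w) * (2 * zeta x / ((zeta x - v) * (zeta x - w)\<^sup>2))) \<le> 4 / d ^ 3 * cmod (v - w)" for x
        proof -
          have "d / 2 * d\<^sup>2 \<le> cmod (zeta x - v) * (cmod (zeta x - w))\<^sup>2"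
            using ge[OF v(1)] gew d by (intro mult_mono power_mono) auto
          then have "2 / (cmod (zeta x - v) * (cmod (zeta x - w))\<^sup>2) \<le> 2 / (d / 2 * d\<^sup>2)"
            using d zeta_neq cv cw by (intro divide_left_mono) auto
          also have "\<dots> = 4 / d ^ 3" by (simp add: power2_eq_square power3_eq_cube)
          finally have "cmod (v - w) * (2 / (cmod (zeta x - v) * (cmod (zeta x - w))\<^sup>2)) \<le> cmod (v - w) * (4 / d ^ 3)"
            by (rule mult_left_mono) simp
          then show ?thesis by (simp add: norm_mult norm_divide norm_power mult.commute)
        qed
        show "integrable circ (\<lambda>x. norm ((v - w) * (2 * zeta x / ((zeta x - v) * (zeta x - w)\<^sup>2)) * of_real (L x)))"
          by (rule integrable_norm[OF integrable_bounded_mult[OF L _ kb]]) measurable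
        show "integrable circ (\<lambda>x. (4 / d ^ 3 * cmod (v - w)) * \<bar>L x\<bar>)"
          using L by (intro integrable_mult_right integrable_abs)
        fix x
        show "norm ((v - w) * (2 * zeta x / ((zeta x - v) * (zeta x - w)\<^sup>2)) * of_real (L x)) \<le> 4 / d ^ 3 * cmod (v - w) * \<bar>L x\<bar>"
          using mult_right_mono[OF kb, of "\<bar>L x\<bar>" x] by (simp add: norm_mult norm_divide norm_power)
      qed
      then show ?thesis unfolding eq by (simp add: A_def mult_ac)
    qed
    have "((\<lambda>v. (herglotz L v - herglotz L w) / (v - w) - D) \<longlongrightarrow> 0) (at w)"
    proof (rule Lim_null_comparison)
      have "\<forall>\<^sub>F v in at w. dist v w < d / 2" using d by (auto simp: eventually_at intro!: exI[of _ "d / 2"])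
      moreover have "\<forall>\<^sub>F v in at w. v \<noteq> w" by (simp add: eventually_neq_at_within)
      ultimately show "\<forall>\<^sub>F v in at w. norm ((herglotz L v - herglotz L w) / (v - w) - D) \<le> (4 / d ^ 3 * A) * cmod (v - w)"
        by eventually_elim (rule est; simp add: dist_norm)
      show "((\<lambda>v. (4 / d ^ 3 * A) * cmod (v - w)) \<longlongrightarrow> 0) (at w)"
        by (rule tendsto_eq_intros refl | simp)+
    qed
    then have "((\<lambda>v. (herglotz L v - herglotz L w) / (v - w)) \<longlongrightarrow> D) (at w)"
      by (simp add: LIM_zero_iff)
    then show ?thesis unfolding field_differentiable_def has_field_derivative_iff by blast
  qed
  then show ?thesis unfolding holomorphic_on_def using field_differentiable_at_within by blast
qed

section \<open>Tools for the dominating outer function\<close>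

lemma le_one_plus_square: "(x::real) \<le> 1 + x\<^sup>2"
  using zero_le_power2[of "x - 1/2"] by (simp add: power2_eq_square algebra_simps)

lemma pmax_cong: "zeta x = zeta y \<Longrightarrow> pmax V x = pmax V y"
  by (simp add: pmax_def ker_def)

lemma pmax_ge: "(\<integral>\<^sup>+y. ennreal (ker (1 / 2 ^ n) x y) * V y \<partial>circ) \<le> pmax V x"
  unfolding pmax_def by (rule SUP_upper) simp

text \<open>On the circle |\<zeta> - w| equals the modulus of 1 - cnj w \<zeta>, whose logarithm is
  harmonic on the closed disc; its Poisson mean is its value at w.\<close>

lemma pois_mean_log_dist:
  assumes w: "cmod w < 1"
  shows "(LINT x|circ. pois w x * ln (cmod (zeta x - w))) = ln (1 - (cmod w)\<^sup>2)"
proof -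
  have cl: "cmod (cnj w * u) < 1" if "cmod u \<le> 1" for u
  proof -
    have "cmod (cnj w * u) \<le> cmod w" using that by (simp add: norm_mult mult_left_le)
    then show ?thesis using w by linarith
  qed
  have nn: "1 - cnj w * u \<notin> \<real>\<^sub>\<le>\<^sub>0" if "cmod u \<le> 1" for u
  proof
    assume "1 - cnj w * u \<in> \<real>\<^sub>\<le>\<^sub>0"
    then have "Re (1 - cnj w * u) \<le> 0" by (simp only: complex_nonpos_Reals_iff)
    then have "1 \<le> Re (cnj w * u)" by simp
    also have "\<dots> \<le> cmod (cnj w * u)" by (rule complex_Re_le_cmod)
    finally show False using cl[OF that] by simp
  qed
  have hol: "(\<lambda>u. Ln (1 - cnj w * u)) holomorphic_on cball 0 1"
    by (intro holomorphic_intros) (use nn in auto)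
  note P = Poisson_formula[OF hol w]
  have dist: "cmod (1 - cnj w * zeta x) = cmod (zeta x - w)" for x
  proof -
    have "cnj (zeta x) * zeta x = 1" using complex_norm_square[of "zeta x"] by (simp add: mult.commute)
    then have "1 - cnj w * zeta x = cnj (zeta x - w) * zeta x" by (simp add: algebra_simps)
    then show ?thesis by (simp only: norm_mult complex_mod_cnj norm_zeta mult_1_right)
  qed
  have Re1: "Re (of_real (pois w x) * Ln (1 - cnj w * zeta x)) = pois w x * ln (cmod (zeta x - w))" for x
  proof -
    have "1 - cnj w * zeta x \<noteq> 0" using nn[of "zeta x"] by auto
    then show ?thesis by (simp add: Re_Ln dist)
  qed
  have "1 - cnj w * w = of_real (1 - (cmod w)\<^sup>2)" using complex_norm_square[of w] by (simp add: mult.commute)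
  moreover have "(cmod w)\<^sup>2 < 1" using w by (simp add: abs_square_less_1)
  ultimately have Re2: "Re (Ln (1 - cnj w * w)) = ln (1 - (cmod w)\<^sup>2)"
    by (metis Ln_of_real Re_complex_of_real diff_gt_0_iff_gt)
  have "continuous_on {0..1} (\<lambda>x. of_real (pois w x) * Ln (1 - cnj w * zeta x))"
    by (intro continuous_intros w) (use nn in auto)
  then have "integrable circ (\<lambda>x. of_real (pois w x) * Ln (1 - cnj w * zeta x))"
    by (rule continuous_integrable_circ)
  then have "Re (LINT x|circ. of_real (pois w x) * Ln (1 - cnj w * zeta x)) = (LINT x|circ. pois w x * ln (cmod (zeta x - w)))"
    by (simp only: integral_Re[symmetric] Re1)
  then show ?thesis unfolding P Re2 by simp
qed

lemma integrable_pois_log_dist: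
  assumes w: "cmod w < 1" shows "integrable circ (\<lambda>x. pois w x * ln (cmod (zeta x - w)))"
  by (intro continuous_integrable_circ continuous_intros w) (auto simp: zeta_neq[OF w])

lemma outer_exp_herglotz:
  assumes "L \<in> borel_measurable circ" "integrable circ L" and L: "\<And>x. L x = ln (u (zeta x))" and "\<And>\<zeta>. 0 \<le> u \<zeta>"
  shows "outer (\<lambda>w. exp (herglotz L w))"
proof -
  have "integrable (lebesgue_on {0..1}) (\<lambda>x. ln (u (zeta x)))"
    using assms(1,2) by (simp add: L[symmetric] lebesgue_on_circ(1))
  moreover have "herglotz L w = (LINT x|lebesgue_on {0..1}. ((zeta x + w) / (zeta x - w)) * complex_of_real (ln (u (zeta x))))" for w
    unfolding herglotz_def L[symmetric]
    by (rule lebesgue_on_circ(2)[symmetric]) (use assms(1) in measurable)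
  ultimately show ?thesis using assms(4) unfolding outer_def
    by (intro exI[of _ 1] exI[of _ u]) auto
qed

text \<open>The modulus of the outer function below has boundary values \<open>(pmax V)\<^bsup>2/p\<^esup>\<close>. Since \<open>pmax V\<close>
  at \<open>\<zeta>\<close> is at least the mean of \<open>V\<close> over \<open>J\<^sub>w\<close> times \<open>(1 - |w|) / |\<zeta> - w|\<close>, and the
  Poisson mean of \<open>log |\<zeta> - w|\<close> is explicit, the modulus at \<open>w\<close> dominates that mean.\<close>

lemma outer_dominating:
  fixes V :: "real \<Rightarrow> real" and p N :: real
  assumes p: "0 < p" and V [measurable]: "V \<in> borel_measurable circ" and N: "0 < N" "\<And>x. N \<le> V x"
    and fin: "(\<integral>\<^sup>+x. (ennreal (V x))\<^sup>2 \<partial>circ) < top"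
  obtains g where "outer g" "in_Hp p g" "Hp_sup p g \<le> 64 * (\<integral>\<^sup>+x. (ennreal (V x))\<^sup>2 \<partial>circ)"
    "\<And>w. cmod w < 1 \<Longrightarrow> g w \<noteq> 0"
    "\<And>w. cmod w < 1 \<Longrightarrow> (\<integral>\<^sup>+x. ennreal (V x) * st x w \<partial>circ) \<le> ennreal (200 * (1 - cmod w) * cmod (g w) powr (p / 2))"
proof -
  define m where "m = pmax (\<lambda>x. ennreal (V x))"
  define mr where "mr x = enn2real (m x)" for x
  have m_meas [measurable]: "m \<in> borel_measurable borel" unfolding m_def by (rule measurable_pmax) measurable
  have [measurable]: "m \<in> borel_measurable circ" by (rule measurable_circ) simp
  have [measurable]: "mr \<in> borel_measurable circ" unfolding mr_def by measurable
  have V0: "0 \<le> V x" for x using N(1) N(2)[of x] by linarith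
  have m2: "(\<integral>\<^sup>+x. (m x)\<^sup>2 \<partial>circ) \<le> 64 * (\<integral>\<^sup>+x. (ennreal (V x))\<^sup>2 \<partial>circ)"
    unfolding m_def by (rule pmax_L2) measurable
  also have fin64: "\<dots> < top" using fin by (simp add: ennreal_mult_less_top)
  finally have m2fin: "(\<integral>\<^sup>+x. (m x)\<^sup>2 \<partial>circ) < top" .
  then have "AE x in circ. (m x)\<^sup>2 \<noteq> \<infinity>" by (intro nn_integral_PInf_AE) auto
  then have mAE: "AE x in circ. m x = ennreal (mr x)"
    by eventually_elim (simp add: mr_def ennreal_enn2real_if power2_eq_square ennreal_mult_eq_top_iff top_ennreal_def[symmetric])
  \<comment> \<open>Chords are at most 2, so the kernel of scale 1 is everywhere at least 1/9. This
    positive floor bounds the logarithm of the maximal function from below.\<close>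
  define c where "c = N / 9"
  have c: "0 < c" using N by (simp add: c_def)
  have mge: "ennreal c \<le> m x" for x
  proof -
    have "ennreal c = (\<integral>\<^sup>+y. ennreal c \<partial>circ)" by simp
    also have "\<dots> \<le> (\<integral>\<^sup>+y. ennreal (ker (1 / 2 ^ 0) x y) * ennreal (V y) \<partial>circ)"
    proof (intro nn_integral_mono)
      fix y
      have "cmod (zeta x - zeta y) \<le> 2" using norm_triangle_ineq4[of "zeta x" "zeta y"] by simp
      then have "(1 + cmod (zeta x - zeta y))\<^sup>2 \<le> 3\<^sup>2" by (intro power_mono) auto
      moreover have "0 < (1 + cmod (zeta x - zeta y))\<^sup>2" by (intro zero_less_power add_pos_nonneg) auto
      ultimately have "1 / 9 \<le> ker 1 x y" unfolding ker_def by (intro frac_le) auto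
      then have "1 / 9 * N \<le> ker 1 x y * V y" using N by (intro mult_mono) auto
      then show "ennreal c \<le> ennreal (ker (1 / 2 ^ 0) x y) * ennreal (V y)"
        by (simp add: c_def ennreal_mult'[symmetric] ker_nonneg V0 ennreal_leI)
    qed
    also have "\<dots> \<le> m x" unfolding m_def by (rule pmax_ge)
    finally show ?thesis .
  qed
  have mrAE: "AE x in circ. c \<le> mr x"
    using mAE
  proof eventually_elim
    case (elim x)
    have "0 \<le> mr x" by (simp add: mr_def)
    then show ?case using mge[of x] unfolding elim by simp
  qed
  \<comment> \<open>With the factor 2/p, |g|^(p/2) is the geometric Poisson mean of the maximal
    function, and by Jensen |g|^p is at most the Poisson mean of its square; the L^2 bound thus
    becomes an H^p bound.\<close>
  define L where "L x = 2 / p * ln (mr x)" for x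
  have [measurable]: "L \<in> borel_measurable circ" unfolding L_def by measurable
  have int_mr2: "integrable circ (\<lambda>x. (mr x)\<^sup>2)"
  proof (rule integrableI_bounded)
    have "(\<integral>\<^sup>+x. ennreal (norm ((mr x)\<^sup>2)) \<partial>circ) = (\<integral>\<^sup>+x. (m x)\<^sup>2 \<partial>circ)"
    proof (rule nn_integral_cong_AE)
      show "AE x in circ. ennreal (norm ((mr x)\<^sup>2)) = (m x)\<^sup>2"
        using mAE
      proof eventually_elim
        case (elim x)
        have "0 \<le> mr x" by (simp add: mr_def)
        then show ?case by (simp add: elim ennreal_power)
      qed
    qed
    then show "(\<integral>\<^sup>+x. ennreal (norm ((mr x)\<^sup>2)) \<partial>circ) < \<infinity>" using m2fin by simp
  qed measurable
  have int_ln: "integrable circ (\<lambda>x. ln (mr x))"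
  proof (rule Bochner_Integration.integrable_bound)
    show "integrable circ (\<lambda>x. \<bar>ln c\<bar> + 1 + (mr x)\<^sup>2)" using int_mr2 by simp
    show "AE x in circ. norm (ln (mr x)) \<le> norm (\<bar>ln c\<bar> + 1 + (mr x)\<^sup>2)"
      using mrAE
    proof eventually_elim
      case (elim x)
      have "ln c \<le> ln (mr x)" using elim c by simp
      moreover have "ln (mr x) \<le> mr x - 1" using elim c by (intro ln_le_minus_one) simp
      moreover have "mr x \<le> 1 + (mr x)\<^sup>2" by (rule le_one_plus_square)
      moreover have "0 \<le> (mr x)\<^sup>2" by simp
      ultimately show ?case unfolding real_norm_def by linarith
    qed
  qed measurable
  then have int_L: "integrable circ L" unfolding L_def by (rule integrable_mult_right)
  \<comment> \<open>\<open>outer\<close> asks for a function on the circle, not of the parameter.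
    \<open>inv_into\<close> selects some parameter, and \<open>pmax_cong\<close> shows that the
    selection does not matter.\<close>
  define u where "u \<zeta> = mr (inv_into UNIV zeta \<zeta>) powr (2 / p)" for \<zeta>
  have mr_inv: "mr (inv_into UNIV zeta (zeta x)) = mr x" for x
    unfolding mr_def m_def by (subst pmax_cong[of _ x]) (auto simp: f_inv_into_f)
  have Lu: "L x = ln (u (zeta x))" for x
  proof (cases "mr x = 0")
    case True
    then show ?thesis by (simp add: L_def u_def mr_inv)
  next
    case False
    then have "0 < mr x" by (simp add: mr_def less_le)
    then show ?thesis by (simp add: L_def u_def mr_inv ln_powr)
  qed
  define g where "g w = exp (herglotz L w)" for w
  have out: "outer g" unfolding g_def
    by (rule outer_exp_herglotz[where u=u]) (use int_L Lu in \<open>auto simp: u_def\<close>)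
  have hol: "g holomorphic_on disc"
    unfolding g_def by (intro holomorphic_intros herglotz_holomorphic int_L)
  have cg: "cmod (g w) = exp (LINT x|circ. pois w x * L x)" if "cmod w < 1" for w
    using Re_herglotz[OF int_L that] by (simp add: g_def)
  have gp: "ennreal (cmod (g w) powr p) \<le> (\<integral>\<^sup>+y. ennreal (pois w y) * (m y)\<^sup>2 \<partial>circ)" if w: "cmod w < 1" for w
  proof -
    have "cmod (g w) powr p = exp (p * (LINT x|circ. pois w x * L x))" by (simp add: cg[OF w] powr_def)
    also have "p * (LINT x|circ. pois w x * L x) = (LINT x|circ. pois w x * (p * L x))"
      by (subst integral_mult_right_zero[symmetric]) (simp add: mult_ac)
    also have "ennreal (exp (LINT x|circ. pois w x * (p * L x))) \<le> (\<integral>\<^sup>+x. ennreal (pois w x * exp (p * L x)) \<partial>circ)"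
      by (rule exp_pois_le[OF w]) (use int_L in simp)
    also have "\<dots> \<le> (\<integral>\<^sup>+y. ennreal (pois w y) * (m y)\<^sup>2 \<partial>circ)"
    proof (intro nn_integral_mono_AE)
      show "AE x in circ. ennreal (pois w x * exp (p * L x)) \<le> ennreal (pois w x) * (m x)\<^sup>2"
        using mAE mrAE
      proof eventually_elim
        case (elim x)
        have "exp (p * L x) = (mr x)\<^sup>2"
          using p elim c by (simp add: L_def power2_eq_square exp_add[symmetric] mult_2[symmetric]) (simp add: exp_double power2_eq_square)
        then show ?case using elim c pois_nonneg[OF w] by (simp add: ennreal_mult' ennreal_power)
      qed
    qed
    finally show ?thesis .
  qed
  have sup: "Hp_sup p g \<le> 64 * (\<integral>\<^sup>+x. (ennreal (V x))\<^sup>2 \<partial>circ)"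
    unfolding Hp_sup_def
  proof (intro SUP_least)
    fix r :: real assume r: "r \<in> {0<..<1}"
    interpret pair_sigma_finite circ circ ..
    have "Hp_integral p g r = (\<integral>\<^sup>+x. ennreal (cmod (g (of_real r * zeta x)) powr p) \<partial>circ)"
      by (simp add: Hp_integral_def nn_integral_circ)
    also have "\<dots> \<le> (\<integral>\<^sup>+x. \<integral>\<^sup>+y. ennreal (pois (of_real r * zeta x) y) * (m y)\<^sup>2 \<partial>circ \<partial>circ)"
      using r by (intro nn_integral_mono gp) (simp add: norm_mult)
    also have "\<dots> = (\<integral>\<^sup>+y. \<integral>\<^sup>+x. ennreal (pois (of_real r * zeta x) y) * (m y)\<^sup>2 \<partial>circ \<partial>circ)"
      by (rule Fubini') measurable
    also have "\<dots> = (\<integral>\<^sup>+y. (m y)\<^sup>2 \<partial>circ)"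
    proof (intro nn_integral_cong)
      fix y
      have "(\<integral>\<^sup>+x. ennreal (pois (of_real r * zeta x) y) * (m y)\<^sup>2 \<partial>circ)
        = (\<integral>\<^sup>+x. ennreal (pois (of_real r * zeta y) x) \<partial>circ) * (m y)\<^sup>2"
        by (subst pois_symm, rule nn_integral_multc) measurable
      then show "(\<integral>\<^sup>+x. ennreal (pois (of_real r * zeta x) y) * (m y)\<^sup>2 \<partial>circ) = (m y)\<^sup>2"
        using r by (simp add: nn_integral_pois norm_mult)
    qed
    also note m2
    finally show "Hp_integral p g r \<le> 64 * (\<integral>\<^sup>+x. (ennreal (V x))\<^sup>2 \<partial>circ)" .
  qed
  have Hp: "in_Hp p g" unfolding in_Hp_def analytic_disc_complex_iff
    using hol order_le_less_trans[OF sup fin64] by simp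
  have lower: "(\<integral>\<^sup>+x. ennreal (V x) * st x w \<partial>circ) \<le> ennreal (200 * (1 - cmod w) * cmod (g w) powr (p / 2))"
    if w: "cmod w < 1" for w
  proof -
    define I where "I = (\<integral>\<^sup>+x. ennreal (V x) * st x w \<partial>circ)"
    define \<delta> where "\<delta> = 1 - cmod w"
    have \<delta>: "0 < \<delta>" "\<delta> \<le> 1" using w by (auto simp: \<delta>_def)
    have "I \<le> (\<integral>\<^sup>+x. 1 + (ennreal (V x))\<^sup>2 \<partial>circ)"
      unfolding I_def
    proof (intro nn_integral_mono)
      fix x
      have "V x \<le> 1 + (V x)\<^sup>2" by (rule le_one_plus_square)
      then have "ennreal (V x) \<le> 1 + (ennreal (V x))\<^sup>2"
        using V0 by (simp add: ennreal_power ennreal_leI flip: ennreal_plus ennreal_1)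
      moreover have "ennreal (V x) * st x w \<le> ennreal (V x) * 1"
        by (intro mult_left_mono) (auto simp: st_def split: split_indicator)
      ultimately show "ennreal (V x) * st x w \<le> 1 + (ennreal (V x))\<^sup>2" by simp
    qed
    also have "\<dots> < top" using fin by (subst nn_integral_add) auto
    finally obtain i where i: "I = ennreal i" "0 \<le> i" by (cases I) auto
    have "ennreal (N * (\<delta> / 13)) = ennreal N * ennreal (\<delta> / 13)" using N \<delta> by (intro ennreal_mult) auto
    also have "\<dots> \<le> ennreal N * (\<integral>\<^sup>+x. st x w \<partial>circ)"
      unfolding \<delta>_def by (intro mult_left_mono nn_integral_st_ge w) auto
    also have "\<dots> = (\<integral>\<^sup>+x. ennreal N * st x w \<partial>circ)" by (simp add: nn_integral_cmult)
    also have "\<dots> \<le> I" unfolding I_def using N by (intro nn_integral_mono mult_right_mono ennreal_leI) auto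
    finally have "N * (\<delta> / 13) \<le> i" using i by simp
    then have i0: "0 < i" using N \<delta> by (smt (verit) divide_pos_pos mult_pos_pos)
    define D where "D x = cmod (zeta x - w)" for x
    have D: "\<delta> \<le> D x" "D x < 2" for x
      using norm_zeta_minus_ge[of w x] norm_triangle_ineq4[of "zeta x" w] w by (auto simp: D_def \<delta>_def)
    \<comment> \<open>At a scale between D/4 and D/2, a point y of J_w has scale plus chord at most
      D/2 + D + 3 \<delta> \<le> 5 D, because \<delta> \<le> D. The kernel is therefore at least
      (D/4) / (5 D)^2 = 1 / (100 D). Comparing with D/2 keeps the scale below 1, as D may approach
      2.\<close>
    have mlow: "ennreal (i / (100 * D x)) \<le> m x" for x
    proof -
      have D2: "0 < D x / 2" "D x / 2 < 1" using D[of x] \<delta> by auto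
      obtain n where "1 / 2 ^ n \<le> D x / 2" "D x / 2 \<le> 2 * (1 / 2 ^ n)"
        by (rule dyadic_scale[OF D2(1) less_imp_le[OF D2(2)]])
      then have n: "1 / 2 ^ n \<le> D x / 2" "D x / 4 \<le> (1::real) / 2 ^ n" by simp_all
      have kl: "st y w \<le> ennreal (100 * D x * ker (1 / 2 ^ n) x y) " if "y \<in> {0..1}" for y
      proof (cases "w \<in> stolz (zeta y)")
        case True
        let ?d = "1 / 2 ^ n :: real"
        have "cmod (w - zeta y) \<le> 3 * \<delta>" unfolding \<delta>_def using True by (intro stolz_dist) auto
        moreover have "cmod (zeta x - zeta y) \<le> D x + cmod (w - zeta y)"
          unfolding D_def by (rule order_trans[OF _ norm_triangle_ineq]) simp
        ultimately have "?d + cmod (zeta x - zeta y) \<le> 5 * D x" using n D[of x] by linarith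
        then have k1: "(?d + cmod (zeta x - zeta y))\<^sup>2 \<le> (5 * D x)\<^sup>2" by (intro power_mono) auto
        have k2: "0 < (?d + cmod (zeta x - zeta y))\<^sup>2" by (intro zero_less_power add_pos_nonneg) auto
        have "(D x / 4) / (5 * D x)\<^sup>2 \<le> ker ?d x y"
          unfolding ker_def by (rule frac_le[OF _ n(2) k2 k1]) simp
        then have "100 * D x * ((D x / 4) / (5 * D x)\<^sup>2) \<le> 100 * D x * ker ?d x y"
          using D2 by (intro mult_left_mono) auto
        moreover have "100 * D x * ((D x / 4) / (5 * D x)\<^sup>2) = 1" using D2 by (simp add: power2_eq_square)
        ultimately have "1 \<le> 100 * D x * ker ?d x y" by simp
        then show ?thesis using True that by (simp add: st_def)
      qed (simp add: st_def)
      have "I \<le> (\<integral>\<^sup>+y. ennreal (100 * D x) * (ennreal (ker (1 / 2 ^ n) x y) * ennreal (V y)) \<partial>circ)"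
        unfolding I_def
      proof (intro nn_integral_mono)
        fix y assume "y \<in> space circ"
        then have "ennreal (V y) * st y w \<le> ennreal (V y) * ennreal (100 * D x * ker (1 / 2 ^ n) x y)"
          by (intro mult_left_mono kl) auto
        then show "ennreal (V y) * st y w \<le> ennreal (100 * D x) * (ennreal (ker (1 / 2 ^ n) x y) * ennreal (V y))"
          using D2 by (simp add: ennreal_mult' ker_nonneg ac_simps)
      qed
      also have "\<dots> = ennreal (100 * D x) * (\<integral>\<^sup>+y. ennreal (ker (1 / 2 ^ n) x y) * ennreal (V y) \<partial>circ)"
        by (rule nn_integral_cmult) measurable
      also have "\<dots> \<le> ennreal (100 * D x) * m x"
        unfolding m_def by (intro mult_left_mono pmax_ge) auto
      finally have "ennreal (1 / (100 * D x)) * ennreal i \<le> ennreal (1 / (100 * D x)) * (ennreal (100 * D x) * m x)"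
        unfolding i by (rule mult_left_mono) simp
      also have "\<dots> = m x" using D2 by (simp add: mult.assoc[symmetric] ennreal_mult'[symmetric])
      finally show ?thesis using i D2 by (simp add: ennreal_mult'[symmetric])
    qed
    have D0: "0 < D x" for x using D(1)[of x] \<delta> by linarith
    have lnm: "AE x in circ. ln (i / 100) - ln (D x) \<le> ln (mr x)"
      using mAE
    proof eventually_elim
      case (elim x)
      have "0 \<le> mr x" by (simp add: mr_def)
      then have le: "i / (100 * D x) \<le> mr x" using mlow[of x] unfolding elim by simp
      have pos: "0 < i / (100 * D x)" using i0 D0[of x] by simp
      have "ln (i / 100) - ln (D x) = ln (i / (100 * D x))" using i0 D0[of x] by (simp add: ln_div ln_mult)
      also have "\<dots> \<le> ln (mr x)" using le pos by simp
      finally show ?case .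
    qed
    \<comment> \<open>The Poisson mean of ln D is ln (1 - |w|^2), at most ln (2 \<delta>); hence 200
      = 100 * 2.\<close>
    have "ln (i / (200 * \<delta>)) \<le> (LINT x|circ. pois w x * ln (mr x))"
    proof -
      have "(1 - (cmod w)\<^sup>2) = (1 + cmod w) * \<delta>" by (simp add: \<delta>_def power2_eq_square algebra_simps)
      also have "\<dots> \<le> 2 * \<delta>" using w \<delta> by (intro mult_right_mono) auto
      finally have "1 - (cmod w)\<^sup>2 \<le> 2 * \<delta>" .
      moreover have "0 < 1 - (cmod w)\<^sup>2" using w by (simp add: abs_square_less_1)
      ultimately have "ln (1 - (cmod w)\<^sup>2) \<le> ln (2 * \<delta>)" by simp
      then have "ln (i / (200 * \<delta>)) \<le> ln (i / 100) - ln (1 - (cmod w)\<^sup>2)"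
      proof -
        have "ln (i / (200 * \<delta>)) = ln ((i / 100) / (2 * \<delta>))" by simp
        also have "\<dots> = ln (i / 100) - ln (2 * \<delta>)" using i0 \<delta> by (subst ln_div) auto
        finally show ?thesis using \<open>ln (1 - (cmod w)\<^sup>2) \<le> ln (2 * \<delta>)\<close> by linarith
      qed
      also have "\<dots> = (LINT x|circ. pois w x * ln (i / 100) - pois w x * ln (D x))"
        using integrable_pois[OF w] integrable_pois_log_dist[OF w] pois_mean_log_dist[OF w]
        by (simp add: Bochner_Integration.integral_diff D_def integral_pois[OF w])
      also have "\<dots> \<le> (LINT x|circ. pois w x * ln (mr x))"
      proof (rule integral_mono_AE)
        show "integrable circ (\<lambda>x. pois w x * ln (i / 100) - pois w x * ln (D x))"
          using integrable_pois[OF w] integrable_pois_log_dist[OF w] by (simp add: D_def)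
        show "integrable circ (\<lambda>x. pois w x * ln (mr x))" by (rule integrable_pois_mult[OF w int_ln])
        show "AE x in circ. pois w x * ln (i / 100) - pois w x * ln (D x) \<le> pois w x * ln (mr x)"
          using lnm by eventually_elim (simp add: right_diff_distrib[symmetric] mult_left_mono pois_nonneg[OF w])
      qed
      finally show ?thesis .
    qed
    then have "exp (ln (i / (200 * \<delta>))) \<le> exp (LINT x|circ. pois w x * ln (mr x))" by simp
    moreover have "exp (LINT x|circ. pois w x * ln (mr x)) = cmod (g w) powr (p / 2)"
    proof -
      have "(LINT x|circ. pois w x * L x) = 2 / p * (LINT x|circ. pois w x * ln (mr x))"
        unfolding L_def by (subst integral_mult_right_zero[symmetric]) (simp add: mult_ac)
      then show ?thesis using p by (simp add: cg[OF w] powr_def)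
    qed
    ultimately have "i / (200 * \<delta>) \<le> cmod (g w) powr (p / 2)" using i0 \<delta> by simp
    then have "i \<le> 200 * \<delta> * cmod (g w) powr (p / 2)" using \<delta> by (simp add: field_simps)
    then show ?thesis using i by (simp add: I_def[symmetric] \<delta>_def[symmetric] ennreal_leI)
  qed
  show thesis by (rule that[OF out Hp sup _ lower]) (auto simp: g_def)
qed

section \<open>Factorization\<close>

lemma ennpow_ennreal: "0 \<le> a \<Longrightarrow> ennpow (ennreal a) t = ennreal (a powr t)"
  by (simp add: ennpow_def)

lemma ennpow_top [simp]: "ennpow top t = top"
  by (simp add: ennpow_def)

lemma ennpow_zero [simp]: "ennpow 0 t = 0"
  by (simp add: ennpow_def)

lemma ennpow_mono: assumes "a \<le> b" "0 \<le> t" shows "ennpow a t \<le> ennpow b t"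
  using assms by (cases a; cases b) (auto simp: ennpow_ennreal top_unique intro!: ennreal_leI powr_mono2)

lemma ennpow_eq_top_iff [simp]: "ennpow a t = top \<longleftrightarrow> a = top"
  by (simp add: ennpow_def)

lemma measurable_ennpow [measurable (raw)]:
  assumes [measurable]: "f \<in> borel_measurable M" shows "(\<lambda>x. ennpow (f x) t) \<in> borel_measurable M"
  unfolding ennpow_def by measurable

lemma enn2real_ennpow: "0 < t \<Longrightarrow> enn2real (ennpow a t) = enn2real a powr t"
  by (simp add: ennpow_def)

section \<open>Dyadic arcs and integrals over their tents\<close>

lemma zeta_eq_imp: assumes "zeta x = zeta y" "\<bar>x - y\<bar> < 1" shows "x = y"
proof -
  have "sin (pi * (x - y)) = 0" using norm_zeta_diff[of x y] assms by simp
  then obtain i where "pi * (x - y) = of_int i * pi" using sin_zero_iff_int2 by blast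
  then have "x - y = of_int i" by simp
  moreover have "i = 0"
  proof -
    have "real_of_int \<bar>i\<bar> < real_of_int 1" using calculation assms(2) by simp
    then show ?thesis by (simp only: of_int_less_iff)
  qed
  ultimately show ?thesis by simp
qed

text \<open>The parameters 0 and 1 name the same point, so 1 joins the arc with k = 0 although the
  interval is half-open.\<close>

lemma dyadic_arc_iff:
  assumes k: "k < 2 ^ j" and x: "x \<in> {0..1}"
  shows "zeta x \<in> dyadic_arc j k \<longleftrightarrow> x \<in> {real k / 2 ^ j ..< (real k + 1) / 2 ^ j} \<or> (x = 1 \<and> k = 0)"
proof
  assume "zeta x \<in> dyadic_arc j k"
  then obtain y where y: "real k / 2 ^ j \<le> y" "y < (real k + 1) / 2 ^ j" "zeta x = zeta y"
    by (auto simp: dyadic_arc_def)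
  have "real k + 1 \<le> 2 ^ j" using k by (metis Suc_leI add.commute of_nat_Suc of_nat_le_iff of_nat_numeral of_nat_power)
  then have "(real k + 1) / 2 ^ j \<le> 1" by simp
  then have "y < 1" using y(2) by linarith
  moreover have "0 \<le> real k / 2 ^ j" by simp
  then have "0 \<le> y" using y(1) by linarith
  ultimately have y01: "0 \<le> y" "y < 1" by auto
  show "x \<in> {real k / 2 ^ j ..< (real k + 1) / 2 ^ j} \<or> (x = 1 \<and> k = 0)"
  proof (cases "x = 1 \<and> y = 0")
    case True
    then have "real k / 2 ^ j \<le> 0" using y by simp
    then show ?thesis using True by (simp add: field_simps)
  next
    case False
    then have "\<bar>x - y\<bar> < 1" using x y01 by auto
    then show ?thesis using zeta_eq_imp[OF y(3)] y by auto
  qed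
next
  assume r: "x \<in> {real k / 2 ^ j ..< (real k + 1) / 2 ^ j} \<or> (x = 1 \<and> k = 0)"
  have z10: "zeta 1 = zeta 0" using zeta_add_int[of 0 1] by simp
  from r show "zeta x \<in> dyadic_arc j k" unfolding dyadic_arc_def
  proof (elim disjE)
    assume "x = 1 \<and> k = 0"
    then show "zeta x \<in> zeta ` {real k / 2 ^ j ..< (real k + 1) / 2 ^ j}"
      using z10 by (intro image_eqI[of _ zeta 0]) auto
  qed (rule imageI)
qed

lemma dyadic_arc_indicator:
  assumes k: "k < 2 ^ j" and x: "x \<in> {0..1}"
  shows "(indicator (dyadic_arc j k) (zeta x) :: ennreal)
    = indicator ({real k / 2 ^ j ..< (real k + 1) / 2 ^ j} \<union> (if k = 0 then {1} else {})) x"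
proof -
  have "x \<in> {real k / 2 ^ j ..< (real k + 1) / 2 ^ j} \<union> (if k = 0 then {1} else {}) \<longleftrightarrow> zeta x \<in> dyadic_arc j k"
    unfolding dyadic_arc_iff[OF assms] by simp
  then show ?thesis by (simp only: indicator_def)
qed

lemma measurable_dyadic_arc:
  assumes k: "k < 2 ^ j" shows "(\<lambda>x. indicator (dyadic_arc j k) (zeta x) :: ennreal) \<in> borel_measurable circ"
proof -
  have "(\<lambda>x. indicator ({real k / 2 ^ j ..< (real k + 1) / 2 ^ j} \<union> (if k = 0 then {1} else {})) x :: ennreal) \<in> borel_measurable circ"
    by (rule measurable_circ) simp
  then show ?thesis by (subst measurable_cong[OF dyadic_arc_indicator[OF k]]) auto
qed

lemma nn_integral_dyadic_arc:
  assumes k: "k < 2 ^ j" shows "(\<integral>\<^sup>+x. indicator (dyadic_arc j k) (zeta x) \<partial>circ) \<le> ennreal (1 / 2 ^ j)"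
proof -
  let ?A = "{real k / 2 ^ j ..< (real k + 1) / 2 ^ j}" and ?B = "if k = 0 then {1} else {} :: real set"
  have "(\<integral>\<^sup>+x. indicator (dyadic_arc j k) (zeta x) \<partial>circ) = (\<integral>\<^sup>+x. indicator (?A \<union> ?B) x \<partial>circ)"
    by (rule nn_integral_cong) (simp add: dyadic_arc_indicator[OF k])
  also have "\<dots> = (\<integral>\<^sup>+x. indicator (?A \<union> ?B) x * indicator {0..1} x \<partial>lborel)"
    by (simp add: nn_integral_circ[symmetric])
  also have "\<dots> \<le> (\<integral>\<^sup>+x. indicator (?A \<union> ?B) x \<partial>lborel)"
    by (intro nn_integral_mono) (auto split: split_indicator)
  also have "\<dots> = emeasure lborel (?A \<union> ?B)" by simp
  also have "\<dots> \<le> emeasure lborel ?A + emeasure lborel ?B" by (rule emeasure_subadditive) auto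
  also have "emeasure lborel ?B = 0" by simp
  also have "emeasure lborel ?A = ennreal (1 / 2 ^ j)"
    by (simp add: field_simps)
  finally show ?thesis by simp
qed

lemma tent_subset_disc: "tent E \<subseteq> disc"
  by (auto simp: tent_def)

lemma tent_inf_sup_dens:
  "tent_inf_sup q F = (SUP (j, k)\<in>{(j, k). k < 2 ^ j}.
      ennreal (2 ^ j) * (\<integral>\<^sup>+z. dens q F z * indicator (tent (dyadic_arc j k)) z \<partial>lborel))"
proof -
  have "ennreal (norm (F z) powr q / (1 - cmod z)) * indicator (tent (dyadic_arc j k)) z
     = dens q F z * indicator (tent (dyadic_arc j k)) z" for j k z
    using tent_subset_disc[of "dyadic_arc j k"] by (auto simp: dens_def split: split_indicator)
  then show ?thesis unfolding tent_inf_sup_def by simp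
qed

lemma tent_int_circ: "tent_int p q F = (\<integral>\<^sup>+x. ennpow (Aq_q q F (zeta x)) (p / q) \<partial>circ)"
  by (simp add: tent_int_def nn_integral_circ)

text \<open>A point \<open>z\<close> lies in \<open>tent E\<close> precisely if all points of the circle having \<open>z\<close> in their
  Stolz angle lie in \<open>E\<close>.\<close>

lemma tent_nn_integral_le:
  assumes F: "continuous_on disc F" "0 < q" and [measurable]: "v \<in> borel_measurable circ"
    and [measurable]: "(\<lambda>x. indicator E (zeta x) :: ennreal) \<in> borel_measurable circ"
    and G: "\<And>z. cmod z < 1 \<Longrightarrow> dens q G z \<le> dens q F z * ennreal (1 / (1 - cmod z)) * (\<integral>\<^sup>+x. v x * st x z \<partial>circ)"
  shows "(\<integral>\<^sup>+z. dens q G z * indicator (tent E) z \<partial>lborel)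
    \<le> (\<integral>\<^sup>+x. indicator E (zeta x) * v x * Aq_q q F (zeta x) \<partial>circ)"
proof -
  have "(\<integral>\<^sup>+z. dens q G z * indicator (tent E) z \<partial>lborel)
    \<le> (\<integral>\<^sup>+z. dens q F z * ennreal (1 / (1 - cmod z)) * (\<integral>\<^sup>+x. indicator E (zeta x) * v x * st x z \<partial>circ) \<partial>lborel)"
  proof (rule nn_integral_mono)
    fix z
    show "dens q G z * indicator (tent E) z
      \<le> dens q F z * ennreal (1 / (1 - cmod z)) * (\<integral>\<^sup>+x. indicator E (zeta x) * v x * st x z \<partial>circ)"
    proof (cases "z \<in> tent E")
      case True
      then have z: "cmod z < 1" using tent_subset_disc by force
      have "v x * st x z = indicator E (zeta x) * v x * st x z" for x
      proof (cases "zeta x \<in> E")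
        case False
        then have "z \<notin> stolz (zeta x)" using True by (auto simp: tent_def)
        then show ?thesis by (simp add: st_def)
      qed simp
      then show ?thesis using True G[OF z] by simp
    qed simp
  qed
  also have "\<dots> = (\<integral>\<^sup>+x. indicator E (zeta x) * v x * Aq_q q F (zeta x) \<partial>circ)"
    by (rule nn_integral_Aq_q[OF F, symmetric]) measurable
  finally show ?thesis .
qed

text \<open>The tangent at m of the convex function y^(-b), in the form that is integrated over J_w
  below.\<close>

lemma powr_neg_tangent:
  fixes m y b :: real assumes "0 < m" "0 < y" "0 < b"
  shows "m powr (- b) * (1 + b) \<le> y powr (- b) + b * m powr (- b) / m * y"
proof -
  have "ln (y / m) \<le> y / m - 1" using assms by (intro ln_le_minus_one) simp
  then have "b * ln (y / m) \<le> b * (y / m - 1)" using assms by (intro mult_left_mono) auto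
  then have "1 - b * (y / m - 1) \<le> 1 + (- b * ln (y / m))" by simp
  also have "\<dots> \<le> exp (- b * ln (y / m))" by (rule exp_ge_add_one_self)
  also have "\<dots> = (y / m) powr (- b)" using assms by (simp add: powr_def)
  finally have "m powr (- b) * (1 - b * (y / m - 1)) \<le> m powr (- b) * (y / m) powr (- b)"
    by (intro mult_left_mono) auto
  also have "\<dots> = y powr (- b)" using assms by (simp add: powr_mult[symmetric])
  finally show ?thesis by (simp add: algebra_simps)
qed

text \<open>Jensen's inequality for the power -b on J_w. As J_w has measure J at least (1 - |w|)/13,
  the mean m of V is at most 200 * 13 a = 2600 a, so a^(-b) \<le> 2600^b m^(-b); the same lower
  bound of J turns the mean of V^(-b) into an integral with the factor 13/(1 - |w|).\<close>

lemma st_mean_powr: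
  fixes V :: "real \<Rightarrow> real"
  assumes V [measurable]: "V \<in> borel_measurable circ" and V0: "\<And>x. 0 < V x" and b: "0 < b"
    and w: "cmod w < 1" and a: "0 < a" "(\<integral>\<^sup>+x. ennreal (V x) * st x w \<partial>circ) \<le> ennreal (200 * (1 - cmod w) * a)"
  shows "ennreal (a powr (- b)) \<le> ennreal (13 * 2600 powr b) * ennreal (1 / (1 - cmod w)) * (\<integral>\<^sup>+x. ennreal (V x powr (- b)) * st x w \<partial>circ)"
proof -
  define \<delta> where "\<delta> = 1 - cmod w"
  have \<delta>: "0 < \<delta>" using w by (simp add: \<delta>_def)
  have "(\<integral>\<^sup>+x. st x w \<partial>circ) \<le> (\<integral>\<^sup>+x. 1 \<partial>circ)"
    by (intro nn_integral_mono) (auto simp: st_def split: split_indicator)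
  then have "(\<integral>\<^sup>+x. st x w \<partial>circ) \<le> 1" by simp
  then obtain J where J: "(\<integral>\<^sup>+x. st x w \<partial>circ) = ennreal J" "0 \<le> J"
    by (cases "\<integral>\<^sup>+x. st x w \<partial>circ") (auto simp: top_unique)
  have Jge: "\<delta> / 13 \<le> J" using nn_integral_st_ge[OF w] J by (simp add: \<delta>_def)
  then have J0: "0 < J" using \<delta> by linarith
  obtain i where i: "(\<integral>\<^sup>+x. ennreal (V x) * st x w \<partial>circ) = ennreal i" "0 \<le> i"
    using a(2) by (cases "\<integral>\<^sup>+x. ennreal (V x) * st x w \<partial>circ") (auto simp: top_unique)
  have ia: "i \<le> 200 * \<delta> * a" using a i \<delta> by (simp add: \<delta>_def)
  have i0: "i \<noteq> 0"
  proof
    assume "i = 0"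
    then have "(\<integral>\<^sup>+x. ennreal (V x) * st x w \<partial>circ) = 0" using i by simp
    then have "AE x in circ. ennreal (V x) * st x w = 0" by (subst (asm) nn_integral_0_iff_AE) measurable
    then have "AE x in circ. st x w = 0" 
    proof eventually_elim
      case (elim x)
      then show ?case using V0[of x] by (auto simp: ennreal_eq_0_iff)
    qed
    then have "(\<integral>\<^sup>+x. st x w \<partial>circ) = 0" by (subst nn_integral_0_iff_AE) auto
    then show False using J J0 by simp
  qed
  define m where "m = i / J"
  have m: "0 < m" using i i0 J0 by (simp add: m_def)
  define R where "R = (\<integral>\<^sup>+x. ennreal (V x powr (- b)) * st x w \<partial>circ)"
  have "ennreal (m powr (- b) * (1 + b)) * ennreal J = (\<integral>\<^sup>+x. ennreal (m powr (- b) * (1 + b)) * st x w \<partial>circ)"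
    unfolding J(1)[symmetric] by (rule nn_integral_cmult[symmetric]) measurable
  also have "\<dots> \<le> (\<integral>\<^sup>+x. ennreal (V x powr (- b)) * st x w + ennreal (b * m powr (- b) / m) * (ennreal (V x) * st x w) \<partial>circ)"
  proof (intro nn_integral_mono)
    fix x
    have "ennreal (m powr (- b) * (1 + b)) \<le> ennreal (V x powr (- b) + b * m powr (- b) / m * V x)"
      using powr_neg_tangent[OF m V0 b] by (rule ennreal_leI)
    also have "\<dots> = ennreal (V x powr (- b)) + ennreal (b * m powr (- b) / m) * ennreal (V x)"
    proof -
      have "ennreal (b * m powr (- b) / m * V x) = ennreal (b * m powr (- b) / m) * ennreal (V x)"
        using m b by (intro ennreal_mult') simp
      then show ?thesis using m b V0[of x] by (subst ennreal_plus) auto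
    qed
    finally have "ennreal (m powr (- b) * (1 + b)) * st x w
       \<le> (ennreal (V x powr (- b)) + ennreal (b * m powr (- b) / m) * ennreal (V x)) * st x w"
      by (rule mult_right_mono) simp
    then show "ennreal (m powr (- b) * (1 + b)) * st x w
       \<le> ennreal (V x powr (- b)) * st x w + ennreal (b * m powr (- b) / m) * (ennreal (V x) * st x w)"
      by (simp add: distrib_right mult.assoc)
  qed
  also have "\<dots> = R + ennreal (b * m powr (- b) / m) * ennreal i"
    unfolding R_def i(1)[symmetric] by (subst nn_integral_add) (auto simp: nn_integral_cmult)
  finally have main: "ennreal (m powr (- b) * (1 + b)) * ennreal J \<le> R + ennreal (b * m powr (- b) / m) * ennreal i" .
  have "ennreal (m powr (- b) * J) \<le> R"
  proof (cases R)
    case (real r)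
    have "ennreal (m powr (- b) * (1 + b) * J) \<le> ennreal (r + b * m powr (- b) / m * i)"
      using main real J i m b by (simp add: ennreal_mult'[symmetric] ennreal_plus[symmetric] del: ennreal_plus)
    then have "m powr (- b) * (1 + b) * J \<le> r + b * m powr (- b) / m * i"
      using real m b i by (subst (asm) ennreal_le_iff) auto
    \<comment> \<open>As m is the mean of V over J_w, the linear term of the tangent integrates to
      exactly the excess b m^(-b) J on the left.\<close>
    moreover have "b * m powr (- b) / m * i = b * m powr (- b) * J" using m J0 i0 by (simp add: m_def)
    ultimately have "m powr (- b) * J \<le> r" by (simp add: algebra_simps)
    then show ?thesis using real by (simp add: ennreal_leI)
  qed simp
  moreover have "a powr (- b) \<le> 13 * 2600 powr b / \<delta> * (m powr (- b) * J)"
  proof -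
    have "m * (\<delta> / 13) \<le> m * J" using Jge m by (intro mult_left_mono) auto
    also have "m * J = i" using J0 by (simp add: m_def)
    also note ia
    finally have "m * \<delta> \<le> 2600 * a * \<delta>" by (simp add: mult_ac)
    then have "m / 2600 \<le> a" using \<delta> by simp
    then have "a powr (- b) \<le> (m / 2600) powr (- b)" using m b by (intro powr_mono2') auto
    also have "\<dots> = 2600 powr b * m powr (- b)" using m by (simp add: powr_divide powr_minus field_simps)
    also have "\<dots> = 2600 powr b * m powr (- b) * 1" by simp
    also have "\<dots> \<le> 2600 powr b * m powr (- b) * (13 / \<delta> * J)"
      using Jge \<delta> by (intro mult_left_mono) (auto simp: field_simps)
    finally show ?thesis by (simp add: mult_ac)
  qed
  then have "ennreal (a powr (- b)) \<le> ennreal (13 * 2600 powr b / \<delta>) * ennreal (m powr (- b) * J)"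
    using \<delta> J m by (subst ennreal_mult[symmetric]) (auto intro!: ennreal_leI)
  ultimately have "ennreal (a powr (- b)) \<le> ennreal (13 * 2600 powr b / \<delta>) * R"
    by (meson mult_left_mono order_trans zero_le)
  also have "ennreal (13 * 2600 powr b / \<delta>) = ennreal (13 * 2600 powr b) * ennreal (1 / \<delta>)"
    using \<delta> by (subst ennreal_mult[symmetric]) auto
  finally show ?thesis by (simp add: R_def \<delta>_def)
qed

section \<open>Assembly of the factorization\<close>

lemma continuous_TL_weight:
  assumes "analytic_disc f" "s < 0" shows "continuous_on disc (TL_weight s f)"
  unfolding TL_weight_def using assms
  by (intro continuous_intros continuous_on_powr' analytic_disc_imp_continuous_on) auto

lemma norm_TL_weight_scaleC: "norm (TL_weight s (\<lambda>z. g z *\<^sub>C f z) z) = cmod (g z) * norm (TL_weight s f z)"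
  by (simp add: TL_weight_def norm_scaleC)

lemma dens_TL_weight_scaleC:
  "dens q (TL_weight s (\<lambda>z. g z *\<^sub>C f z)) z = ennreal (cmod (g z) powr q) * dens q (TL_weight s f) z"
proof (cases "z \<in> disc")
  case True
  then show ?thesis unfolding dens_def norm_TL_weight_scaleC
    by (simp add: powr_mult ennreal_mult[symmetric] mult.assoc)
qed (simp add: dens_def)

lemma outer_one: "outer (\<lambda>z. 1)"
  unfolding outer_def by (intro exI[of _ 1] exI[of _ "\<lambda>_. 1"]) simp

lemma Hp_one: "in_Hp p (\<lambda>z. 1)"
proof -
  have "Hp_integral p (\<lambda>z. 1 :: complex) r = 1" for r
    unfolding Hp_integral_def nn_integral_circ by simp
  then have "Hp_sup p (\<lambda>z. 1 :: complex) = 1" by (simp add: Hp_sup_def)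
  then show ?thesis by (simp add: in_Hp_def analytic_disc_complex_iff)
qed

text \<open>The constant 256 is 64 from the maximal theorem times 4 from the integral of V^2, which
  is at most 4 T; K is the Jensen constant of \<open>st_mean_powr\<close> for the exponent
  2q/p.\<close>

lemma TL_factorization:
  fixes f :: "complex \<Rightarrow> 'a::complex_banach" and s p q :: real
  assumes s: "s < 0" and p: "0 < p" and q: "1 \<le> q" and f: "in_F s p q f"
  defines "K \<equiv> 13 * 2600 powr (2 * q / p)"
  obtains g h where "in_Hp p g" "outer g" "in_Finf s q h" "\<And>z. z \<in> disc \<Longrightarrow> f z = g z *\<^sub>C h z"
    "Hp_norm p g * Finf_norm s q h \<le> 256 powr (1 / p) * K powr (1 / q) * F_norm s p q f"
proof -
  define F where "F = TL_weight s f"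
  define \<Phi> where "\<Phi> x = Aq_q q F (zeta x)" for x
  define T where "T = tent_int p q F"
  have an: "analytic_disc f" using f by (simp add: in_F_def)
  have F: "continuous_on disc F" "0 < q" using continuous_TL_weight[OF an s] q by (auto simp: F_def)
  have [measurable]: "\<Phi> \<in> borel_measurable circ" unfolding \<Phi>_def by (rule measurable_Aq_q[OF F])
  have T: "T = (\<integral>\<^sup>+x. ennpow (\<Phi> x) (p / q) \<partial>circ)" by (simp add: T_def tent_int_circ \<Phi>_def)
  have Tfin: "T < top" using f by (simp add: in_F_def T_def F_def)
  have "AE x in circ. ennpow (\<Phi> x) (p / q) \<noteq> \<infinity>" using Tfin T by (intro nn_integral_PInf_AE) auto
  then have \<Phi>fin: "AE x in circ. \<Phi> x < top" by eventually_elim (simp add: less_top)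
  have K0: "0 \<le> K" by (simp add: K_def)
  show thesis
  \<comment> \<open>The floor N used below would vanish for T = 0, but
    \<open>outer_dominating\<close> demands a positive one. In that case all tent integrals of f are
    zero, and g = 1, h = f will do.\<close>
  proof (cases "T = 0")
    case True
    then have "AE x in circ. ennpow (\<Phi> x) (p / q) = 0" using T by (simp add: nn_integral_0_iff_AE)
    then have \<Phi>0: "AE x in circ. \<Phi> x = 0"
    proof eventually_elim
      case (elim x)
      then show ?case by (cases "\<Phi> x") (auto simp: ennpow_ennreal)
    qed
    have sup0: "tent_inf_sup q F = 0"
    proof -
      have z: "(\<integral>\<^sup>+z. dens q F z * indicator (tent (dyadic_arc j k)) z \<partial>lborel) = 0" if k: "k < 2 ^ j" for j k
      proof -
        have "(\<integral>\<^sup>+z. dens q F z * indicator (tent (dyadic_arc j k)) z \<partial>lborel)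
          \<le> (\<integral>\<^sup>+x. indicator (dyadic_arc j k) (zeta x) * 13 * Aq_q q F (zeta x) \<partial>circ)"
        proof (rule tent_nn_integral_le[OF F _ measurable_dyadic_arc[OF k]])
          fix z :: complex assume z: "cmod z < 1"
          have "ennreal 1 = 13 * (ennreal (1 / (1 - cmod z)) * ennreal ((1 - cmod z) / 13))"
            using z by (subst ennreal_numeral[symmetric]) (simp add: ennreal_mult[symmetric] del: ennreal_numeral)
          also have "\<dots> \<le> 13 * (ennreal (1 / (1 - cmod z)) * (\<integral>\<^sup>+x. st x z \<partial>circ))"
            by (intro mult_left_mono nn_integral_st_ge z) auto
          finally have "dens q F z * 1 \<le> dens q F z * (13 * (ennreal (1 / (1 - cmod z)) * (\<integral>\<^sup>+x. st x z \<partial>circ)))"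
            by (intro mult_left_mono) auto
          moreover have "(\<integral>\<^sup>+x. 13 * st x z \<partial>circ) = 13 * (\<integral>\<^sup>+x. st x z \<partial>circ)"
            by (rule nn_integral_cmult) measurable
          ultimately show "dens q F z \<le> dens q F z * ennreal (1 / (1 - cmod z)) * (\<integral>\<^sup>+x. 13 * st x z \<partial>circ)"
            by (simp add: ac_simps)
        qed simp
        also have "\<dots> = 0"
        proof -
          note [measurable] = measurable_dyadic_arc[OF k] measurable_Aq_q[OF F]
          have m: "(\<lambda>x. indicator (dyadic_arc j k) (zeta x) * 13 * Aq_q q F (zeta x)) \<in> borel_measurable circ"
            by measurable
          show ?thesis using \<Phi>0 unfolding nn_integral_0_iff_AE[OF m] by eventually_elim (simp add: \<Phi>_def)
        qed
        finally show ?thesis by simp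
      qed
      show ?thesis unfolding tent_inf_sup_dens by (rule antisym, rule SUP_least) (auto simp: z)
    qed
    have Finf: "in_Finf s q f" using an sup0 by (simp add: in_Finf_def F_def)
    have "Finf_norm s q f = 0" using sup0 by (simp add: Finf_norm_def tent_inf_norm_def F_def)
    moreover have "F_norm s p q f = 0" using True by (simp add: F_norm_def tent_norm_def T_def F_def)
    ultimately show thesis
      by (intro that[OF Hp_one outer_one Finf]) (auto simp: scaleC_one)
  next
    case False
    obtain t where t: "T = ennreal t" "0 < t" using False Tfin by (cases T) (auto simp: less_le)
    \<comment> \<open>The square of the floor is T, so it contributes as much to the bound of the
      integral of V^2 as \<Phi> does, and the estimate stays homogeneous in f.\<close>
    define N where "N = sqrt t"
    define V where "V x = enn2real (\<Phi> x) powr (p / (2 * q)) + N" for x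
    have N: "0 < N" "N\<^sup>2 = t" using t by (auto simp: N_def)
    have VN: "N \<le> V x" for x by (simp add: V_def)
    have V0: "0 < V x" for x using VN[of x] N by linarith
    have [measurable]: "V \<in> borel_measurable circ" unfolding V_def by measurable
    have V2: "(\<integral>\<^sup>+x. (ennreal (V x))\<^sup>2 \<partial>circ) \<le> 4 * T"
    proof -
      have "(\<integral>\<^sup>+x. (ennreal (V x))\<^sup>2 \<partial>circ) \<le> (\<integral>\<^sup>+x. 2 * ennpow (\<Phi> x) (p / q) + 2 * T \<partial>circ)"
      proof (rule nn_integral_mono_AE)
        show "AE x in circ. (ennreal (V x))\<^sup>2 \<le> 2 * ennpow (\<Phi> x) (p / q) + 2 * T"
          using \<Phi>fin
        proof eventually_elim
          case (elim x)
          obtain r where r: "\<Phi> x = ennreal r" "0 \<le> r" using elim by (cases "\<Phi> x") auto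
          define y where "y = r powr (p / (2 * q))"
          have "y\<^sup>2 = r powr (p / q)" using F by (simp add: y_def power2_eq_square powr_add[symmetric])
          moreover have "(y + N)\<^sup>2 \<le> 2 * y\<^sup>2 + 2 * N\<^sup>2"
            using zero_le_power2[of "y - N"] by (simp add: power2_eq_square algebra_simps)
          ultimately have "ennreal ((V x)\<^sup>2) \<le> ennreal (2 * r powr (p / q) + 2 * t)"
            using r N by (intro ennreal_leI) (simp add: V_def y_def)
          also have "\<dots> = 2 * ennpow (\<Phi> x) (p / q) + 2 * T"
            using r t by (simp add: ennpow_ennreal ennreal_plus ennreal_mult)
          finally show ?case using V0[of x] by (simp add: ennreal_power)
        qed
      qed
      also have "\<dots> = 2 * T + 2 * T" by (subst nn_integral_add) (auto simp: nn_integral_cmult T)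
      also have "\<dots> = 4 * T" by (simp add: distrib_right[symmetric])
      finally show ?thesis .
    qed
    have "4 * T < top" using Tfin by (simp add: ennreal_mult_less_top)
    then have fin: "(\<integral>\<^sup>+x. (ennreal (V x))\<^sup>2 \<partial>circ) < top" using V2 by (rule le_less_trans[rotated])
    obtain g where g: "outer g" "in_Hp p g" "Hp_sup p g \<le> 64 * (\<integral>\<^sup>+x. (ennreal (V x))\<^sup>2 \<partial>circ)"
      "\<And>w. cmod w < 1 \<Longrightarrow> g w \<noteq> 0"
      "\<And>w. cmod w < 1 \<Longrightarrow> (\<integral>\<^sup>+x. ennreal (V x) * st x w \<partial>circ) \<le> ennreal (200 * (1 - cmod w) * cmod (g w) powr (p / 2))"
      by (rule outer_dominating[OF p _ N(1) VN fin]) auto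
    define h where "h z = inverse (g z) *\<^sub>C f z" for z
    \<comment> \<open>With this exponent (|g|^(p/2))^(-b) = |g|^(-q), and V^(-b) \<Phi> \<le> 1
      because V \<ge> \<Phi>^(p/(2q)).\<close>
    define b where "b = 2 * q / p"
    have b: "0 < b" using p F by (simp add: b_def)
    have fg: "f z = g z *\<^sub>C h z" if "z \<in> disc" for z
      using g(4)[of z] that by (simp add: h_def scaleC_scaleC scaleC_one)
    have ghol: "g holomorphic_on disc" using g(2) by (simp add: in_Hp_def analytic_disc_complex_iff)
    have "analytic_disc h"
      unfolding h_def using g(4) by (intro analytic_disc_scaleC an) (auto simp: analytic_disc_complex_iff intro!: holomorphic_intros ghol)
    moreover have sup: "tent_inf_sup q (TL_weight s h) \<le> ennreal K"
      unfolding tent_inf_sup_dens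
    proof (rule SUP_least, clarify)
      fix j k :: nat assume k: "k < 2 ^ j"
      define v where "v x = ennreal K * ennreal (V x powr (- b))" for x
      have [measurable]: "v \<in> borel_measurable circ" unfolding v_def by measurable
      have "(\<integral>\<^sup>+z. dens q (TL_weight s h) z * indicator (tent (dyadic_arc j k)) z \<partial>lborel)
        \<le> (\<integral>\<^sup>+x. indicator (dyadic_arc j k) (zeta x) * v x * Aq_q q F (zeta x) \<partial>circ)"
      proof (rule tent_nn_integral_le[OF F _ measurable_dyadic_arc[OF k]])
        fix z :: complex assume z: "cmod z < 1"
        have gz: "0 < cmod (g z) powr (p / 2)" using g(4)[OF z] by simp
        have "cmod (inverse (g z)) powr q = (cmod (g z) powr (p / 2)) powr (- b)"
          using p g(4)[OF z] by (simp add: powr_powr b_def norm_inverse inverse_powr powr_minus)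
        then have "ennreal (cmod (inverse (g z)) powr q)
          \<le> ennreal K * ennreal (1 / (1 - cmod z)) * (\<integral>\<^sup>+x. ennreal (V x powr (- b)) * st x z \<partial>circ)"
          using st_mean_powr[OF _ V0 b z gz g(5)[OF z]] by (simp add: K_def b_def)
        then have "ennreal (cmod (inverse (g z)) powr q) * dens q F z
          \<le> (ennreal K * ennreal (1 / (1 - cmod z)) * (\<integral>\<^sup>+x. ennreal (V x powr (- b)) * st x z \<partial>circ)) * dens q F z"
          by (rule mult_right_mono) simp
        then show "dens q (TL_weight s h) z \<le> dens q F z * ennreal (1 / (1 - cmod z)) * (\<integral>\<^sup>+x. v x * st x z \<partial>circ)"
          unfolding h_def dens_TL_weight_scaleC F_def[symmetric] v_def mult.assoc
          by (subst nn_integral_cmult) (auto simp: ac_simps)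
      qed simp
      also have "\<dots> \<le> (\<integral>\<^sup>+x. ennreal K * indicator (dyadic_arc j k) (zeta x) \<partial>circ)"
      proof (rule nn_integral_mono_AE)
        show "AE x in circ. indicator (dyadic_arc j k) (zeta x) * v x * Aq_q q F (zeta x)
           \<le> ennreal K * indicator (dyadic_arc j k) (zeta x)"
          using \<Phi>fin
        proof eventually_elim
          case (elim x)
          obtain r where r: "\<Phi> x = ennreal r" "0 \<le> r" using elim by (cases "\<Phi> x") auto
          have "V x powr (- b) * r \<le> 1"
          proof (cases "r = 0")
            case False
            then have r0: "0 < r" using r by simp
            have "r powr (p / (2 * q)) \<le> V x" using r N by (simp add: V_def)
            then have "V x powr (- b) \<le> (r powr (p / (2 * q))) powr (- b)"
              using b r0 by (intro powr_mono2') auto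
            also have "\<dots> = r powr (- 1)" using p F by (simp add: powr_powr b_def)
            finally have "V x powr (- b) * r \<le> r powr (- 1) * r" using r by (intro mult_right_mono) auto
            then show ?thesis using r0 by (simp add: powr_minus)
          qed simp
          then have "ennreal (V x powr (- b)) * \<Phi> x \<le> 1"
            using r by (simp add: ennreal_mult'[symmetric] flip: ennreal_1) 
          then have "ennreal K * indicator (dyadic_arc j k) (zeta x) * (ennreal (V x powr (- b)) * \<Phi> x)
             \<le> ennreal K * indicator (dyadic_arc j k) (zeta x) * 1"
            by (intro mult_left_mono) auto
          then show ?case by (simp add: v_def \<Phi>_def ac_simps)
        qed
      qed
      also have "\<dots> = ennreal K * (\<integral>\<^sup>+x. indicator (dyadic_arc j k) (zeta x) \<partial>circ)"
        by (rule nn_integral_cmult[OF measurable_dyadic_arc[OF k]])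
      also have "\<dots> \<le> ennreal K * ennreal (1 / 2 ^ j)"
        by (intro mult_left_mono nn_integral_dyadic_arc k) auto
      finally have "ennreal (2 ^ j) * (\<integral>\<^sup>+z. dens q (TL_weight s h) z * indicator (tent (dyadic_arc j k)) z \<partial>lborel)
        \<le> ennreal (2 ^ j) * (ennreal K * ennreal (1 / 2 ^ j))" by (rule mult_left_mono) simp
      also have "\<dots> = ennreal K" using K0 by (simp add: ennreal_mult[symmetric])
      finally show "ennreal (2 ^ j) * (\<integral>\<^sup>+z. dens q (TL_weight s h) z * indicator (tent (dyadic_arc j k)) z \<partial>lborel) \<le> ennreal K" .
    qed
    ultimately have hF: "in_Finf s q h" by (auto simp: in_Finf_def less_top[symmetric] top_unique)
    have "Finf_norm s q h \<le> K powr (1 / q)"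
    proof -
      have "enn2real (tent_inf_sup q (TL_weight s h)) \<le> K" using sup K0 by (intro enn2real_leI) auto
      then show ?thesis unfolding Finf_norm_def tent_inf_norm_def using F
        by (subst enn2real_ennpow) (auto intro!: powr_mono2)
    qed
    moreover have "Hp_norm p g \<le> 256 powr (1 / p) * F_norm s p q f"
    proof -
      have "Hp_sup p g \<le> 64 * (4 * T)" using g(3) V2 by (meson mult_left_mono order_trans zero_le)
      also have "\<dots> = ennreal (256 * t)" using t by (simp add: ennreal_mult)
      finally have "enn2real (Hp_sup p g) \<le> 256 * t" using t by (intro enn2real_leI) auto
      then have "Hp_norm p g \<le> (256 * t) powr (1 / p)" unfolding Hp_norm_def using p
        by (subst enn2real_ennpow) (auto intro!: powr_mono2)
      also have "\<dots> = 256 powr (1 / p) * F_norm s p q f" unfolding F_norm_def tent_norm_def using p t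
        by (subst enn2real_ennpow) (auto simp: F_def[symmetric] T_def[symmetric] powr_mult)
      finally show ?thesis .
    qed
    ultimately have "Hp_norm p g * Finf_norm s q h \<le> (256 powr (1 / p) * F_norm s p q f) * K powr (1 / q)"
      by (intro mult_mono) (auto simp: Finf_norm_def tent_inf_norm_def F_norm_def tent_norm_def)
    then show thesis by (intro that[OF g(2,1) hF fg]) (simp_all add: mult_ac)
  qed
qed

section \<open>Nontangential majorants for Hardy functions\<close>

text \<open>The Poisson kernel as an approximate identity, uniformly in x because a maximum
  principle on a whole circle of radius r is to follow. Uniform continuity settles chords below
  \<eta>; beyond, the kernel is at most 4 (1 - r^2) / \<eta>^2.\<close>

lemma Poisson_boundary:
  fixes \<phi> :: "complex \<Rightarrow> real"
  assumes \<phi>: "continuous_on (sphere 0 1) \<phi>" and e: "0 < e"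
  obtains r0 where "r0 < 1" "\<And>r x. r0 < r \<Longrightarrow> 0 \<le> r \<Longrightarrow> r < 1 \<Longrightarrow>
    \<bar>(LINT y|circ. pois (of_real r * zeta x) y * \<phi> (zeta y)) - \<phi> (zeta x)\<bar> \<le> e"
proof -
  have "compact (\<phi> ` sphere 0 1)" by (intro compact_continuous_image \<phi>) simp
  then have "bounded (\<phi> ` sphere 0 1)" by (rule compact_imp_bounded)
  then obtain B where B: "0 < B" "\<And>\<zeta>. cmod \<zeta> = 1 \<Longrightarrow> \<bar>\<phi> \<zeta>\<bar> \<le> B"
    unfolding bounded_pos by auto
  have "uniformly_continuous_on (sphere 0 1) \<phi>"
    by (intro compact_uniformly_continuous \<phi>) simp
  then obtain \<eta> where \<eta>: "0 < \<eta>" "\<And>x y. cmod x = 1 \<Longrightarrow> cmod y = 1 \<Longrightarrow> cmod (y - x) < \<eta> \<Longrightarrow> \<bar>\<phi> y - \<phi> x\<bar> < e / 2"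
    unfolding uniformly_continuous_on_def dist_norm real_norm_def using e by (metis half_gt_zero mem_sphere_0)
  \<comment> \<open>Then 1 - r^2 \<le> 2 (1 - r) is at most e \<eta>^2 / (16 B), which makes the far
    part 8 B (1 - r^2) / \<eta>^2 at most e/2.\<close>
  define r0 where "r0 = 1 - e * \<eta>\<^sup>2 / (32 * B)"
  show thesis
  proof (rule that)
    show "r0 < 1" using e \<eta> B by (simp add: r0_def)
    fix r x :: real assume r: "r0 < r" "0 \<le> r" "r < 1"
    define w where "w = of_real r * zeta x"
    have w: "cmod w < 1" using r by (simp add: w_def norm_mult)
    have cont: "continuous_on {0..1} (\<lambda>y. \<phi> (zeta y))"
      by (rule continuous_on_compose2[OF \<phi>]) (auto intro!: continuous_intros)
    have i1: "integrable circ (\<lambda>y. pois w y * \<phi> (zeta y))"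
      by (intro continuous_integrable_circ continuous_intros w cont)
    have i2: "integrable circ (\<lambda>y. pois w y * \<phi> (zeta x))"
      by (intro continuous_integrable_circ continuous_intros w)
    have i3: "integrable circ (\<lambda>y. pois w y * (e / 2) + 8 * B * (1 - r\<^sup>2) / \<eta>\<^sup>2)"
      by (intro continuous_integrable_circ continuous_intros w)
    have "\<bar>(LINT y|circ. pois w y * \<phi> (zeta y)) - \<phi> (zeta x)\<bar>
      = \<bar>LINT y|circ. pois w y * \<phi> (zeta y) - pois w y * \<phi> (zeta x)\<bar>"
      using i1 i2 by (simp add: Bochner_Integration.integral_diff integral_pois[OF w])
    also have "\<dots> \<le> (LINT y|circ. pois w y * (e / 2) + 8 * B * (1 - r\<^sup>2) / \<eta>\<^sup>2)"
    proof (rule order_trans[OF integral_abs_bound integral_mono])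
      show "integrable circ (\<lambda>y. \<bar>pois w y * \<phi> (zeta y) - pois w y * \<phi> (zeta x)\<bar>)"
        using i1 i2 by simp
      fix y
      have d: "cmod (zeta y - zeta x) \<le> 2 * cmod (zeta y - w)"
      proof -
        have "zeta y - zeta x = (zeta y - w) - of_real (1 - r) * zeta x" by (simp add: w_def algebra_simps)
        then have "cmod (zeta y - zeta x) \<le> cmod (zeta y - w) + cmod (of_real (1 - r) * zeta x)"
          by (metis norm_triangle_ineq4)
        moreover have "cmod (of_real (1 - r) * zeta x) = 1 - r" using r by (simp add: norm_mult del: of_real_diff)
        moreover have "cmod w = r" using r by (simp add: w_def norm_mult)
        ultimately show ?thesis using norm_zeta_minus_ge[of w y] by linarith
      qed
      have "pois w y * \<bar>\<phi> (zeta y) - \<phi> (zeta x)\<bar> \<le> pois w y * (e / 2) + 8 * B * (1 - r\<^sup>2) / \<eta>\<^sup>2"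
      proof (cases "cmod (zeta y - zeta x) < \<eta>")
        case True
        then have "pois w y * \<bar>\<phi> (zeta y) - \<phi> (zeta x)\<bar> \<le> pois w y * (e / 2)"
          using \<eta>(2)[of "zeta x" "zeta y"] pois_nonneg[OF w] by (intro mult_left_mono) auto
        moreover have "0 \<le> 8 * B * (1 - r\<^sup>2) / \<eta>\<^sup>2" using B r by (simp add: abs_square_le_1)
        ultimately show ?thesis by linarith
      next
        case False
        then have "\<eta>\<^sup>2 \<le> (2 * cmod (zeta y - w))\<^sup>2" using d \<eta> by (intro power_mono) auto
        then have "\<eta>\<^sup>2 \<le> 4 * (cmod (zeta y - w))\<^sup>2" by (simp add: power_mult_distrib)
        then have "pois w y \<le> (1 - r\<^sup>2) / (\<eta>\<^sup>2 / 4)"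
          unfolding pois_def using r \<eta> zeta_neq[OF w]
          by (intro frac_le) (auto simp: w_def norm_mult abs_square_le_1)
        moreover have "\<bar>\<phi> (zeta y) - \<phi> (zeta x)\<bar> \<le> 2 * B"
          using B(2)[of "zeta x"] B(2)[of "zeta y"] by simp
        ultimately have "pois w y * \<bar>\<phi> (zeta y) - \<phi> (zeta x)\<bar> \<le> (1 - r\<^sup>2) / (\<eta>\<^sup>2 / 4) * (2 * B)"
          using r pois_nonneg[OF w] by (intro mult_mono) (auto simp: abs_square_le_1)
        moreover have "0 \<le> pois w y * (e / 2)" using pois_nonneg[OF w, of y] e by simp
        ultimately show ?thesis by (simp add: mult_ac)
      qed
      then show "\<bar>pois w y * \<phi> (zeta y) - pois w y * \<phi> (zeta x)\<bar> \<le> pois w y * (e / 2) + 8 * B * (1 - r\<^sup>2) / \<eta>\<^sup>2"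
        using pois_nonneg[OF w, of y] by (simp add: right_diff_distrib[symmetric] abs_mult)
    qed (rule i3)
    also have "\<dots> = e / 2 + 8 * B * (1 - r\<^sup>2) / \<eta>\<^sup>2"
      using integrable_pois[OF w] by (simp add: integral_pois[OF w] measure_def)
    also have "\<dots> \<le> e"
    proof -
      have "1 - r\<^sup>2 = (1 + r) * (1 - r)" by (simp add: power2_eq_square algebra_simps)
      also have "\<dots> \<le> 2 * (1 - r)" using r by (intro mult_right_mono) auto
      also have "\<dots> \<le> 2 * (e * \<eta>\<^sup>2 / (32 * B))" using r by (simp add: r0_def)
      finally have "8 * B * (1 - r\<^sup>2) \<le> 8 * B * (2 * (e * \<eta>\<^sup>2 / (32 * B)))"
        using B by (intro mult_left_mono) auto
      also have "\<dots> = e / 2 * \<eta>\<^sup>2" using B by simp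
      finally have "8 * B * (1 - r\<^sup>2) / \<eta>\<^sup>2 \<le> e / 2" using \<eta> by (simp add: pos_divide_le_eq)
      then show ?thesis by simp
    qed
    finally show "\<bar>(LINT y|circ. pois (of_real r * zeta x) y * \<phi> (zeta y)) - \<phi> (zeta x)\<bar> \<le> e"
      by (simp add: w_def)
  qed
qed

text \<open>Comparison with the outer function whose boundary modulus is \<open>max |G| \<epsilon>\<close> avoids
  factoring out zeros.\<close>

lemma norm_le_exp_Poisson:
  assumes G: "G holomorphic_on S" "open S" "cball 0 1 \<subseteq> S" and e: "0 < e" and w: "cmod w < 1"
  shows "cmod (G w) \<le> exp (LINT y|circ. pois w y * ln (max (cmod (G (zeta y))) e))"
proof -
  define \<phi> where "\<phi> \<zeta> = ln (max (cmod (G \<zeta>)) e)" for \<zeta>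
  have contG: "continuous_on (cball 0 1) G"
    using G holomorphic_on_imp_continuous_on continuous_on_subset by blast
  have \<phi>: "continuous_on (sphere 0 1) \<phi>"
    unfolding \<phi>_def using e
    by (intro continuous_intros continuous_on_subset[OF contG]) (auto simp: less_max_iff_disj)
  have cont: "continuous_on {0..1} (\<lambda>y. \<phi> (zeta y))"
    by (rule continuous_on_compose2[OF \<phi>]) (auto intro!: continuous_intros)
  then have int: "integrable circ (\<lambda>y. \<phi> (zeta y))" by (rule continuous_integrable_circ)
  define H where "H = herglotz (\<lambda>y. \<phi> (zeta y))"
  have ReH: "Re (H z) = (LINT y|circ. pois z y * \<phi> (zeta y))" if "cmod z < 1" for z
    unfolding H_def by (rule Re_herglotz[OF int that])
  \<comment> \<open>The maximum principle is applied on a circle of radius r < 1, since H lives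
    inside the disc only; \<theta> pays for the shift from the unit circle and tends to 0 at the
    end.\<close>
  have "cmod (G w * exp (- H w)) \<le> exp \<theta>" if \<theta>: "0 < \<theta>" for \<theta>
  proof -
    obtain r0 where r0: "r0 < 1" "\<And>r x. r0 < r \<Longrightarrow> 0 \<le> r \<Longrightarrow> r < 1 \<Longrightarrow>
      \<bar>(LINT y|circ. pois (of_real r * zeta x) y * \<phi> (zeta y)) - \<phi> (zeta x)\<bar> \<le> \<theta> / 2"
      using Poisson_boundary[OF \<phi>, of "\<theta> / 2"] \<theta> by (metis half_gt_zero)
    have "uniformly_continuous_on (cball 0 1) G"
      by (intro compact_uniformly_continuous contG) simp
    \<comment> \<open>This size lets an additive error become the factor exp (\<theta>/2), since the
      boundary modulus of the comparison function never drops below e.\<close>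
    moreover have "0 < e * (exp (\<theta> / 2) - 1)" using e \<theta> by simp
    ultimately obtain \<eta> where \<eta>: "0 < \<eta>"
      "\<And>x y. cmod x \<le> 1 \<Longrightarrow> cmod y \<le> 1 \<Longrightarrow> cmod (y - x) < \<eta> \<Longrightarrow> cmod (G y - G x) < e * (exp (\<theta> / 2) - 1)"
      unfolding uniformly_continuous_on_def dist_norm by (metis mem_cball_0)
    obtain r where r: "max (max r0 (cmod w)) (1 - \<eta>) < r" "r < 1"
      using dense[of "max (max r0 (cmod w)) (1 - \<eta>)" 1] r0 w \<eta> by auto
    have rpos: "0 < r" using r norm_ge_zero[of w] by linarith
    have "cmod ((\<lambda>z. G z * exp (- H z)) w) \<le> exp \<theta>"
    proof (rule maximum_modulus_frontier[where S="ball 0 r" and f="\<lambda>z. G z * exp (- H z)"])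
      have sub: "cball 0 r \<subseteq> disc" using r by auto
      have hol: "(\<lambda>z. G z * exp (- H z)) holomorphic_on disc"
        unfolding H_def by (intro holomorphic_intros holomorphic_on_subset[OF G(1)] herglotz_holomorphic int)
          (use G in \<open>auto simp: disc_def\<close>)
      show "(\<lambda>z. G z * exp (- H z)) holomorphic_on interior (ball 0 r)"
        by (rule holomorphic_on_subset[OF hol]) (use r in auto)
      show "continuous_on (closure (ball 0 r)) (\<lambda>z. G z * exp (- H z))"
        by (rule continuous_on_subset[OF holomorphic_on_imp_continuous_on[OF hol]])
          (use r rpos in auto)
      fix z :: complex assume "z \<in> frontier (ball 0 r)"
      then have nz: "cmod z = r" using r norm_ge_zero[of w] by (auto simp: frontier_ball)
      obtain x where x: "z = of_real r * zeta x" using polar_zeta[of 0 z] nz by metis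
      let ?M = "max (cmod (G (zeta x))) e"
      have "zeta x - z = of_real (1 - r) * zeta x" by (simp add: x algebra_simps)
      then have "cmod (zeta x - z) = 1 - r" using r by (simp add: norm_mult del: of_real_diff)
      then have "cmod (z - zeta x) < \<eta>" using r by (simp add: norm_minus_commute)
      then have "cmod (G z - G (zeta x)) < e * (exp (\<theta> / 2) - 1)"
        using r nz by (intro \<eta>) auto
      then have "cmod (G z) \<le> cmod (G (zeta x)) + e * (exp (\<theta> / 2) - 1)"
        using norm_triangle_ineq2[of "G z" "G (zeta x)"] by linarith
      also have "\<dots> \<le> ?M + ?M * (exp (\<theta> / 2) - 1)"
        using \<theta> by (intro add_mono mult_right_mono) auto
      also have "\<dots> = ?M * exp (\<theta> / 2)" by (simp add: algebra_simps)
      finally have Gz: "cmod (G z) \<le> ?M * exp (\<theta> / 2)" .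
      have "\<bar>Re (H z) - \<phi> (zeta x)\<bar> \<le> \<theta> / 2"
        using r0(2)[of r x] r rpos nz by (simp add: ReH x)
      then have "- Re (H z) \<le> \<theta> / 2 - \<phi> (zeta x)" by linarith
      then have "exp (- Re (H z)) \<le> exp (\<theta> / 2 - \<phi> (zeta x))" by simp
      also have "\<dots> = exp (\<theta> / 2) / ?M" using e by (simp add: exp_diff \<phi>_def less_max_iff_disj)
      finally have "cmod (G z) * exp (- Re (H z)) \<le> (?M * exp (\<theta> / 2)) * (exp (\<theta> / 2) / ?M)"
        using Gz e by (intro mult_mono) (auto simp: less_max_iff_disj)
      also have "\<dots> = exp \<theta>" using e by (simp add: exp_add[symmetric] less_max_iff_disj less_imp_neq[symmetric])
      finally show "cmod (G z * exp (- H z)) \<le> exp \<theta>" by (simp add: norm_mult)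
    qed (use r in auto)
    then show ?thesis .
  qed
  moreover have "((\<lambda>\<theta>. exp \<theta>) \<longlongrightarrow> exp 0) (at_right (0::real))"
    by (intro tendsto_intros)
  ultimately have "cmod (G w * exp (- H w)) \<le> exp 0"
    by (intro tendsto_lowerbound[where F="at_right (0::real)" and f="\<lambda>\<theta>. exp \<theta>"])
      (auto simp: eventually_at_right_less eventually_at_filter)
  then have "cmod (G w) \<le> exp (Re (H w))"
    by (simp add: norm_divide exp_minus field_simps)
  then show ?thesis using ReH[OF w] by (simp add: \<phi>_def)
qed

text \<open>Subharmonicity of |G|^t for every t > 0, by Jensen's inequality from the logarithmic
  estimate. The floor e costs at most e^t, which is as small as desired.\<close>

lemma norm_powr_le_Poisson:
  assumes G: "G holomorphic_on S" "open S" "cball 0 1 \<subseteq> S" and t: "0 < t" and w: "cmod w < 1"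
  shows "ennreal (cmod (G w) powr t) \<le> (\<integral>\<^sup>+y. ennreal (pois w y) * ennreal (cmod (G (zeta y)) powr t) \<partial>circ)"
proof -
  have contG: "continuous_on (cball 0 1) G"
    using G holomorphic_on_imp_continuous_on continuous_on_subset by blast
  have cz: "continuous_on {0..1} (\<lambda>y. G (zeta y))"
    by (rule continuous_on_compose2[OF contG]) (auto intro!: continuous_intros)
  let ?I = "\<integral>\<^sup>+y. ennreal (pois w y) * ennreal (cmod (G (zeta y)) powr t) \<partial>circ"
  have cp: "continuous_on {0..1} (\<lambda>y. cmod (G (zeta y)) powr t)"
    using t by (intro continuous_on_powr' continuous_intros cz) auto
  have [measurable]: "(\<lambda>y. cmod (G (zeta y)) powr t) \<in> borel_measurable circ"
    using continuous_integrable_circ(1)[OF cp] by simp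
  have le: "ennreal (cmod (G w) powr t) \<le> ?I + ennreal (e powr t)" if e: "0 < e" for e
  proof -
    let ?v = "\<lambda>y. ln (max (cmod (G (zeta y))) e)"
    have int: "integrable circ (\<lambda>y. t * ?v y)"
      using e by (intro continuous_integrable_circ continuous_intros cz) (auto simp: less_max_iff_disj)
    have "cmod (G w) powr t \<le> exp (LINT y|circ. pois w y * ?v y) powr t"
      using norm_le_exp_Poisson[OF G e w] t by (intro powr_mono2) auto
    also have "\<dots> = exp (t * (LINT y|circ. pois w y * ?v y))" by (simp add: powr_def)
    also have "t * (LINT y|circ. pois w y * ?v y) = (LINT y|circ. pois w y * (t * ?v y))"
      by (subst integral_mult_right_zero[symmetric]) (simp add: mult_ac)
    finally have "ennreal (cmod (G w) powr t) \<le> ennreal (exp (LINT y|circ. pois w y * (t * ?v y)))"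
      by (rule ennreal_leI)
    also have "\<dots> \<le> (\<integral>\<^sup>+y. ennreal (pois w y * exp (t * ?v y)) \<partial>circ)"
      by (rule exp_pois_le[OF w int])
    also have "\<dots> \<le> (\<integral>\<^sup>+y. ennreal (pois w y) * ennreal (cmod (G (zeta y)) powr t) + ennreal (pois w y) * ennreal (e powr t) \<partial>circ)"
    proof (intro nn_integral_mono)
      fix y
      have "exp (t * ?v y) = max (cmod (G (zeta y))) e powr t" 
      proof -
        have "0 < max (cmod (G (zeta y))) e" using e by (simp add: less_max_iff_disj)
        then show ?thesis by (simp add: powr_def)
      qed
      also have "\<dots> \<le> cmod (G (zeta y)) powr t + e powr t" by (simp add: max_def)
      finally have "pois w y * exp (t * ?v y) \<le> pois w y * (cmod (G (zeta y)) powr t + e powr t)"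
        using pois_nonneg[OF w] by (intro mult_left_mono) auto
      then have "ennreal (pois w y * exp (t * ?v y)) \<le> ennreal (pois w y * (cmod (G (zeta y)) powr t + e powr t))"
        by (rule ennreal_leI)
      also have "\<dots> = ennreal (pois w y) * ennreal (cmod (G (zeta y)) powr t) + ennreal (pois w y) * ennreal (e powr t)"
        using pois_nonneg[OF w] by (simp add: ennreal_mult' ennreal_plus distrib_left)
      finally show "ennreal (pois w y * exp (t * ?v y)) \<le> \<dots>" .
    qed
    also have "\<dots> = ?I + ennreal (e powr t)"
      by (subst nn_integral_add) (auto simp: nn_integral_multc nn_integral_pois[OF w])
    finally show ?thesis .
  qed
  show ?thesis
  proof (rule ennreal_le_epsilon)
    fix \<epsilon> :: real assume \<epsilon>: "0 < \<epsilon>"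
    have "ennreal (cmod (G w) powr t) \<le> ?I + ennreal ((\<epsilon> powr (1 / t)) powr t)" using \<epsilon> by (intro le) simp
    then show "ennreal (cmod (G w) powr t) \<le> ?I + ennreal \<epsilon>" using t \<epsilon> by (simp add: powr_powr)
  qed
qed

text \<open>Scale plus chord is at most (1 + 8 + 1) |\<zeta> - z|, where \<zeta> is
  \<open>zeta y\<close>, and the square gives 100; the remaining 4 comes from the factor 2 in
  \<open>pois_le2\<close> and from d being possibly half of 1 - |z|.\<close>

lemma pois_le_ker:
  assumes z: "cmod z < 1" and zx: "cmod (z - zeta x) \<le> 8 * (1 - cmod z)"
    and d: "0 < d" "d \<le> 1 - cmod z" "1 - cmod z \<le> 2 * d"
  shows "pois z y \<le> 400 * ker d x y"
proof -
  have ge: "1 - cmod z \<le> cmod (zeta y - z)" by (rule norm_zeta_minus_ge)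
  have "cmod (zeta x - zeta y) \<le> cmod (z - zeta x) + cmod (zeta y - z)"
    using norm_triangle_ineq[of "zeta x - z" "z - zeta y"] by (simp add: norm_minus_commute)
  then have "d + cmod (zeta x - zeta y) \<le> 10 * cmod (zeta y - z)" using zx d ge by argo
  then have k1: "(d + cmod (zeta x - zeta y))\<^sup>2 \<le> (10 * cmod (zeta y - z))\<^sup>2"
    using d by (intro power_mono) auto
  have k2: "0 < (d + cmod (zeta x - zeta y))\<^sup>2" using d by (intro zero_less_power add_pos_nonneg) auto
  have "(1 - cmod z) / 2 \<le> d" using d by simp
  then have "((1 - cmod z) / 2) / (10 * cmod (zeta y - z))\<^sup>2 \<le> ker d x y"
    unfolding ker_def by (intro frac_le[OF _ _ k2 k1]) (use d in auto)
  moreover have "pois z y \<le> 2 * (1 - cmod z) / (cmod (zeta y - z))\<^sup>2" by (rule pois_le2[OF z])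
  moreover have "2 * (1 - cmod z) / (cmod (zeta y - z))\<^sup>2 = 400 * (((1 - cmod z) / 2) / (10 * cmod (zeta y - z))\<^sup>2)"
  proof -
    have "2 * a / b = 400 * (a / 2 / (100 * b))" for a b :: real by simp
    then show ?thesis by (simp only: power_mult_distrib) simp
  qed
  ultimately show ?thesis by linarith
qed

lemma ennreal_powr_half_square: "(ennreal (a powr (p / 2)))\<^sup>2 = ennreal (a powr p)"
proof -
  have "(a powr (p / 2))\<^sup>2 = a powr p" by (simp add: power2_eq_square flip: powr_add)
  then show ?thesis by (simp add: ennreal_power)
qed

text \<open>|g|^(p/2) is subharmonic with bounded square means, so the L^2 maximal theorem serves
  every p. It is applied to the dilates \<open>G k\<close>, which are holomorphic across the circle;
  Q is the liminf of their squared maximal functions, and Fatou's lemma bounds its integral. The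
  constant is 400^2 times 64.\<close>

lemma nontangential_majorant:
  assumes p: "0 < p" and g: "in_Hp p g"
  obtains Q where "Q \<in> borel_measurable borel"
    "\<And>x z. cmod z < 1 \<Longrightarrow> cmod (z - zeta x) \<le> 8 * (1 - cmod z) \<Longrightarrow> ennreal (cmod (g z) powr p) \<le> Q x"
    "(\<integral>\<^sup>+x. Q x \<partial>circ) \<le> 10240000 * Hp_sup p g"
proof -
  define \<rho> where "\<rho> k = 1 - 1 / (real k + 2)" for k :: nat
  have \<rho>: "0 < \<rho> k" "\<rho> k < 1" for k by (auto simp: \<rho>_def field_simps)
  have \<rho>lim: "\<rho> \<longlonglongrightarrow> 1" unfolding \<rho>_def by real_asymp
  have hol: "g holomorphic_on disc" using g by (simp add: in_Hp_def analytic_disc_complex_iff)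
  define G where "G k z = g (of_real (\<rho> k) * z)" for k z
  define S where "S k = ball (0::complex) (1 / \<rho> k)" for k
  have lt: "cmod (of_real (\<rho> k) * z) < 1" if "z \<in> S k" for z k
    using that \<rho>[of k] by (simp add: S_def norm_mult field_simps)
  have Ghol: "G k holomorphic_on S k" for k
    unfolding G_def by (rule holomorphic_on_compose_gen[OF _ hol, unfolded o_def]) (use lt in \<open>auto intro!: holomorphic_intros\<close>)
  have SO: "open (S k)" "cball 0 1 \<subseteq> S k" for k
  proof -
    have "1 < 1 / \<rho> k" using \<rho>[of k] by simp
    then show "open (S k)" "cball 0 1 \<subseteq> S k" by (auto simp: S_def)
  qed
  define W where "W k y = ennreal (cmod (G k (zeta y)) powr (p / 2))" for k y
  have W_meas: "W k \<in> borel_measurable circ" for k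
  proof -
    have "continuous_on (cball 0 1) (G k)"
      by (rule continuous_on_subset[OF holomorphic_on_imp_continuous_on[OF Ghol] SO(2)])
    then have "continuous_on {0..1} (\<lambda>y. G k (zeta y))"
      by (rule continuous_on_compose2) (auto intro!: continuous_intros)
    then have "continuous_on {0..1} (\<lambda>y. cmod (G k (zeta y)) powr (p / 2))"
      using p by (intro continuous_on_powr' continuous_intros) auto
    then have "(\<lambda>y. cmod (G k (zeta y)) powr (p / 2)) \<in> borel_measurable circ"
      using continuous_integrable_circ(1) by blast
    then show ?thesis unfolding W_def by measurable
  qed
  define P where "P k x = (400 * pmax (W k) x)\<^sup>2" for k x
  define Q where "Q x = liminf (\<lambda>k. P k x)" for x
  have [measurable]: "P k \<in> borel_measurable borel" for k
    unfolding P_def using measurable_pmax[OF W_meas[of k]] by measurable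
  have Pbound: "ennreal (cmod (G k z) powr p) \<le> P k x"
    if z: "cmod z < 1" "cmod (z - zeta x) \<le> 8 * (1 - cmod z)" for k x z
  proof -
    obtain n :: nat where n: "1 / 2 ^ n \<le> 1 - cmod z" "1 - cmod z \<le> 2 * (1 / 2 ^ n)"
      using dyadic_scale[of "1 - cmod z"] z(1) by auto
    have "ennreal (cmod (G k z) powr (p / 2)) \<le> (\<integral>\<^sup>+y. ennreal (pois z y) * W k y \<partial>circ)"
      unfolding W_def using p by (intro norm_powr_le_Poisson[OF Ghol SO _ z(1)]) simp
    also have "\<dots> \<le> (\<integral>\<^sup>+y. 400 * (ennreal (ker (1 / 2 ^ n) x y) * W k y) \<partial>circ)"
    proof (intro nn_integral_mono)
      fix y
      have "ennreal (pois z y) \<le> ennreal (400 * ker (1 / 2 ^ n) x y)"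
        using n by (intro ennreal_leI pois_le_ker z) auto
      then have "ennreal (pois z y) * W k y \<le> ennreal (400 * ker (1 / 2 ^ n) x y) * W k y"
        by (rule mult_right_mono) simp
      then show "ennreal (pois z y) * W k y \<le> 400 * (ennreal (ker (1 / 2 ^ n) x y) * W k y)"
        by (simp add: ennreal_mult' mult.assoc)
    qed
    also have "\<dots> = 400 * (\<integral>\<^sup>+y. ennreal (ker (1 / 2 ^ n) x y) * W k y \<partial>circ)"
    proof (rule nn_integral_cmult)
      note W_meas[measurable]
      show "(\<lambda>y. ennreal (ker (1 / 2 ^ n) x y) * W k y) \<in> borel_measurable circ" by measurable
    qed
    also have "\<dots> \<le> 400 * pmax (W k) x" by (intro mult_left_mono pmax_ge) auto
    finally have "(ennreal (cmod (G k z) powr (p / 2)))\<^sup>2 \<le> P k x" unfolding P_def by (intro power_mono) auto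
    then show ?thesis by (simp only: ennreal_powr_half_square)
  qed
  have "ennreal (cmod (g z) powr p) \<le> Q x"
    if z: "cmod z < 1" "cmod (z - zeta x) \<le> 8 * (1 - cmod z)" for x z
  proof -
    have "isCont g z"
      using holomorphic_on_imp_continuous_on[OF hol] z(1) by (simp add: continuous_on_eq_continuous_at)
    moreover have "(\<lambda>k. of_real (\<rho> k) * z) \<longlonglongrightarrow> z"
      using tendsto_mult[OF tendsto_of_real[OF \<rho>lim] tendsto_const[of z]] by simp
    ultimately have "(\<lambda>k. G k z) \<longlonglongrightarrow> g z" unfolding G_def by (rule isCont_tendsto_compose)
    then have "(\<lambda>k. ennreal (cmod (G k z) powr p)) \<longlonglongrightarrow> ennreal (cmod (g z) powr p)"
      using p by (intro tendsto_ennrealI tendsto_powr' tendsto_norm) auto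
    then have "ennreal (cmod (g z) powr p) = liminf (\<lambda>k. ennreal (cmod (G k z) powr p))"
      by (intro lim_imp_Liminf[symmetric]) simp_all
    also have "\<dots> \<le> Q x" unfolding Q_def by (intro Liminf_mono always_eventually allI Pbound z)
    finally show ?thesis .
  qed
  moreover have "Q \<in> borel_measurable borel" unfolding Q_def by measurable
  moreover have "(\<integral>\<^sup>+x. Q x \<partial>circ) \<le> 10240000 * Hp_sup p g"
  proof -
    have "(\<integral>\<^sup>+x. Q x \<partial>circ) \<le> liminf (\<lambda>k. \<integral>\<^sup>+x. P k x \<partial>circ)"
      unfolding Q_def by (rule nn_integral_liminf) (rule measurable_circ, measurable)
    also have "\<dots> \<le> 10240000 * Hp_sup p g"
    proof (rule order_trans[OF Liminf_le_Limsup Limsup_bounded])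
      show "\<forall>\<^sub>F k in sequentially. (\<integral>\<^sup>+x. P k x \<partial>circ) \<le> 10240000 * Hp_sup p g"
      proof (intro always_eventually allI)
        fix k
        note W_meas[measurable]
        have [measurable]: "pmax (W k) \<in> borel_measurable circ"
          by (rule measurable_circ[OF measurable_pmax[OF W_meas]])
        have "(\<integral>\<^sup>+x. P k x \<partial>circ) = 160000 * (\<integral>\<^sup>+x. (pmax (W k) x)\<^sup>2 \<partial>circ)"
          unfolding P_def power_mult_distrib by (subst nn_integral_cmult) auto
        also have "\<dots> \<le> 160000 * (64 * (\<integral>\<^sup>+x. (W k x)\<^sup>2 \<partial>circ))"
          by (intro mult_left_mono pmax_L2) auto
        also have "(\<integral>\<^sup>+x. (W k x)\<^sup>2 \<partial>circ) = Hp_integral p g (\<rho> k)"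
          unfolding Hp_integral_def nn_integral_circ W_def G_def
          by (simp only: ennreal_powr_half_square)
        also have "\<dots> \<le> Hp_sup p g" unfolding Hp_sup_def using \<rho>[of k] by (intro SUP_upper) auto
        finally show "(\<integral>\<^sup>+x. P k x \<partial>circ) \<le> 10240000 * Hp_sup p g"
          by (simp add: mult.assoc[symmetric] mult_left_mono)
      qed
    qed simp
    finally show ?thesis .
  qed
  ultimately show thesis using that by blast
qed

section \<open>Carleson embedding and balayage\<close>

definition carleson :: "(complex \<Rightarrow> ennreal) \<Rightarrow> ennreal \<Rightarrow> bool" where
  "carleson b \<Lambda> \<longleftrightarrow> b \<in> borel_measurable borel \<and> (\<forall>z. 1 \<le> cmod z \<longrightarrow> b z = 0) \<and>
     (\<forall>x t. 0 < t \<longrightarrow> (\<integral>\<^sup>+z. b z * indicator (ball (zeta x) t) z \<partial>lborel) \<le> \<Lambda> * ennreal t)"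

text \<open>The aperture 8 is wider than the 3 of \<open>stolz_dist\<close>: in
  \<open>carleson_level_set\<close> a boundary point assigned to z may be 4.5 (1 - |z|) away from
  it.\<close>

definition ntmaj :: "(complex \<Rightarrow> ennreal) \<Rightarrow> (real \<Rightarrow> ennreal) \<Rightarrow> bool" where
  "ntmaj \<gamma> N \<longleftrightarrow> \<gamma> \<in> borel_measurable borel \<and> N \<in> borel_measurable borel \<and>
     (\<forall>x z. cmod z < 1 \<longrightarrow> cmod (z - zeta x) \<le> 8 * (1 - cmod z) \<longrightarrow> \<gamma> z \<le> N x)"

lemma nn_integral_count_space_ge:
  fixes f :: "'a \<Rightarrow> ennreal" assumes "w \<in> C" shows "f w \<le> (\<integral>\<^sup>+v. f v \<partial>count_space C)"
proof -
  have "f w = (\<integral>\<^sup>+v. f w * indicator {w} v \<partial>count_space C)"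
    using assms by (subst nn_integral_cmult_indicator) auto
  also have "\<dots> \<le> (\<integral>\<^sup>+v. f v \<partial>count_space C)"
    by (intro nn_integral_mono) (auto split: split_indicator)
  finally show ?thesis .
qed

lemma layer_cake_ennreal: "(\<integral>\<^sup>+l. indicator {l. 0 < l \<and> ennreal l < c} l \<partial>lborel) = c"
proof (cases c)
  case (real r)
  then have "{l. 0 < l \<and> ennreal l < c} = {0<..<r}" by (auto simp: ennreal_less_iff)
  then show ?thesis using real by simp
next
  case top
  have "emeasure lborel {0::real<..} = top"
  proof (rule ccontr)
    assume "emeasure lborel {0::real<..} \<noteq> top"
    then obtain r where r: "0 \<le> r" "emeasure lborel {0::real<..} = ennreal r"
      by (cases "emeasure lborel {0::real<..}") auto
    have "ennreal (r + 1) = emeasure lborel {0<..<r + 1}" using r by simp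
    also have "\<dots> \<le> emeasure lborel {0::real<..}" by (rule emeasure_mono) auto
    finally show False using r by simp
  qed
  moreover have "{l. 0 < l \<and> ennreal l < c} = {0<..}" using top by auto
  ultimately show ?thesis using top by simp
qed

text \<open>Each z with \<gamma> z > l owns an interval of radius (1 - |z|)/2 about its argument,
  and N > l on it. Vitali's lemma selects disjoint intervals whose fivefold enlargements contain the
  others. The points owning intervals near a selected one of radius r lie within 7 * 5 r of its
  centre on the circle, hence in a disc of radius 42 r to which the Carleson condition
  applies.\<close>

lemma carleson_level_set:
  assumes b: "carleson b \<Lambda>" and n: "ntmaj \<gamma> N"
  shows "(\<integral>\<^sup>+z. b z * indicator {z. l < \<gamma> z} z \<partial>lborel) \<le> 42 * \<Lambda> * (\<integral>\<^sup>+x. indicator {x. l < N x} x \<partial>circ)"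
proof -
  have [measurable]: "b \<in> borel_measurable borel" "\<gamma> \<in> borel_measurable borel" "N \<in> borel_measurable borel"
    using b n by (auto simp: carleson_def ntmaj_def)
  have [measurable]: "ball c s \<in> sets borel" for c :: complex and s by simp
  define K where "K = {z. cmod z < 1 \<and> l < \<gamma> z}"
  define a where "a z = (SOME x. x \<in> {0..<1} \<and> z = of_real (cmod z) * zeta x)" for z
  have a: "a z \<in> {0..<1}" "z = of_real (cmod z) * zeta (a z)" for z
  proof -
    obtain x where "x \<in> {0..<0 + 1}" "z = of_real (cmod z) * zeta x" by (rule polar_zeta)
    then have "\<exists>x. x \<in> {0..<1} \<and> z = of_real (cmod z) * zeta x" by auto
    from someI_ex[OF this] show "a z \<in> {0..<1}" "z = of_real (cmod z) * zeta (a z)"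
      unfolding a_def by auto
  qed
  define r where "r z = (1 - cmod z) / 2" for z
  have r: "0 < r z" "r z \<le> 1 / 2" if "z \<in> K" for z using that by (auto simp: r_def K_def)
  have near: "cmod (z - zeta x) \<le> (1 - cmod z) + 7 * \<bar>x - a z\<bar>" if "z \<in> K" for z x
  proof -
    have "cmod (z - zeta (a z)) = 1 - cmod z" using that by (intro zeta_coordinates_dist a) (simp add: K_def)
    moreover have "cmod (zeta (a z) - zeta x) \<le> 7 * \<bar>x - a z\<bar>"
      using norm_zeta_diff_le7[of "a z" x] by (simp add: abs_minus_commute)
    moreover have "cmod (z - zeta x) \<le> cmod (z - zeta (a z)) + cmod (zeta (a z) - zeta x)"
      using norm_triangle_ineq[of "z - zeta (a z)" "zeta (a z) - zeta x"] by simp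
    ultimately show ?thesis by linarith
  qed
  obtain C where C: "countable C" "C \<subseteq> K"
    "pairwise (\<lambda>i j. disjnt (cball (a i) (r i)) (cball (a j) (r j))) C"
    "\<And>i. i \<in> K \<Longrightarrow> \<exists>j. j \<in> C \<and> \<not> disjnt (cball (a i) (r i)) (cball (a j) (r j)) \<and> cball (a i) (r i) \<subseteq> ball (a j) (5 * r j)"
    using Vitali_covering_lemma_cballs_balls[of K r "1/2" a] r by blast
  have cover: "b z * indicator {z. l < \<gamma> z} z \<le> (\<integral>\<^sup>+w. b z * indicator (ball (zeta (a w)) (42 * r w)) z \<partial>count_space C)" for z
  proof (cases "z \<in> K")
    case True
    obtain w where w: "w \<in> C" "cball (a z) (r z) \<subseteq> ball (a w) (5 * r w)" using C(4)[OF True] by blast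
    have rz: "0 < r z" using r True by blast
    have d: "\<bar>a w - a z\<bar> + r z < 5 * r w"
    proof -
      \<comment> \<open>The end of the covered interval farther from \<open>a w\<close> turns the
        inclusion of balls into an inequality.\<close>
      define e where "e = (if a z \<ge> a w then a z + r z else a z - r z)"
      have "e \<in> cball (a z) (r z)" using rz by (auto simp: e_def dist_real_def)
      then have "\<bar>a w - e\<bar> < 5 * r w" using w(2) by (auto simp: dist_real_def)
      then show ?thesis using rz by (auto simp: e_def split: if_splits)
    qed
    have "cmod (z - zeta (a w)) \<le> 2 * r z + 7 * \<bar>a w - a z\<bar>" 
    proof -
      have "2 * r z = 1 - cmod z" by (simp add: r_def)
      then show ?thesis using near[OF True, of "a w"] by simp
    qed
    also have "\<dots> < 42 * r w" using d rz abs_ge_zero[of "a w - a z"] by argo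
    finally have z: "z \<in> ball (zeta (a w)) (42 * r w)" by (simp add: dist_norm norm_minus_commute)
    have "b z * indicator {z. l < \<gamma> z} z \<le> b z * indicator (ball (zeta (a w)) (42 * r w)) z"
      using z by (intro mult_left_mono) (auto split: split_indicator)
    also have "\<dots> \<le> (\<integral>\<^sup>+w. b z * indicator (ball (zeta (a w)) (42 * r w)) z \<partial>count_space C)"
      by (rule nn_integral_count_space_ge[OF w(1)])
    finally show ?thesis .
  next
    case False
    then show ?thesis using b by (cases "cmod z < 1") (auto simp: K_def carleson_def)
  qed
  have "(\<integral>\<^sup>+z. b z * indicator {z. l < \<gamma> z} z \<partial>lborel)
    \<le> (\<integral>\<^sup>+z. \<integral>\<^sup>+w. b z * indicator (ball (zeta (a w)) (42 * r w)) z \<partial>count_space C \<partial>lborel)"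
    by (intro nn_integral_mono cover)
  also have "\<dots> = (\<integral>\<^sup>+w. \<integral>\<^sup>+z. b z * indicator (ball (zeta (a w)) (42 * r w)) z \<partial>lborel \<partial>count_space C)"
    by (rule nn_integral_count_space_nn_integral[OF C(1)]) measurable
  also have "\<dots> \<le> (\<integral>\<^sup>+w. 42 * \<Lambda> * (\<integral>\<^sup>+x. indicator (cball (a w) (r w)) x \<partial>circ) \<partial>count_space C)"
  proof (intro nn_integral_mono)
    fix w assume "w \<in> space (count_space C)"
    then have w: "w \<in> K" using C by auto
    have "ennreal (r w) \<le> (\<integral>\<^sup>+x. indicator (cball (a w) (r w)) x \<partial>circ)"
    proof -
      \<comment> \<open>One half of the interval always lies in {0..1}, because its radius is at
        most 1/2.\<close>
      define I where "I = (if a w + r w \<le> 1 then {a w .. a w + r w} else {a w - r w .. a w})"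
      have "I \<subseteq> {0..1}" "I \<subseteq> cball (a w) (r w)" using a(1)[of w] r[OF w] by (auto simp: I_def dist_real_def)
      have "ennreal (r w) = (\<integral>\<^sup>+x. indicator I x \<partial>lborel)" using r[OF w] by (simp add: I_def)
      also have "\<dots> \<le> (\<integral>\<^sup>+x. indicator (cball (a w) (r w)) x * indicator {0..1} x \<partial>lborel)"
        using \<open>I \<subseteq> {0..1}\<close> \<open>I \<subseteq> cball (a w) (r w)\<close> by (intro nn_integral_mono) (auto split: split_indicator)
      also have "\<dots> = (\<integral>\<^sup>+x. indicator (cball (a w) (r w)) x \<partial>circ)" by (rule nn_integral_circ)
      finally show ?thesis .
    qed
    then have "\<Lambda> * (42 * ennreal (r w)) \<le> \<Lambda> * (42 * (\<integral>\<^sup>+x. indicator (cball (a w) (r w)) x \<partial>circ))"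
      by (intro mult_left_mono) auto
    moreover have "(\<integral>\<^sup>+z. b z * indicator (ball (zeta (a w)) (42 * r w)) z \<partial>lborel) \<le> \<Lambda> * ennreal (42 * r w)"
      using b r[OF w] by (simp add: carleson_def)
    moreover have "ennreal (42 * r w) = 42 * ennreal (r w)" using r[OF w] by (simp add: ennreal_mult)
    ultimately show "(\<integral>\<^sup>+z. b z * indicator (ball (zeta (a w)) (42 * r w)) z \<partial>lborel)
      \<le> 42 * \<Lambda> * (\<integral>\<^sup>+x. indicator (cball (a w) (r w)) x \<partial>circ)"
      by (simp add: ac_simps)
  qed
  also have "\<dots> = 42 * \<Lambda> * (\<integral>\<^sup>+w. \<integral>\<^sup>+x. indicator (cball (a w) (r w)) x \<partial>circ \<partial>count_space C)"
    by (rule nn_integral_cmult) simp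
  also have "(\<integral>\<^sup>+w. \<integral>\<^sup>+x. indicator (cball (a w) (r w)) x \<partial>circ \<partial>count_space C)
    = (\<integral>\<^sup>+x. \<integral>\<^sup>+w. indicator (cball (a w) (r w)) x \<partial>count_space C \<partial>circ)"
    by (rule nn_integral_count_space_nn_integral[OF C(1), symmetric])
      (rule measurable_circ, rule borel_measurable_indicator, simp)
  also have "\<dots> \<le> (\<integral>\<^sup>+x. indicator {x. l < N x} x \<partial>circ)"
  proof (intro nn_integral_mono)
    fix x
    show "(\<integral>\<^sup>+w. indicator (cball (a w) (r w)) x \<partial>count_space C) \<le> indicator {x. l < N x} x"
    proof (cases "\<exists>w\<in>C. x \<in> cball (a w) (r w)")
      case True
      then obtain w where w: "w \<in> C" "x \<in> cball (a w) (r w)" by blast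
      \<comment> \<open>By disjointness x lies in one selected interval only, so the sum over all of
        them is 1.\<close>
      have "indicator (cball (a v) (r v)) x = (indicator {w} v :: ennreal)" if "v \<in> C" for v
      proof (cases "v = w")
        case False
        then have "disjnt (cball (a v) (r v)) (cball (a w) (r w))" using C(3) that w by (simp add: pairwise_def)
        then have "x \<notin> cball (a v) (r v)" using w unfolding disjnt_def by blast
        then show ?thesis using False by simp
      qed (use w in simp)
      then have "(\<integral>\<^sup>+v. indicator (cball (a v) (r v)) x \<partial>count_space C) = (\<integral>\<^sup>+v. indicator {w} v \<partial>count_space C)"
        by (intro nn_integral_cong) simp
      also have "\<dots> = 1" using w by (subst nn_integral_indicator) (auto simp: emeasure_count_space_finite)
      finally have 1: "(\<integral>\<^sup>+v. indicator (cball (a v) (r v)) x \<partial>count_space C) = 1" .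
      have wK: "w \<in> K" using w C by blast
      then have "cmod (w - zeta x) \<le> (1 - cmod w) + 7 * r w"
        using near[OF wK, of x] w(2) by (auto simp: dist_real_def abs_minus_commute)
      also have "\<dots> \<le> 8 * (1 - cmod w)" using wK by (simp add: r_def K_def field_simps)
      finally have "\<gamma> w \<le> N x" using n wK by (simp add: ntmaj_def K_def)
      then have "l < N x" using wK by (auto simp: K_def intro: less_le_trans)
      then show ?thesis using 1 by simp
    next
      case False
      then have "(\<integral>\<^sup>+w. indicator (cball (a w) (r w)) x \<partial>count_space C) = (\<integral>\<^sup>+w. 0 \<partial>count_space C)"
        by (intro nn_integral_cong) auto
      then show ?thesis by simp
    qed
  qed
  finally show ?thesis by (simp add: mult_left_mono)
qed

text \<open>The layer cake formula on both sides reduces this to \<open>carleson_level_set\<close>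
  at each positive level l.\<close>

lemma carleson_embedding:
  assumes b: "carleson b \<Lambda>" and n: "ntmaj \<gamma> N"
  shows "(\<integral>\<^sup>+z. \<gamma> z * b z \<partial>lborel) \<le> 42 * \<Lambda> * (\<integral>\<^sup>+x. N x \<partial>circ)"
proof -
  have [measurable]: "b \<in> borel_measurable borel" "\<gamma> \<in> borel_measurable borel" "N \<in> borel_measurable borel"
    using b n by (auto simp: carleson_def ntmaj_def)
  have [measurable]: "N \<in> borel_measurable circ" by (rule measurable_circ) simp
  interpret q: pair_sigma_finite circ "lborel :: real measure" ..
  let ?i = "\<lambda>c l. indicator {l. 0 < l \<and> ennreal l < c} l :: ennreal"
  have mi [measurable]: "(\<lambda>t. ?i (f t) (h t)) \<in> borel_measurable M"
    if [measurable]: "f \<in> borel_measurable M" "h \<in> borel_measurable M" for f h and M :: "'z measure"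
  proof -
    have "(\<lambda>t. ?i (f t) (h t)) = (\<lambda>t. if 0 < h t \<and> ennreal (h t) < f t then 1 else 0)"
      by (auto simp: indicator_def)
    then show ?thesis by simp
  qed
  have "(\<integral>\<^sup>+z. \<gamma> z * b z \<partial>lborel) = (\<integral>\<^sup>+z. \<integral>\<^sup>+l. b z * ?i (\<gamma> z) l \<partial>lborel \<partial>lborel)"
  proof (intro nn_integral_cong)
    fix z
    have "(\<integral>\<^sup>+l. b z * ?i (\<gamma> z) l \<partial>lborel) = b z * (\<integral>\<^sup>+l. ?i (\<gamma> z) l \<partial>lborel)"
      by (rule nn_integral_cmult) measurable
    then show "\<gamma> z * b z = (\<integral>\<^sup>+l. b z * ?i (\<gamma> z) l \<partial>lborel)" by (simp only: layer_cake_ennreal mult.commute)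
  qed
  also have "\<dots> = (\<integral>\<^sup>+l. \<integral>\<^sup>+z. b z * ?i (\<gamma> z) l \<partial>lborel \<partial>lborel)"
    by (rule lborel_pair.Fubini') measurable
  also have "\<dots> \<le> (\<integral>\<^sup>+l. 42 * \<Lambda> * (\<integral>\<^sup>+x. ?i (N x) l \<partial>circ) \<partial>lborel)"
  proof (intro nn_integral_mono)
    fix l :: real
    show "(\<integral>\<^sup>+z. b z * ?i (\<gamma> z) l \<partial>lborel) \<le> 42 * \<Lambda> * (\<integral>\<^sup>+x. ?i (N x) l \<partial>circ)"
    proof (cases "0 < l")
      case True
      then have "?i c l = indicator {z. ennreal l < f z} z" if "c = f z" for c z and f :: "'z \<Rightarrow> ennreal"
        using that by (simp add: indicator_def)
      then have "?i (\<gamma> z) l = indicator {z. ennreal l < \<gamma> z} z" "?i (N x) l = indicator {x. ennreal l < N x} x" for x z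
        using True by (simp_all add: indicator_def)
      then show ?thesis using carleson_level_set[OF b n, of "ennreal l"] by simp
    qed simp
  qed
  also have "\<dots> = 42 * \<Lambda> * (\<integral>\<^sup>+l. \<integral>\<^sup>+x. ?i (N x) l \<partial>circ \<partial>lborel)"
    by (rule nn_integral_cmult) measurable
  also have "(\<integral>\<^sup>+l. \<integral>\<^sup>+x. ?i (N x) l \<partial>circ \<partial>lborel) = (\<integral>\<^sup>+x. \<integral>\<^sup>+l. ?i (N x) l \<partial>lborel \<partial>circ)"
    by (rule q.Fubini') measurable
  also have "\<dots> = (\<integral>\<^sup>+x. N x \<partial>circ)" by (simp only: layer_cake_ennreal)
  finally show ?thesis .
qed

section \<open>Balayage with a Poisson-type kernel\<close>

definition edist :: "complex \<Rightarrow> complex \<Rightarrow> real" where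
  "edist z v = max 0 (1 - cmod z) + max 0 (1 - cmod v) + cmod (z - v)"

text \<open>For v on the circle and z in the disc, comparable to the Poisson kernel. It also accepts
  v inside the disc, so that a balayage can be evaluated at z and fed back into a density; adding
  both distances to the circle preserves the triangle inequality of \<open>edist\<close>.\<close>

definition bker :: "complex \<Rightarrow> complex \<Rightarrow> real" where
  "bker z v = max 0 (1 - cmod z) / (edist z v)\<^sup>2"

lemma edist_triangle: "edist z w \<le> edist z v + edist v w"
proof -
  have "cmod (z - w) \<le> cmod (z - v) + cmod (v - w)" using norm_triangle_ineq[of "z - v" "v - w"] by simp
  then show ?thesis unfolding edist_def using max.cobounded1[of 0 "1 - cmod v"] by linarith
qed

lemma edist_commute: "edist z w = edist w z"
  by (simp add: edist_def norm_minus_commute)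

lemma edist_nonneg [simp]: "0 \<le> edist z w"
  unfolding edist_def by simp

lemma bker_nonneg [simp]: "0 \<le> bker z v"
  by (simp add: bker_def)

lemma measurable_bker [measurable (raw)]:
  assumes [measurable]: "f \<in> borel_measurable M" "g \<in> borel_measurable M"
  shows "(\<lambda>t. bker (f t) (g t)) \<in> borel_measurable M"
  unfolding bker_def edist_def by measurable

lemma bker_mono:
  assumes "edist z w \<le> c * edist z v" "0 < c" shows "bker z v \<le> c\<^sup>2 * bker z w"
proof (cases "cmod z < 1")
  case True
  then have e: "0 < edist z u" for u by (auto simp: edist_def intro!: add_pos_nonneg)
  have "(edist z w)\<^sup>2 \<le> (c * edist z v)\<^sup>2" using assms by (intro power_mono) auto
  then have "(edist z w)\<^sup>2 / c\<^sup>2 \<le> (edist z v)\<^sup>2" using assms by (simp add: power_mult_distrib field_simps)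
  then have "max 0 (1 - cmod z) / (edist z v)\<^sup>2 \<le> max 0 (1 - cmod z) / ((edist z w)\<^sup>2 / c\<^sup>2)"
    using e[of v] e[of w] assms by (intro divide_left_mono) (auto intro!: mult_pos_pos divide_pos_pos)
  then show ?thesis by (simp add: bker_def mult.commute)
qed (simp add: bker_def)

text \<open>As in \<open>ker_mult_le\<close>: the longer of the two legs to v is at least half of
  \<open>edist z w\<close>.\<close>

lemma bker_mult_le: "bker z v * bker w v \<le> 4 * (bker z w * bker w v) + 4 * (bker w z * bker z v)"
proof (cases "edist w v \<le> edist z v")
  case True
  then have "edist z w \<le> 2 * edist z v" using edist_triangle[of z w v] by (simp add: edist_commute)
  then have "bker z v \<le> 2\<^sup>2 * bker z w" by (rule bker_mono) simp
  then have "bker z v * bker w v \<le> 2\<^sup>2 * bker z w * bker w v" by (rule mult_right_mono) simp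
  then have "bker z v * bker w v \<le> 4 * (bker z w * bker w v)" by simp
  moreover have "0 \<le> bker w z * bker z v" by (intro mult_nonneg_nonneg bker_nonneg)
  ultimately show ?thesis by linarith
next
  case False
  then have "edist w z \<le> 2 * edist w v" using edist_triangle[of w z v] by (simp add: edist_commute)
  then have "bker w v \<le> 2\<^sup>2 * bker w z" by (rule bker_mono) simp
  then have "bker w v * bker z v \<le> 2\<^sup>2 * bker w z * bker z v" by (rule mult_right_mono) simp
  then have "bker z v * bker w v \<le> 4 * (bker w z * bker z v)" by (simp add: mult_ac)
  moreover have "0 \<le> bker z w * bker w v" by (intro mult_nonneg_nonneg bker_nonneg)
  ultimately show ?thesis by linarith
qed

definition balay :: "(complex \<Rightarrow> ennreal) \<Rightarrow> (complex \<Rightarrow> ennreal) \<Rightarrow> complex \<Rightarrow> ennreal" where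
  "balay b \<gamma> v = (\<integral>\<^sup>+z. \<gamma> z * b z * ennreal (bker z v) \<partial>lborel)"

lemma measurable_balay [measurable]:
  assumes [measurable]: "b \<in> borel_measurable borel" "\<gamma> \<in> borel_measurable borel"
  shows "balay b \<gamma> \<in> borel_measurable borel"
  unfolding balay_def by measurable

lemma balay_square_le:
  assumes [measurable]: "b \<in> borel_measurable borel" "\<gamma> \<in> borel_measurable borel"
  shows "(balay b \<gamma> v)\<^sup>2 \<le> 8 * balay b (\<lambda>z. \<gamma> z * balay b \<gamma> z) v"
proof -
  have "(balay b \<gamma> v)\<^sup>2 \<le> 8 * (\<integral>\<^sup>+z. \<gamma> z * b z * balay b \<gamma> z * ennreal (bker z v) \<partial>lborel)"
    unfolding balay_def
  proof (rule square_balayage_le[where k="\<lambda>z v. ennreal (bker z v)" and \<pi>="\<lambda>z. z"])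
    show "sigma_finite_measure (lborel :: complex measure)" ..
    fix x y
    have "ennreal (bker x v * bker y v) \<le> ennreal (4 * (bker x y * bker y v) + 4 * (bker y x * bker x v))"
      by (intro ennreal_leI bker_mult_le)
    then show "ennreal (bker x v) * ennreal (bker y v)
      \<le> 4 * (ennreal (bker x y) * ennreal (bker y v)) + 4 * (ennreal (bker y x) * ennreal (bker x v))"
      by (simp add: ennreal_mult ennreal_plus)
  qed measurable
  then show ?thesis by (simp add: balay_def ac_simps)
qed

text \<open>Moving from z to a boundary point that sees z nontangentially enlarges
  \<open>edist\<close> by a factor of at most 9. Consequently \<gamma> times its balayage again has
  a nontangential majorant, and the squaring step can be iterated.\<close>

lemma balay_nontangential:
  assumes [measurable]: "b \<in> borel_measurable borel" "\<gamma> \<in> borel_measurable borel"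
    and "cmod z < 1" "cmod (z - zeta x) \<le> 8 * (1 - cmod z)"
  shows "balay b \<gamma> z \<le> 81 * balay b \<gamma> (zeta x)"
proof -
  have "bker w z \<le> 81 * bker w (zeta x)" for w
  proof -
    have "cmod (w - zeta x) \<le> cmod (w - z) + cmod (z - zeta x)"
      using norm_triangle_ineq[of "w - z" "z - zeta x"] by simp
    moreover define m where "m = max 0 (1 - cmod w)"
    moreover have "edist w (zeta x) = m + cmod (w - zeta x)" by (simp add: edist_def m_def)
    moreover have "edist w z = m + (1 - cmod z) + cmod (w - z)" using assms by (simp add: edist_def m_def)
    moreover have "0 \<le> m" by (simp add: m_def)
    ultimately have "edist w (zeta x) \<le> 9 * edist w z"
      using assms(3,4) norm_ge_zero[of "w - z"] by argo
    then have "bker w z \<le> 9\<^sup>2 * bker w (zeta x)" by (rule bker_mono) simp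
    then show ?thesis by simp
  qed
  then have le: "ennreal (bker w z) \<le> 81 * ennreal (bker w (zeta x))" for w
    using ennreal_leI[of "bker w z" "81 * bker w (zeta x)"] by (simp add: ennreal_mult)
  have "balay b \<gamma> z \<le> (\<integral>\<^sup>+w. 81 * (\<gamma> w * b w * ennreal (bker w (zeta x))) \<partial>lborel)"
    unfolding balay_def
  proof (intro nn_integral_mono)
    fix w
    show "\<gamma> w * b w * ennreal (bker w z) \<le> 81 * (\<gamma> w * b w * ennreal (bker w (zeta x)))"
      using mult_left_mono[OF le, of "\<gamma> w * b w" w] by (simp add: ac_simps)
  qed
  also have "\<dots> = 81 * balay b \<gamma> (zeta x)"
    unfolding balay_def by (rule nn_integral_cmult) measurable
  finally show ?thesis .
qed

text \<open>The start 42 is that of \<open>carleson_embedding\<close>. Each doubling of the exponent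
  costs 648 = 8 * 81, from \<open>balay_square_le\<close> and \<open>balay_nontangential\<close>;
  the square stems from Cauchy-Schwarz.\<close>

primrec balay_const :: "nat \<Rightarrow> ennreal" where
  "balay_const 0 = 42"
| "balay_const (Suc j) = (648 ^ 2 ^ j * balay_const j)\<^sup>2"

text \<open>Products in \<open>ennreal\<close> are not continuous at 0 and top; for increasing
  sequences suprema get round this.\<close>

lemma tendsto_power_ennreal_inc:
  fixes f :: "nat \<Rightarrow> ennreal" assumes "incseq f" "f \<longlonglongrightarrow> l" shows "(\<lambda>k. f k ^ n) \<longlonglongrightarrow> l ^ n"
proof -
  have l: "l = (SUP k. f k)" using LIMSEQ_SUP[OF assms(1)] assms(2) LIMSEQ_unique by blast
  have inc: "incseq (\<lambda>k. f k ^ n)" for n using assms(1) by (auto simp: incseq_def intro!: power_mono)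
  have "(SUP k. f k ^ n) = (SUP k. f k) ^ n"
  proof (induction n)
    case (Suc n)
    have "f k * f m ^ n \<le> (SUP k. f k ^ Suc n)" for k m
    proof -
      have "f k * f m ^ n \<le> f (max k m) * f (max k m) ^ n"
        by (intro mult_mono power_mono incseqD[OF assms(1)]) auto
      also have "\<dots> \<le> (SUP k. f k ^ Suc n)" by (rule SUP_upper2[of "max k m"]) auto
      finally show ?thesis .
    qed
    then have "(SUP k. f k) * (SUP k. f k ^ n) \<le> (SUP k. f k ^ Suc n)"
      unfolding SUP_mult_left_ennreal SUP_mult_right_ennreal by (intro SUP_least)
    moreover have "(SUP k. f k ^ Suc n) \<le> (SUP k. f k) ^ Suc n"
      by (intro SUP_least power_mono SUP_upper) auto
    ultimately show ?case using Suc by (simp add: antisym)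
  qed simp
  then show ?thesis using LIMSEQ_SUP[OF inc, of n] l by simp
qed

lemma ennreal_power_less_top: "a < top \<Longrightarrow> a ^ n < (top :: ennreal)"
  by (induction n) (auto simp: ennreal_mult_less_top)

lemma balay_const_less_top: "balay_const j < top"
proof (induction j)
  case (Suc j)
  have "(648 :: ennreal) ^ 2 ^ j < top" by (rule ennreal_power_less_top) simp
  then show ?case using Suc by (simp add: power2_eq_square ennreal_mult_less_top)
qed simp

lemma bker_le_pois: assumes "cmod z < 1" shows "bker z (zeta x) \<le> pois z x"
proof -
  have "edist z (zeta x) \<ge> cmod (zeta x - z)" by (simp add: edist_def norm_minus_commute)
  then have k1: "(cmod (zeta x - z))\<^sup>2 \<le> (edist z (zeta x))\<^sup>2" by (intro power_mono) auto
  have k2: "0 < (cmod (zeta x - z))\<^sup>2" using zeta_neq[OF assms] by simp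
  have "(cmod z)\<^sup>2 \<le> cmod z" using assms by (simp add: power2_eq_square mult_left_le)
  then have "max 0 (1 - cmod z) \<le> 1 - (cmod z)\<^sup>2" using assms by simp
  then show ?thesis unfolding bker_def pois_def by (intro frac_le[OF _ _ k2 k1]) (use assms in \<open>auto simp: abs_square_le_1\<close>)
qed

lemma balay_circ_le:
  assumes [measurable]: "b \<in> borel_measurable borel" "\<gamma> \<in> borel_measurable borel"
    and b0: "\<And>z. 1 \<le> cmod z \<Longrightarrow> b z = 0"
  shows "(\<integral>\<^sup>+x. balay b \<gamma> (zeta x) \<partial>circ) \<le> (\<integral>\<^sup>+z. \<gamma> z * b z \<partial>lborel)"
proof -
  interpret pair_sigma_finite lborel circ ..
  have "(\<integral>\<^sup>+x. balay b \<gamma> (zeta x) \<partial>circ) = (\<integral>\<^sup>+z. \<integral>\<^sup>+x. \<gamma> z * b z * ennreal (bker z (zeta x)) \<partial>circ \<partial>lborel)"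
    unfolding balay_def by (rule Fubini') measurable
  also have "\<dots> \<le> (\<integral>\<^sup>+z. \<gamma> z * b z \<partial>lborel)"
  proof (intro nn_integral_mono)
    fix z
    show "(\<integral>\<^sup>+x. \<gamma> z * b z * ennreal (bker z (zeta x)) \<partial>circ) \<le> \<gamma> z * b z"
    proof (cases "cmod z < 1")
      case True
      have "(\<integral>\<^sup>+x. \<gamma> z * b z * ennreal (bker z (zeta x)) \<partial>circ) = \<gamma> z * b z * (\<integral>\<^sup>+x. ennreal (bker z (zeta x)) \<partial>circ)"
        by (rule nn_integral_cmult) measurable
      also have "\<dots> \<le> \<gamma> z * b z * (\<integral>\<^sup>+x. ennreal (pois z x) \<partial>circ)"
        using bker_le_pois[OF True] by (intro mult_left_mono nn_integral_mono ennreal_leI) auto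
      finally show ?thesis by (simp add: nn_integral_pois[OF True])
    qed (simp add: b0)
  qed
  finally show ?thesis .
qed

text \<open>Let n = 2^j and X the integral of S^(2n). By \<open>balay_square_le\<close>, X is
  controlled by the n-th power of the balayage of \<gamma> S, whose majorant is 81 N S. The
  induction hypothesis and Cauchy-Schwarz give X^2 \<le> c Y X with Y the integral of N^(2n). The
  bound B makes X finite, so that X cancels.\<close>

lemma balay_power_bounded:
  assumes b: "carleson b \<Lambda>"
  shows "ntmaj \<gamma> N \<Longrightarrow> B < top \<Longrightarrow> (\<And>v. balay b \<gamma> v \<le> B) \<Longrightarrow>
    (\<integral>\<^sup>+x. balay b \<gamma> (zeta x) ^ 2 ^ j \<partial>circ) \<le> balay_const j * \<Lambda> ^ 2 ^ j * (\<integral>\<^sup>+x. N x ^ 2 ^ j \<partial>circ)"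
proof (induction j arbitrary: \<gamma> N B)
  case 0
  have [measurable]: "b \<in> borel_measurable borel" "\<gamma> \<in> borel_measurable borel"
    using b 0 by (auto simp: carleson_def ntmaj_def)
  have "(\<integral>\<^sup>+x. balay b \<gamma> (zeta x) \<partial>circ) \<le> (\<integral>\<^sup>+z. \<gamma> z * b z \<partial>lborel)"
    by (rule balay_circ_le) (use b in \<open>auto simp: carleson_def\<close>)
  also have "\<dots> \<le> 42 * \<Lambda> * (\<integral>\<^sup>+x. N x \<partial>circ)" by (rule carleson_embedding[OF b 0(1)])
  finally show ?case by simp
next
  case (Suc j)
  have [measurable]: "b \<in> borel_measurable borel" "\<gamma> \<in> borel_measurable borel" "N \<in> borel_measurable borel"
    using b Suc.prems(1) by (auto simp: carleson_def ntmaj_def)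
  have Nc [measurable]: "N \<in> borel_measurable circ" by (rule measurable_circ) simp
  define n :: nat where "n = 2 ^ j"
  have n2: "2 ^ Suc j = 2 * n" by (simp add: n_def)
  define S where "S x = balay b \<gamma> (zeta x)" for x
  have S_meas [measurable]: "S \<in> borel_measurable borel" unfolding S_def by measurable
  have [measurable]: "S \<in> borel_measurable circ" by (rule measurable_circ) simp
  \<comment> \<open>The induction hypothesis is used for this new density; hence \<gamma>, N and B
    are generalized in the induction.\<close>
  define \<gamma>' where "\<gamma>' z = \<gamma> z * balay b \<gamma> z" for z
  define N' where "N' x = N x * (81 * S x)" for x
  have nt: "ntmaj \<gamma>' N'"
    unfolding ntmaj_def
  proof (intro conjI allI impI)
    show "\<gamma>' \<in> borel_measurable borel" unfolding \<gamma>'_def by measurable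
    show "N' \<in> borel_measurable borel" unfolding N'_def by measurable
    fix x z assume z: "cmod z < 1" "cmod (z - zeta x) \<le> 8 * (1 - cmod z)"
    then show "\<gamma>' z \<le> N' x" unfolding \<gamma>'_def N'_def S_def using Suc.prems(1)
      by (intro mult_mono balay_nontangential) (auto simp: ntmaj_def)
  qed
  \<comment> \<open>Boundedness passes to the new balayage, with B squared.\<close>
  have bd: "balay b \<gamma>' v \<le> B * B" for v
  proof -
    have "balay b \<gamma>' v \<le> (\<integral>\<^sup>+z. B * (\<gamma> z * b z * ennreal (bker z v)) \<partial>lborel)"
      unfolding balay_def[of b \<gamma>']
    proof (intro nn_integral_mono)
      fix z
      show "\<gamma>' z * b z * ennreal (bker z v) \<le> B * (\<gamma> z * b z * ennreal (bker z v))"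
        using mult_right_mono[OF Suc.prems(3)[of z], of "\<gamma> z * b z * ennreal (bker z v)"]
        by (simp add: \<gamma>'_def ac_simps)
    qed
    also have "\<dots> = B * balay b \<gamma> v" unfolding balay_def by (rule nn_integral_cmult) measurable
    also have "\<dots> \<le> B * B" by (intro mult_left_mono Suc.prems) auto
    finally show ?thesis .
  qed
  let ?X = "\<integral>\<^sup>+x. S x ^ (2 * n) \<partial>circ" and ?Y = "\<integral>\<^sup>+x. N x ^ (2 * n) \<partial>circ"
  have "?X \<le> (\<integral>\<^sup>+x. 8 ^ n * balay b \<gamma>' (zeta x) ^ n \<partial>circ)"
  proof (intro nn_integral_mono)
    fix x
    have "(S x)\<^sup>2 \<le> 8 * balay b \<gamma>' (zeta x)"
      unfolding S_def \<gamma>'_def by (rule balay_square_le) measurable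
    then have "((S x)\<^sup>2) ^ n \<le> (8 * balay b \<gamma>' (zeta x)) ^ n" by (rule power_mono) simp
    then show "S x ^ (2 * n) \<le> 8 ^ n * balay b \<gamma>' (zeta x) ^ n" by (simp add: power_mult power_mult_distrib)
  qed
  also have "\<dots> = 8 ^ n * (\<integral>\<^sup>+x. balay b \<gamma>' (zeta x) ^ n \<partial>circ)"
  proof (rule nn_integral_cmult)
    have [measurable]: "\<gamma>' \<in> borel_measurable borel" unfolding \<gamma>'_def by measurable
    have "(\<lambda>x. balay b \<gamma>' (zeta x) ^ n) \<in> borel_measurable borel" by measurable
    then show "(\<lambda>x. balay b \<gamma>' (zeta x) ^ n) \<in> borel_measurable circ" by (rule measurable_circ)
  qed
  also have "\<dots> \<le> 8 ^ n * (balay_const j * \<Lambda> ^ n * (\<integral>\<^sup>+x. N' x ^ n \<partial>circ))"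
  proof (rule mult_left_mono)
    have "B * B < top" using Suc.prems(2) by (simp add: ennreal_mult_less_top)
    then show "(\<integral>\<^sup>+x. balay b \<gamma>' (zeta x) ^ n \<partial>circ) \<le> balay_const j * \<Lambda> ^ n * (\<integral>\<^sup>+x. N' x ^ n \<partial>circ)"
      unfolding n_def by (rule Suc.IH[OF nt _ bd])
  qed simp
  also have "(\<integral>\<^sup>+x. N' x ^ n \<partial>circ) = (\<integral>\<^sup>+x. 81 ^ n * (N x ^ n * S x ^ n) \<partial>circ)"
    by (simp add: N'_def power_mult_distrib ac_simps)
  also have "\<dots> = 81 ^ n * (\<integral>\<^sup>+x. N x ^ n * S x ^ n \<partial>circ)"
    by (rule nn_integral_cmult) measurable
  finally have "?X \<le> (648 ^ n * balay_const j * \<Lambda> ^ n) * (\<integral>\<^sup>+x. N x ^ n * S x ^ n \<partial>circ)"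
  proof -
    have "(648 :: ennreal) ^ n = 8 ^ n * 81 ^ n" by (simp add: power_mult_distrib[symmetric])
    then show "?X \<le> 8 ^ n * (balay_const j * \<Lambda> ^ n * (81 ^ n * (\<integral>\<^sup>+x. N x ^ n * S x ^ n \<partial>circ))) \<Longrightarrow> ?thesis"
      by (simp add: ac_simps)
  qed
  then have "?X\<^sup>2 \<le> ((648 ^ n * balay_const j * \<Lambda> ^ n) * (\<integral>\<^sup>+x. N x ^ n * S x ^ n \<partial>circ))\<^sup>2"
    by (rule power_mono) simp
  also have "\<dots> = (648 ^ n * balay_const j * \<Lambda> ^ n)\<^sup>2 * (\<integral>\<^sup>+x. N x ^ n * S x ^ n \<partial>circ)\<^sup>2"
    by (rule power_mult_distrib)
  also have "\<dots> \<le> (648 ^ n * balay_const j * \<Lambda> ^ n)\<^sup>2 * ((\<integral>\<^sup>+x. (N x ^ n)\<^sup>2 \<partial>circ) * (\<integral>\<^sup>+x. (S x ^ n)\<^sup>2 \<partial>circ))"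
    by (intro mult_left_mono Cauchy_Schwarz_nn_integral) auto
  also have "\<dots> = ((648 ^ n * balay_const j * \<Lambda> ^ n)\<^sup>2 * ?Y) * ?X"
    by (simp add: power_mult[symmetric] mult.commute[of n 2] mult.assoc)
  finally have "?X\<^sup>2 \<le> ((648 ^ n * balay_const j * \<Lambda> ^ n)\<^sup>2 * ?Y) * ?X" .
  moreover have "?X < top"
  proof -
    have "?X \<le> (\<integral>\<^sup>+x. B ^ (2 * n) \<partial>circ)"
      unfolding S_def by (intro nn_integral_mono power_mono Suc.prems) auto
    then show ?thesis using ennreal_power_less_top[OF Suc.prems(2), of "2 * n"] by simp
  qed
  ultimately have "?X \<le> (648 ^ n * balay_const j * \<Lambda> ^ n)\<^sup>2 * ?Y" by (rule ennreal_le_of_square_le)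
  also have "(648 ^ n * balay_const j * \<Lambda> ^ n)\<^sup>2 = balay_const (Suc j) * \<Lambda> ^ (2 * n)"
    by (simp add: n_def power_mult_distrib power_mult[symmetric] mult.commute)
  finally show ?case unfolding n2 S_def .
qed

text \<open>The bound required above is created by truncation: where 1 - |z| \<ge> 1/(k+1) the
  kernel is at most k + 1, the density is capped at k, and the Carleson measure has finite mass.
  Monotone convergence recovers the balayage and Fatou's lemma its power integral.\<close>

lemma balay_power:
  assumes b: "carleson b \<Lambda>" and L: "\<Lambda> < top" and nt: "ntmaj \<gamma> N"
  shows "(\<integral>\<^sup>+x. balay b \<gamma> (zeta x) ^ 2 ^ j \<partial>circ) \<le> balay_const j * \<Lambda> ^ 2 ^ j * (\<integral>\<^sup>+x. N x ^ 2 ^ j \<partial>circ)"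
proof -
  have [measurable]: "b \<in> borel_measurable borel" "\<gamma> \<in> borel_measurable borel" "N \<in> borel_measurable borel"
    and b0: "\<And>z. 1 \<le> cmod z \<Longrightarrow> b z = 0"
    using b nt by (auto simp: carleson_def ntmaj_def)
  define \<gamma>' where "\<gamma>' k z = min (\<gamma> z) (of_nat k) * indicator (cball 0 (1 - 1 / (real k + 1))) z" for k z
  have [measurable]: "cball (0::complex) s \<in> sets borel" for s by simp
  have [measurable]: "\<gamma>' k \<in> borel_measurable borel" for k unfolding \<gamma>'_def by measurable
  have g_le: "\<gamma>' k z \<le> \<gamma> z" for k z by (auto simp: \<gamma>'_def split: split_indicator)
  have inc: "\<gamma>' k z \<le> \<gamma>' (Suc k) z" for k z
    unfolding \<gamma>'_def
  proof (rule mult_mono)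
    have "1 / (real (Suc k) + 1) \<le> 1 / (real k + 1)" by (intro divide_left_mono) auto
    then show "indicator (cball 0 (1 - 1 / (real k + 1))) z \<le> (indicator (cball 0 (1 - 1 / (real (Suc k) + 1))) z :: ennreal)"
      by (auto split: split_indicator)
    show "min (\<gamma> z) (of_nat k) \<le> min (\<gamma> z) (of_nat (Suc k))"
      by (intro min.mono order_refl) simp
  qed auto
  have sup: "(SUP k. \<gamma>' k z * b z) = \<gamma> z * b z" for z
  proof (cases "cmod z < 1")
    case True
    obtain k0 :: nat where k0: "1 / (1 - cmod z) < real k0" using reals_Archimedean2 by blast
    have ge: "min (\<gamma> z) (of_nat k) \<le> (SUP k. \<gamma>' k z)" for k
    proof -
      define m where "m = max k k0"
      have "1 / (1 - cmod z) \<le> real m + 1" using k0 by (simp add: m_def)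
      then have "1 / (real m + 1) \<le> 1 - cmod z" using True by (simp add: field_simps)
      then have "\<gamma>' m z = min (\<gamma> z) (of_nat m)" by (simp add: \<gamma>'_def)
      moreover have "min (\<gamma> z) (of_nat k) \<le> min (\<gamma> z) (of_nat m)" by (intro min.mono) (auto simp: m_def)
      ultimately show ?thesis by (metis SUP_upper UNIV_I order_trans)
    qed
    have "\<gamma> z \<le> (SUP k. \<gamma>' k z)"
    proof (cases "\<gamma> z = top")
      case True
      have "(SUP k. of_nat k :: ennreal) \<le> (SUP k. \<gamma>' k z)"
        using ge True by (intro SUP_least) simp
      then show ?thesis by (simp add: ennreal_SUP_of_nat_eq_top top_unique True)
    next
      case False
      then obtain r where r: "\<gamma> z = ennreal r" "0 \<le> r" by (cases "\<gamma> z") auto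
      obtain k :: nat where "r \<le> real k" using real_arch_simple by blast
      then have "\<gamma> z \<le> of_nat k" using r by (simp add: ennreal_of_nat_eq_real_of_nat ennreal_leI)
      then show ?thesis using ge[of k] by (simp add: min_absorb1)
    qed
    then have "(SUP k. \<gamma>' k z) = \<gamma> z" by (intro antisym SUP_least g_le)
    then show ?thesis by (simp add: SUP_mult_right_ennreal[symmetric])
  qed (simp add: b0)
  have intb: "(\<integral>\<^sup>+z. b z \<partial>lborel) < top"
  proof -
    have "(\<integral>\<^sup>+z. b z \<partial>lborel) \<le> (\<integral>\<^sup>+z. b z * indicator (ball (zeta 0) 2) z \<partial>lborel)"
    proof (intro nn_integral_mono)
      fix z
      show "b z \<le> b z * indicator (ball (zeta 0) 2) z"
      proof (cases "cmod z < 1")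
        case True
        then have "z \<in> ball (zeta 0) 2" using norm_triangle_ineq4[of "zeta 0" z] by (simp add: dist_norm)
        then show ?thesis by simp
      qed (simp add: b0)
    qed
    also have "\<dots> \<le> \<Lambda> * ennreal 2" using b by (simp add: carleson_def del: ennreal_numeral)
    also have "\<dots> < top" using L by (simp add: ennreal_mult_less_top)
    finally show ?thesis .
  qed
  have bound: "(\<integral>\<^sup>+x. balay b (\<gamma>' k) (zeta x) ^ 2 ^ j \<partial>circ) \<le> balay_const j * \<Lambda> ^ 2 ^ j * (\<integral>\<^sup>+x. N x ^ 2 ^ j \<partial>circ)" for k
  proof (rule balay_power_bounded[OF b])
    show "ntmaj (\<gamma>' k) N" using nt g_le order_trans[OF g_le] by (auto simp: ntmaj_def)
    let ?B = "of_nat k * ennreal (real k + 1) * (\<integral>\<^sup>+z. b z \<partial>lborel)"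
    show "?B < top" using intb by (simp add: ennreal_mult_less_top ennreal_of_nat_eq_real_of_nat)
    fix v
    have "balay b (\<gamma>' k) v \<le> (\<integral>\<^sup>+z. of_nat k * ennreal (real k + 1) * b z \<partial>lborel)"
      unfolding balay_def
    proof (intro nn_integral_mono)
      fix z
      show "\<gamma>' k z * b z * ennreal (bker z v) \<le> of_nat k * ennreal (real k + 1) * b z"
      proof (cases "z \<in> cball 0 (1 - 1 / (real k + 1))")
        case True
        then have d: "1 / (real k + 1) \<le> 1 - cmod z" by simp
        moreover have "0 < 1 / (real k + 1)" by simp
        ultimately have d0: "0 < 1 - cmod z" by linarith
        have "1 - cmod z \<le> edist z v" unfolding edist_def using norm_ge_zero[of "z - v"] max.cobounded1[of 0 "1 - cmod v"] max.cobounded2[of 0 "1 - cmod z"] by linarith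
        then have "(1 - cmod z)\<^sup>2 \<le> (edist z v)\<^sup>2" using d0 by (intro power_mono) auto
        then have "bker z v \<le> (1 - cmod z) / (1 - cmod z)\<^sup>2" unfolding bker_def using d0
          by (intro frac_le) auto
        also have "\<dots> = 1 / (1 - cmod z)" by (simp add: power2_eq_square)
        also have "\<dots> \<le> real k + 1" using d d0 by (simp add: field_simps)
        finally have "ennreal (bker z v) \<le> ennreal (real k + 1)" by (rule ennreal_leI)
        moreover have "\<gamma>' k z \<le> of_nat k" by (auto simp: \<gamma>'_def split: split_indicator)
        ultimately have "\<gamma>' k z * (ennreal (bker z v) * b z) \<le> of_nat k * (ennreal (real k + 1) * b z)"
          by (intro mult_mono order_refl) auto
        then show ?thesis by (simp add: ac_simps)
      qed (simp add: \<gamma>'_def)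
    qed
    also have "\<dots> = ?B" by (rule nn_integral_cmult) measurable
    finally show "balay b (\<gamma>' k) v \<le> ?B" .
  qed
  have S_inc: "incseq (\<lambda>k. balay b (\<gamma>' k) v)" for v
    unfolding balay_def by (intro incseq_SucI nn_integral_mono mult_right_mono inc) auto
  have S_sup: "balay b \<gamma> v = (SUP k. balay b (\<gamma>' k) v)" for v
  proof -
    have "balay b \<gamma> v = (\<integral>\<^sup>+z. (SUP k. \<gamma>' k z * b z * ennreal (bker z v)) \<partial>lborel)"
      unfolding balay_def by (simp only: sup[symmetric] SUP_mult_right_ennreal)
    also have "\<dots> = (SUP k. balay b (\<gamma>' k) v)"
      unfolding balay_def
      by (rule nn_integral_monotone_convergence_SUP)
        (auto simp: incseq_def le_fun_def intro!: mult_right_mono lift_Suc_mono_le[of "\<lambda>k. \<gamma>' k _", OF inc])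
    finally show ?thesis .
  qed
  have "(\<integral>\<^sup>+x. balay b \<gamma> (zeta x) ^ 2 ^ j \<partial>circ) \<le> (\<integral>\<^sup>+x. liminf (\<lambda>k. balay b (\<gamma>' k) (zeta x) ^ 2 ^ j) \<partial>circ)"
  proof (intro nn_integral_mono)
    fix x
    have "(\<lambda>k. balay b (\<gamma>' k) (zeta x)) \<longlonglongrightarrow> balay b \<gamma> (zeta x)"
      unfolding S_sup by (rule LIMSEQ_SUP[OF S_inc])
    then have "(\<lambda>k. balay b (\<gamma>' k) (zeta x) ^ n) \<longlonglongrightarrow> balay b \<gamma> (zeta x) ^ n" for n
      by (intro tendsto_power_ennreal_inc S_inc)
    then show "balay b \<gamma> (zeta x) ^ 2 ^ j \<le> liminf (\<lambda>k. balay b (\<gamma>' k) (zeta x) ^ 2 ^ j)"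
      by (subst lim_imp_Liminf) auto
  qed
  also have "\<dots> \<le> liminf (\<lambda>k. \<integral>\<^sup>+x. balay b (\<gamma>' k) (zeta x) ^ 2 ^ j \<partial>circ)"
    by (rule nn_integral_liminf) (rule measurable_circ, measurable)
  also have "\<dots> \<le> balay_const j * \<Lambda> ^ 2 ^ j * (\<integral>\<^sup>+x. N x ^ 2 ^ j \<partial>circ)"
    by (rule order_trans[OF Liminf_le_Limsup Limsup_bounded]) (simp_all add: always_eventually bound)
  finally show ?thesis .
qed

section \<open>Area mean values\<close>

lemma emeasure_ball_complex: "0 \<le> r \<Longrightarrow> emeasure lborel (ball (c::complex) r) = ennreal (pi * r\<^sup>2)"
  by (simp add: emeasure_ball unit_ball_vol_2)

lemma emeasure_cball_complex: "0 \<le> r \<Longrightarrow> emeasure lborel (cball (c::complex) r) = ennreal (pi * r\<^sup>2)"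
  by (simp add: emeasure_cball unit_ball_vol_2)

lemma nn_integral_lborel_shift:
  fixes f :: "complex \<Rightarrow> ennreal" assumes [measurable]: "f \<in> borel_measurable borel"
  shows "(\<integral>\<^sup>+z. f (z + c) \<partial>lborel) = (\<integral>\<^sup>+z. f z \<partial>lborel)"
proof -
  have "(\<integral>\<^sup>+z. f z \<partial>lborel) = (\<integral>\<^sup>+z. f z \<partial>distr lborel borel ((+) c))" by (simp add: lborel_distr_plus)
  also have "\<dots> = (\<integral>\<^sup>+z. f (c + z) \<partial>lborel)" by (rule nn_integral_distr) auto
  finally show ?thesis by (simp add: add.commute)
qed

text \<open>Averaging Cauchy's formula over the centre of the circle instead of its radius needs only
  translation invariance of area, no polar coordinates.\<close>

lemma area_mean_value:
  assumes k: "k holomorphic_on ball z0 (2 * \<rho>)" and \<rho>: "0 < \<rho>"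
  shows "ennreal (cmod (k z0) * (pi * \<rho>\<^sup>2 / 4)) \<le> 2 * (\<integral>\<^sup>+z. ennreal (cmod (k z)) * indicator (ball z0 (2 * \<rho>)) z \<partial>lborel)"
proof -
  interpret pair_sigma_finite lborel circ ..
  define f where "f z = ennreal (cmod (k z)) * indicator (ball z0 (2 * \<rho>)) z" for z
  have [measurable]: "f \<in> borel_measurable borel"
  proof -
    have "(\<lambda>z. indicator (ball z0 (2 * \<rho>)) z *\<^sub>R cmod (k z)) \<in> borel_measurable borel"
      by (intro borel_measurable_continuous_on_indicator continuous_intros holomorphic_on_imp_continuous_on k) simp
    then have "(\<lambda>z. ennreal (indicator (ball z0 (2 * \<rho>)) z *\<^sub>R cmod (k z))) \<in> borel_measurable borel" by measurable
    also have "(\<lambda>z. ennreal (indicator (ball z0 (2 * \<rho>)) z *\<^sub>R cmod (k z))) = f"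
      by (auto simp: f_def fun_eq_iff split: split_indicator)
    finally show ?thesis .
  qed
  have [measurable]: "ball c s \<in> sets borel" for c :: complex and s by simp
  \<comment> \<open>If c is within \<rho>/2 of z0, the circle of radius \<rho> about c stays at
    least \<rho>/2 away from z0 and inside the ball of radius 2 \<rho>; the Cauchy kernel is at most
    2 there.\<close>
  have ptw: "ennreal (cmod (k z0)) * indicator (ball z0 (\<rho> / 2)) c \<le> (\<integral>\<^sup>+x. 2 * f (c + of_real \<rho> * zeta x) \<partial>circ)" for c
  proof (cases "c \<in> ball z0 (\<rho> / 2)")
    case True
    then have c: "cmod (z0 - c) < \<rho> / 2" by (simp add: dist_norm)
    have sub: "cball c \<rho> \<subseteq> ball z0 (2 * \<rho>)"
    proof
      fix z assume "z \<in> cball c \<rho>"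
      then have "dist z0 z \<le> dist z0 c + \<rho>" using dist_triangle[of z0 z c] by simp
      then show "z \<in> ball z0 (2 * \<rho>)" using c \<rho> by (simp add: dist_norm)
    qed
    let ?g = "\<lambda>x. of_real \<rho> * zeta x / (c + of_real \<rho> * zeta x - z0) * k (c + of_real \<rho> * zeta x)"
    have kz: "(LINT x|circ. ?g x) = k z0"
      by (rule Cauchy_circ[OF holomorphic_on_subset[OF k sub]]) (use c \<rho> in simp)
    have den: "\<rho> / 2 \<le> cmod (c + of_real \<rho> * zeta x - z0)" for x
    proof -
      have "cmod (of_real \<rho> * zeta x) \<le> cmod (c + of_real \<rho> * zeta x - z0) + cmod (z0 - c)"
        by (rule order_trans[OF _ norm_triangle_ineq]) simp
      then show ?thesis using c \<rho> by (simp add: norm_mult)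
    qed
    have mem: "c + of_real \<rho> * zeta x \<in> ball z0 (2 * \<rho>)" for x
      using sub \<rho> by (auto simp: subset_iff dist_norm norm_mult)
    have gle: "ennreal (cmod (?g x)) \<le> 2 * f (c + of_real \<rho> * zeta x)" for x
    proof -
      have "cmod (of_real \<rho> * zeta x / (c + of_real \<rho> * zeta x - z0)) \<le> \<rho> / (\<rho> / 2)"
        unfolding norm_divide using den[of x] \<rho> by (intro frac_le) (auto simp: norm_mult)
      also have "\<dots> = 2" using \<rho> by simp
      finally have "cmod (?g x) \<le> 2 * cmod (k (c + of_real \<rho> * zeta x))"
        unfolding norm_mult by (intro mult_right_mono) (auto simp: norm_mult norm_divide)
      then have "ennreal (cmod (?g x)) \<le> ennreal (2 * cmod (k (c + of_real \<rho> * zeta x)))" by (rule ennreal_leI)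
      then show ?thesis using mem by (simp add: f_def ennreal_mult)
    qed
    \<comment> \<open>The integral of a non-integrable function is 0 by convention, so the bound
      holds in either case.\<close>
    have "ennreal (cmod (k z0)) \<le> (\<integral>\<^sup>+x. ennreal (cmod (?g x)) \<partial>circ)"
      unfolding kz[symmetric] 
      by (cases "integrable circ ?g") (auto simp: integral_norm_bound_ennreal not_integrable_integral_eq)
    also have "\<dots> \<le> (\<integral>\<^sup>+x. 2 * f (c + of_real \<rho> * zeta x) \<partial>circ)" by (intro nn_integral_mono gle)
    finally show ?thesis using True by simp
  qed simp
  have "ennreal (cmod (k z0) * (pi * \<rho>\<^sup>2 / 4)) = ennreal (cmod (k z0)) * emeasure lborel (ball z0 (\<rho> / 2))"
    using \<rho> by (simp add: emeasure_ball_complex ennreal_mult'[symmetric] power_divide)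
  also have "\<dots> = (\<integral>\<^sup>+c. ennreal (cmod (k z0)) * indicator (ball z0 (\<rho> / 2)) c \<partial>lborel)"
    by (rule nn_integral_cmult_indicator[symmetric]) simp
  also have "\<dots> \<le> (\<integral>\<^sup>+c. \<integral>\<^sup>+x. 2 * f (c + of_real \<rho> * zeta x) \<partial>circ \<partial>lborel)"
    by (intro nn_integral_mono ptw)
  also have "\<dots> = (\<integral>\<^sup>+x. \<integral>\<^sup>+c. 2 * f (c + of_real \<rho> * zeta x) \<partial>lborel \<partial>circ)"
    by (rule Fubini'[symmetric]) measurable
  also have "\<dots> = (\<integral>\<^sup>+x. 2 * (\<integral>\<^sup>+z. f z \<partial>lborel) \<partial>circ)"
  proof (intro nn_integral_cong)
    fix x
    have "(\<integral>\<^sup>+c. 2 * f (c + of_real \<rho> * zeta x) \<partial>lborel) = 2 * (\<integral>\<^sup>+c. f (c + of_real \<rho> * zeta x) \<partial>lborel)"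
      by (rule nn_integral_cmult) measurable
    then show "(\<integral>\<^sup>+c. 2 * f (c + of_real \<rho> * zeta x) \<partial>lborel) = 2 * (\<integral>\<^sup>+z. f z \<partial>lborel)"
      by (simp add: nn_integral_lborel_shift)
  qed
  finally show ?thesis by (simp add: f_def)
qed

text \<open>Up to a the first term dominates, beyond it (y/a)^(q-1) \<ge> 1. A small a lets the
  first term be absorbed later on.\<close>

lemma le_scaled_powr:
  fixes y a q :: real assumes "0 \<le> y" "0 < a" "1 \<le> q" shows "y \<le> a + a powr (1 - q) * y powr q"
proof (cases "y \<le> a")
  case False
  then have "1 \<le> (y / a) powr (q - 1)" using assms by (intro ge_one_powr_ge_zero) auto
  then have "y * 1 \<le> y * (y / a) powr (q - 1)" using assms by (intro mult_left_mono) auto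
  also have "\<dots> = a powr (1 - q) * (y powr 1 * y powr (q - 1))"
    using assms False by (simp add: powr_divide powr_diff field_simps)
  also have "y powr 1 * y powr (q - 1) = y powr q" using False assms by (simp add: powr_mult_base)
  finally show ?thesis using assms by simp
qed (use assms in \<open>simp add: add_increasing2\<close>)

text \<open>A functional norming h at z0 reduces the claim to the scalar mean value for first
  powers, and \<open>le_scaled_powr\<close> trades the first power for the q-th.\<close>

lemma area_mean_value_powr:
  fixes h :: "complex \<Rightarrow> 'a::complex_banach"
  assumes h: "analytic_disc h" and z0: "cmod z0 < 1" and q: "1 \<le> q"
  shows "ennreal (norm (h z0) powr q) \<le> ennreal (64 powr (q + 1) / (1 - cmod z0)\<^sup>2) *
    (\<integral>\<^sup>+z. ennreal (norm (h z) powr q) * indicator (ball z0 ((1 - cmod z0) / 4)) z \<partial>lborel)"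
proof -
  define \<rho> where "\<rho> = (1 - cmod z0) / 8"
  have \<rho>: "0 < \<rho>" using z0 by (simp add: \<rho>_def)
  have \<rho>2: "(1 - cmod z0) / 4 = 2 * \<rho>" "1 - cmod z0 = 8 * \<rho>" by (auto simp: \<rho>_def)
  define A where "A = norm (h z0)"
  define I where "I = (\<integral>\<^sup>+z. ennreal (norm (h z) powr q) * indicator (ball z0 (2 * \<rho>)) z \<partial>lborel)"
  have sub: "ball z0 (2 * \<rho>) \<subseteq> disc"
  proof
    fix z assume "z \<in> ball z0 (2 * \<rho>)"
    then have "cmod (z - z0) < 2 * \<rho>" by (simp add: dist_norm norm_minus_commute)
    then show "z \<in> disc" using norm_triangle_ineq2[of z z0] \<rho>2 \<rho> by simp
  qed
  have "ennreal (A powr q) \<le> ennreal (64 powr (q + 1) / (8 * \<rho>)\<^sup>2) * I"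
  proof (cases "A = 0")
    case False
    then have A: "0 < A" by (simp add: A_def)
    obtain l :: "'a \<Rightarrow> complex" where l: "\<And>x y. l (x + y) = l x + l y" "\<And>a x. l (a *\<^sub>C x) = a * l x"
      "\<And>x. cmod (l x) \<le> norm x" "l (h z0) = norm (h z0)"
      using Hahn_Banach_norming by blast
    have hol: "(\<lambda>z. l (h z)) holomorphic_on ball z0 (2 * \<rho>)"
      by (rule holomorphic_on_subset[OF analytic_disc_functional[OF l(1-3) h] sub])
    \<comment> \<open>With 64, the term coming from a is 8 pi a \<rho>^2, exactly half of the left
      side A pi \<rho>^2 / 4.\<close>
    define a where "a = A / 64"
    have a: "0 < a" using A by (simp add: a_def)
    have [measurable]: "(\<lambda>z. ennreal (norm (h z) powr q) * indicator (ball z0 (2 * \<rho>)) z) \<in> borel_measurable borel"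
    proof -
      have "(\<lambda>z. indicator (ball z0 (2 * \<rho>)) z *\<^sub>R (norm (h z) powr q)) \<in> borel_measurable borel"
        using q by (intro borel_measurable_continuous_on_indicator continuous_on_powr' continuous_intros
            continuous_on_subset[OF analytic_disc_imp_continuous_on[OF h] sub]) auto
      then have "(\<lambda>z. ennreal (indicator (ball z0 (2 * \<rho>)) z *\<^sub>R (norm (h z) powr q))) \<in> borel_measurable borel" by measurable
      also have "(\<lambda>z. ennreal (indicator (ball z0 (2 * \<rho>)) z *\<^sub>R (norm (h z) powr q)))
         = (\<lambda>z. ennreal (norm (h z) powr q) * indicator (ball z0 (2 * \<rho>)) z)"
        by (auto simp: fun_eq_iff split: split_indicator)
      finally show ?thesis .
    qed
    have [measurable]: "ball c s \<in> sets borel" for c :: complex and s by simp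
    have "ennreal (A * (pi * \<rho>\<^sup>2 / 4)) \<le> 2 * (\<integral>\<^sup>+z. ennreal (cmod (l (h z))) * indicator (ball z0 (2 * \<rho>)) z \<partial>lborel)"
      using area_mean_value[OF hol \<rho>] by (simp add: l(4) A_def)
    also have "(\<integral>\<^sup>+z. ennreal (cmod (l (h z))) * indicator (ball z0 (2 * \<rho>)) z \<partial>lborel)
      \<le> (\<integral>\<^sup>+z. ennreal a * indicator (ball z0 (2 * \<rho>)) z + ennreal (a powr (1 - q)) * (ennreal (norm (h z) powr q) * indicator (ball z0 (2 * \<rho>)) z) \<partial>lborel)"
    proof (intro nn_integral_mono)
      fix z
      have "cmod (l (h z)) \<le> a + a powr (1 - q) * norm (h z) powr q"
        using l(3)[of "h z"] le_scaled_powr[OF norm_ge_zero a q, of "h z"] by linarith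
      then have "ennreal (cmod (l (h z))) \<le> ennreal a + ennreal (a powr (1 - q)) * ennreal (norm (h z) powr q)"
        using a by (simp add: ennreal_mult[symmetric] ennreal_plus[symmetric] ennreal_leI del: ennreal_plus)
      then show "ennreal (cmod (l (h z))) * indicator (ball z0 (2 * \<rho>)) z
        \<le> ennreal a * indicator (ball z0 (2 * \<rho>)) z + ennreal (a powr (1 - q)) * (ennreal (norm (h z) powr q) * indicator (ball z0 (2 * \<rho>)) z)"
        by (auto split: split_indicator)
    qed
    also have "\<dots> = ennreal a * ennreal (pi * (2 * \<rho>)\<^sup>2) + ennreal (a powr (1 - q)) * I"
      using \<rho> by (subst nn_integral_add) (auto simp: nn_integral_cmult I_def emeasure_ball_complex)
    finally have main: "ennreal (A * (pi * \<rho>\<^sup>2 / 4)) \<le> 2 * (ennreal a * ennreal (pi * (2 * \<rho>)\<^sup>2) + ennreal (a powr (1 - q)) * I)"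
      by (simp add: mult_left_mono)
    show ?thesis
    proof (cases I)
      case (real r)
      have "2 * (ennreal a * ennreal (pi * (2 * \<rho>)\<^sup>2) + ennreal (a powr (1 - q)) * I)
        = ennreal (2 * (a * (pi * (2 * \<rho>)\<^sup>2) + a powr (1 - q) * r))"
      proof -
        have "ennreal (2 * (a * (pi * (2 * \<rho>)\<^sup>2) + a powr (1 - q) * r))
          = 2 * ennreal (a * (pi * (2 * \<rho>)\<^sup>2) + a powr (1 - q) * r)"
          using ennreal_mult'[of 2 "a * (pi * (2 * \<rho>)\<^sup>2) + a powr (1 - q) * r"] by (simp only: ennreal_numeral)
        also have "ennreal (a * (pi * (2 * \<rho>)\<^sup>2) + a powr (1 - q) * r)
          = ennreal (a * (pi * (2 * \<rho>)\<^sup>2)) + ennreal (a powr (1 - q) * r)"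
          using a real by (intro ennreal_plus) auto
        also have "ennreal (a * (pi * (2 * \<rho>)\<^sup>2)) = ennreal a * ennreal (pi * (2 * \<rho>)\<^sup>2)"
          using a by (intro ennreal_mult) auto
        also have "ennreal (a powr (1 - q) * r) = ennreal (a powr (1 - q)) * I"
          unfolding real(2) using real by (intro ennreal_mult) auto
        finally show ?thesis by simp
      qed
      then have "ennreal (A * (pi * \<rho>\<^sup>2 / 4)) \<le> ennreal (2 * (a * (pi * (2 * \<rho>)\<^sup>2) + a powr (1 - q) * r))"
        using main by simp
      then have "A * (pi * \<rho>\<^sup>2 / 4) \<le> 2 * (a * (pi * (2 * \<rho>)\<^sup>2) + a powr (1 - q) * r)"
        using a real by (subst (asm) ennreal_le_iff) auto
      moreover have "2 * (a * (pi * (2 * \<rho>)\<^sup>2)) = A * (pi * \<rho>\<^sup>2 / 4) / 2"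
        by (simp add: a_def power_mult_distrib)
      ultimately have "A * (pi * \<rho>\<^sup>2 / 4) \<le> 4 * (a powr (1 - q) * r)" by argo
      then have "A * (pi * \<rho>\<^sup>2) \<le> 16 * (a powr (1 - q) * r)" by simp
      moreover have "A * (1 * \<rho>\<^sup>2) \<le> A * (pi * \<rho>\<^sup>2)"
        using A pi_gt3 by (intro mult_left_mono mult_right_mono) auto
      ultimately have "A * \<rho>\<^sup>2 \<le> 64 * (a powr (1 - q) * r)" using real a
        by (smt (verit) mult_nonneg_nonneg powr_ge_zero mult_1)
      then have "a powr (q - 1) * (A * \<rho>\<^sup>2) \<le> a powr (q - 1) * (64 * (a powr (1 - q) * r))"
        by (intro mult_left_mono) auto
      also have "\<dots> = 64 * (a powr (q - 1) * a powr (1 - q)) * r" by (simp add: mult_ac)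
      also have "a powr (q - 1) * a powr (1 - q) = 1" using a by (simp add: powr_add[symmetric])
      also have "a powr (q - 1) * (A * \<rho>\<^sup>2) = 64 * a powr q * \<rho>\<^sup>2"
        using a by (simp add: a_def powr_diff)
      finally have "a powr q * \<rho>\<^sup>2 \<le> r" by simp
      then have "A powr q * \<rho>\<^sup>2 \<le> 64 powr q * r"
        using A by (simp add: a_def powr_divide field_simps)
      then have "A powr q \<le> 64 powr (q + 1) / (8 * \<rho>)\<^sup>2 * r"
        using \<rho> by (simp add: powr_add power_mult_distrib field_simps)
      then show ?thesis using real by (simp add: ennreal_mult[symmetric] ennreal_leI)
    qed (use \<rho> in \<open>simp add: ennreal_mult_top\<close>)
  qed (use q in simp)
  then show ?thesis by (simp add: A_def I_def \<rho>2)
qed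

section \<open>From dyadic tents to a genuine Carleson condition\<close>

text \<open>If z is in the Stolz angle at \<open>zeta y\<close>, the chord from x to y is at most 1
  + 3 times 1 - |z| by \<open>stolz_dist\<close>, and at least 4 |y - x|. So y is within 1 - |z| of
  x, that is, inside the arc.\<close>

lemma mem_tentI:
  assumes "cmod z < 1" "z = of_real (cmod z) * zeta x" "\<alpha> \<le> x - (1 - cmod z)" "x + (1 - cmod z) < \<beta>"
  shows "z \<in> tent (zeta ` {\<alpha>..<\<beta>})"
  unfolding tent_def
proof (intro DiffI notI, goal_cases)
  case 1
  then show ?case using assms by simp
next
  case 2
  then obtain \<zeta> where \<zeta>: "cmod \<zeta> = 1" "\<zeta> \<notin> zeta ` {\<alpha>..<\<beta>}" "z \<in> stolz \<zeta>" by auto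
  obtain y where y: "y \<in> {x - 1/2..<x - 1/2 + 1}" "\<zeta> = zeta y" using zeta_surj[OF \<zeta>(1)] .
  have "cmod (z - zeta x) = 1 - cmod z" by (rule zeta_coordinates_dist[OF assms(1,2)])
  moreover have "cmod (z - zeta y) \<le> 3 * (1 - cmod z)" using stolz_dist[OF \<zeta>(1) \<zeta>(3)] y by simp
  moreover have "\<bar>y - x\<bar> \<le> 1 / 2" using y unfolding abs_le_iff by auto
  then have "4 * \<bar>y - x\<bar> \<le> cmod (zeta y - zeta x)" by (rule norm_zeta_diff_ge)
  moreover have "cmod (zeta y - zeta x) \<le> cmod (z - zeta x) + cmod (z - zeta y)"
    using norm_triangle_ineq4[of "z - zeta x" "z - zeta y"] by simp
  ultimately have "\<bar>y - x\<bar> \<le> 1 - cmod z" by argo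
  then have "y \<in> {\<alpha>..<\<beta>}" using assms by auto
  then show ?case using \<zeta> y by auto
qed

lemma zeta_image_shift: "zeta ` {\<alpha> + of_int i..<\<beta> + of_int i} = zeta ` {\<alpha>..<\<beta>}"
proof (intro antisym subsetI)
  fix z assume "z \<in> zeta ` {\<alpha> + of_int i..<\<beta> + of_int i}"
  then obtain x where "\<alpha> + of_int i \<le> x" "x < \<beta> + of_int i" "z = zeta x" by auto
  then show "z \<in> zeta ` {\<alpha>..<\<beta>}" using zeta_add_int[of x "- i"] by (intro image_eqI[of _ _ "x - of_int i"]) auto
next
  fix z assume "z \<in> zeta ` {\<alpha>..<\<beta>}"
  then obtain x where "\<alpha> \<le> x" "x < \<beta>" "z = zeta x" by auto
  then show "z \<in> zeta ` {\<alpha> + of_int i..<\<beta> + of_int i}" using zeta_add_int[of x i] by (intro image_eqI[of _ _ "x + of_int i"]) auto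
qed

text \<open>The index m is any integer, reduced modulo 2^j by periodicity, so that both neighbours
  of a dyadic point can be named without a case distinction at 0.\<close>

lemma tent_integral_le:
  fixes m :: int
  shows "(\<integral>\<^sup>+z. dens q F z * indicator (tent (zeta ` {of_int m / 2 ^ j..<(of_int m + 1) / 2 ^ j})) z \<partial>lborel)
    \<le> ennreal (1 / 2 ^ j) * tent_inf_sup q F"
proof -
  define k where "k = nat (m mod 2 ^ j)"
  define i where "i = m div 2 ^ j"
  have k: "k < 2 ^ j" by (simp add: k_def nat_less_iff)
  have "m = int k + i * 2 ^ j" using mod_div_mult_eq[of m "2 ^ j"] by (simp add: k_def i_def)
  then have m: "real_of_int m = real k + of_int i * 2 ^ j" by (metis of_int_add of_int_mult of_int_numeral of_int_of_nat_eq of_int_power)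
  have "of_int m / 2 ^ j = real k / 2 ^ j + of_int i" "(of_int m + 1) / 2 ^ j = (real k + 1) / 2 ^ j + of_int i"
    unfolding m by (auto simp: field_simps)
  then have arc: "zeta ` {of_int m / 2 ^ j..<(of_int m + 1) / 2 ^ j} = dyadic_arc j k"
    unfolding dyadic_arc_def by (simp only: zeta_image_shift)
  let ?I = "\<integral>\<^sup>+z. dens q F z * indicator (tent (dyadic_arc j k)) z \<partial>lborel"
  have "ennreal (2 ^ j) * ?I \<le> tent_inf_sup q F"
    unfolding tent_inf_sup_dens using k by (intro SUP_upper2[of "(j, k)"]) auto
  then have "ennreal (1 / 2 ^ j) * (ennreal (2 ^ j) * ?I) \<le> ennreal (1 / 2 ^ j) * tent_inf_sup q F"
    by (rule mult_left_mono) simp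
  moreover have "ennreal (1 / 2 ^ j) * (ennreal (2 ^ j) * ?I) = ?I"
    by (simp add: mult.assoc[symmetric] ennreal_mult[symmetric])
  ultimately show ?thesis unfolding arc by simp
qed

lemma zeta_coordinates:
  obtains x where "\<bar>x - c\<bar> \<le> 1 / 2" "z = of_real (cmod z) * zeta x"
proof -
  obtain x where "x \<in> {c - 1/2..<c - 1/2 + 1}" "z = of_real (cmod z) * zeta x" by (rule polar_zeta)
  moreover from this have "\<bar>x - c\<bar> \<le> 1 / 2" unfolding abs_le_iff by auto
  ultimately show thesis by (intro that[of x])
qed

lemma compact_stolz_UN: assumes K: "compact (K :: real set)" shows "compact (\<Union>x\<in>K. stolz (zeta x))"
proof -
  let ?f = "\<lambda>p. of_real (1 - fst (snd p)) * zeta (fst p) + of_real (fst (snd p)) * snd (snd p)"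
  have "(\<Union>x\<in>K. stolz (zeta x)) = ?f ` (K \<times> {0..1} \<times> cball 0 (1/2))"
    by (force simp: stolz_iff_combination image_iff)
  moreover have "compact (?f ` (K \<times> {0..1} \<times> cball 0 (1/2)))"
    by (intro compact_continuous_image compact_Times continuous_intros K) auto
  ultimately show ?thesis by simp
qed

text \<open>The complement of a half-open arc is a half-open arc, an increasing union of compact
  ones, and the Stolz angles over a compact parameter set fill a compact set.\<close>

lemma tent_borel:
  assumes "\<alpha> \<le> \<beta>" "\<beta> \<le> \<alpha> + 1" shows "tent (zeta ` {\<alpha>..<\<beta>}) \<in> sets borel"
proof -
  have comp: "sphere 0 1 - zeta ` {\<alpha>..<\<beta>} = zeta ` {\<beta>..<\<alpha> + 1}"
  proof (intro antisym subsetI)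
    fix \<zeta> assume \<zeta>: "\<zeta> \<in> sphere 0 1 - zeta ` {\<alpha>..<\<beta>}"
    then have c\<zeta>: "cmod \<zeta> = 1" by simp
    obtain x where "x \<in> {\<alpha>..<\<alpha> + 1}" "\<zeta> = zeta x" by (rule zeta_surj[OF c\<zeta>])
    then show "\<zeta> \<in> zeta ` {\<beta>..<\<alpha> + 1}" using \<zeta> by force
  next
    fix \<zeta> assume "\<zeta> \<in> zeta ` {\<beta>..<\<alpha> + 1}"
    then obtain x where x: "\<beta> \<le> x" "x < \<alpha> + 1" "\<zeta> = zeta x" by auto
    have False if "\<alpha> \<le> y" "y < \<beta>" "zeta x = zeta y" for y
    proof -
      have "x = y" using that x by (intro zeta_eq_imp) auto
      then show False using that x by simp
    qed
    then have "zeta x \<notin> zeta ` {\<alpha>..<\<beta>}" by (metis atLeastLessThan_iff imageE)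
    then show "\<zeta> \<in> sphere 0 1 - zeta ` {\<alpha>..<\<beta>}" using x by simp
  qed
  have "{\<beta>..<\<alpha> + 1} = (\<Union>n. {\<beta>..\<alpha> + 1 - 1 / (real n + 1)})"
  proof (intro antisym subsetI)
    fix x assume x: "x \<in> {\<beta>..<\<alpha> + 1}"
    obtain n :: nat where "1 / (\<alpha> + 1 - x) < real n" using reals_Archimedean2 by blast
    then have "1 / (real n + 1) \<le> \<alpha> + 1 - x" using x by (simp add: field_simps)
    then show "x \<in> (\<Union>n. {\<beta>..\<alpha> + 1 - 1 / (real n + 1)})" using x by (intro UN_I[of n]) auto
  next
    fix x assume "x \<in> (\<Union>n. {\<beta>..\<alpha> + 1 - 1 / (real n + 1)})"
    then obtain n :: nat where "\<beta> \<le> x" "x \<le> \<alpha> + 1 - 1 / (real n + 1)" by auto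
    moreover have "0 < 1 / (real n + 1)" by simp
    ultimately show "x \<in> {\<beta>..<\<alpha> + 1}" unfolding atLeastLessThan_iff by linarith
  qed
  then have "(\<Union>\<zeta>\<in>sphere 0 1 - zeta ` {\<alpha>..<\<beta>}. stolz \<zeta>)
    = (\<Union>n. \<Union>x\<in>{\<beta>..\<alpha> + 1 - 1 / (real n + 1)}. stolz (zeta x))"
    unfolding comp by auto
  moreover have "(\<Union>n. \<Union>x\<in>{\<beta>..\<alpha> + 1 - 1 / (real n + 1)}. stolz (zeta x)) \<in> sets borel"
  proof -
    have "(\<Union>x\<in>{\<beta>..\<alpha> + 1 - 1 / (real n + 1)}. stolz (zeta x)) \<in> sets borel" for n
      by (rule borel_compact[OF compact_stolz_UN[OF compact_Icc]])
    then show ?thesis by (intro sets.countable_UN) blast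
  qed
  ultimately show ?thesis unfolding tent_def by (intro sets.Diff) auto
qed

lemma tent_borel_dyadic:
  fixes m :: int shows "tent (zeta ` {of_int m / 2 ^ j..<(of_int m + 1) / 2 ^ j}) \<in> sets borel"
proof (rule tent_borel)
  have "(1::real) / 2 ^ j \<le> 1" by simp
  then show "(of_int m + 1) / 2 ^ j \<le> of_int m / 2 ^ j + (1 :: real)" by (simp add: add_divide_distrib)
qed (simp add: divide_right_mono)

section \<open>Pointwise bounds from dyadic tents\<close>

locale tent_class =
  fixes s q L :: real and h :: "complex \<Rightarrow> 'a::complex_banach"
  assumes s: "s < 0" and q: "1 \<le> q" and h: "analytic_disc h"
    and L: "0 \<le> L" "tent_inf_sup q (TL_weight s h) \<le> ennreal L"
begin

abbreviation "F \<equiv> TL_weight s h"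
abbreviation "b \<equiv> dens q F"

text \<open>\<open>C2\<close> belongs to the area mean value, on a disc where 1 - |z| stays between
  3/4 and 2 times its value at the centre. \<open>C3\<close> adds the cone aperture 20 and the 80 of
  \<open>top_bound\<close>. \<open>C4\<close> collects two neighbouring tents, 32 each, and the area
  integral 1700 over a cone.\<close>

definition "C2 = 2 * 64 powr (q + 1) * (3 / 4) powr (s * q)"
definition "C3 = 20 powr (- s * q) * (80 * C2)"
definition "C4 = 64 + 1700 * C3"

lemma C2_pos: "0 < C2" by (simp add: C2_def)
lemma C3_pos: "0 < C3" using C2_pos by (simp add: C3_def)

lemma b_measurable [measurable]: "b \<in> borel_measurable borel"
  using continuous_TL_weight[OF h s] q by (intro measurable_dens) auto

lemma norm_F: "cmod z < 1 \<Longrightarrow> norm (F z) = (1 - cmod z) powr (- s) * norm (h z)"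
  by (simp add: TL_weight_def)

lemma tent_le:
  fixes m :: int
  shows "(\<integral>\<^sup>+z. b z * indicator (tent (zeta ` {of_int m / 2 ^ j..<(of_int m + 1) / 2 ^ j})) z \<partial>lborel) \<le> ennreal (L / 2 ^ j)"
proof -
  have "(\<integral>\<^sup>+z. b z * indicator (tent (zeta ` {of_int m / 2 ^ j..<(of_int m + 1) / 2 ^ j})) z \<partial>lborel)
     \<le> ennreal (1 / 2 ^ j) * ennreal L"
    by (rule order_trans[OF tent_integral_le mult_left_mono[OF L(2)]]) simp
  also have "\<dots> = ennreal (L / 2 ^ j)" using L by (simp add: ennreal_mult[symmetric])
  finally show ?thesis .
qed

text \<open>For j = 0 the arc is the whole circle, so no Stolz angle is removed and the tent is the
  disc.\<close>

lemma total_le: "(\<integral>\<^sup>+z. b z \<partial>lborel) \<le> ennreal L"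
proof -
  have "b z = b z * indicator (tent (zeta ` {of_int 0 / 2 ^ 0..<(of_int 0 + 1) / 2 ^ 0})) z" for z
  proof (cases "z \<in> disc")
    case True
    have "\<zeta> \<in> zeta ` {0..<1}" if c\<zeta>: "cmod \<zeta> = 1" for \<zeta>
    proof -
      obtain x where "x \<in> {0..<0 + 1}" "\<zeta> = zeta x" by (rule zeta_surj[OF c\<zeta>])
      then show ?thesis by auto
    qed
    then have "z \<in> tent (zeta ` {0..<1})" using True by (auto simp: tent_def)
    then show ?thesis by simp
  qed (simp add: dens_def)
  then have "(\<integral>\<^sup>+z. b z \<partial>lborel) = (\<integral>\<^sup>+z. b z * indicator (tent (zeta ` {of_int 0 / 2 ^ 0..<(of_int 0 + 1) / 2 ^ 0})) z \<partial>lborel)"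
    by (rule nn_integral_cong)
  also have "\<dots> \<le> ennreal (L / 2 ^ 0)" by (rule tent_le)
  finally show ?thesis by simp
qed

text \<open>On a disc of radius (1 - |z0|)/4 the weights are comparable to their values at z0, so
  the mean value inequality for h becomes one for F against the density b.\<close>

lemma point_estimate:
  assumes z0: "cmod z0 < 1" and M: "0 \<le> M"
    and le: "(\<integral>\<^sup>+z. b z * indicator (ball z0 ((1 - cmod z0) / 4)) z \<partial>lborel) \<le> ennreal M"
  shows "norm (F z0) powr q \<le> C2 * (M / (1 - cmod z0))"
proof -
  define \<delta> where "\<delta> = 1 - cmod z0"
  have \<delta>: "0 < \<delta>" using z0 by (simp add: \<delta>_def)
  let ?D = "(3 / 4 * \<delta>) powr (s * q) * (2 * \<delta>)"
  let ?B = "ball z0 (\<delta> / 4)"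
  have "(\<integral>\<^sup>+z. ennreal (norm (h z) powr q) * indicator ?B z \<partial>lborel) \<le> (\<integral>\<^sup>+z. ennreal ?D * (b z * indicator ?B z) \<partial>lborel)"
  proof (intro nn_integral_mono)
    fix z
    show "ennreal (norm (h z) powr q) * indicator ?B z \<le> ennreal ?D * (b z * indicator ?B z)"
    proof (cases "z \<in> ?B")
      case True
      define e where "e = 1 - cmod z"
      have "\<bar>cmod z - cmod z0\<bar> \<le> cmod (z - z0)" by (rule norm_triangle_ineq3)
      then have e: "3 / 4 * \<delta> \<le> e" "e \<le> 2 * \<delta>"
        using True \<delta> by (auto simp: e_def \<delta>_def dist_norm norm_minus_commute abs_le_iff)
      then have e0: "0 < e" using \<delta> by linarith
      then have z: "cmod z < 1" by (simp add: e_def)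
      have "norm (h z) = e powr s * norm (F z)"
        using e0 by (simp add: norm_F[OF z] e_def[symmetric] powr_minus)
      then have "norm (h z) powr q = e powr (s * q) * norm (F z) powr q"
        using e0 by (simp add: powr_mult powr_powr)
      also have "\<dots> = e powr (s * q) * (e * (norm (F z) powr q / e))" using e0 by simp
      also have "\<dots> \<le> (3 / 4 * \<delta>) powr (s * q) * (2 * \<delta> * (norm (F z) powr q / e))"
        using e e0 \<delta> s q by (intro mult_mono powr_mono2' mult_nonneg_nonneg) (auto simp: mult_le_0_iff)
      finally have "ennreal (norm (h z) powr q) \<le> ennreal (?D * (norm (F z) powr q / e))"
        by (intro ennreal_leI) (simp add: mult_ac)
      also have "\<dots> = ennreal ?D * b z" using e0 \<delta> z
        by (simp add: dens_def e_def[symmetric] ennreal_mult[symmetric])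
      finally show ?thesis using True by simp
    qed simp
  qed
  also have "\<dots> = ennreal ?D * (\<integral>\<^sup>+z. b z * indicator ?B z \<partial>lborel)"
  proof (rule nn_integral_cmult)
    have [measurable]: "?B \<in> sets borel" by simp
    show "(\<lambda>z. b z * indicator ?B z) \<in> borel_measurable lborel" by measurable
  qed
  also have "\<dots> \<le> ennreal ?D * ennreal M" using le by (intro mult_left_mono) (auto simp: \<delta>_def)
  finally have "ennreal (norm (h z0) powr q) \<le> ennreal (64 powr (q + 1) / \<delta>\<^sup>2) * (ennreal ?D * ennreal M)"
    using area_mean_value_powr[OF h z0 q] unfolding \<delta>_def[symmetric]
    by (meson mult_left_mono order_trans zero_le)
  also have "\<dots> = ennreal (64 powr (q + 1) / \<delta>\<^sup>2 * (?D * M))"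
    using \<delta> M by (simp add: ennreal_mult'[symmetric])
  finally have "norm (h z0) powr q \<le> 64 powr (q + 1) / \<delta>\<^sup>2 * (?D * M)"
    using \<delta> M by (subst (asm) ennreal_le_iff) auto
  then have "\<delta> powr (- s * q) * norm (h z0) powr q \<le> \<delta> powr (- s * q) * (64 powr (q + 1) / \<delta>\<^sup>2 * (?D * M))"
    by (rule mult_left_mono) simp
  also have "\<delta> powr (- s * q) * norm (h z0) powr q = norm (F z0) powr q"
    by (simp add: norm_F[OF z0] \<delta>_def[symmetric] powr_mult powr_powr)
  also have "\<delta> powr (- s * q) * (64 powr (q + 1) / \<delta>\<^sup>2 * (?D * M)) = C2 * (M / \<delta>)"
  proof -
    have "?D = (3 / 4) powr (s * q) * \<delta> powr (s * q) * (2 * \<delta>)" using \<delta> by (subst powr_mult) auto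
    moreover have "\<delta> powr (- s * q) * \<delta> powr (s * q) = 1" using \<delta> by (simp add: powr_add[symmetric])
    moreover have "a * (u / \<delta>\<^sup>2 * (v * d * (2 * \<delta>) * M)) = (a * d) * (u / \<delta>\<^sup>2 * (v * (2 * \<delta>) * M))" for a d u v :: real
      by (simp only: mult_ac)
    ultimately have "\<delta> powr (- s * q) * (64 powr (q + 1) / \<delta>\<^sup>2 * (?D * M)) = 64 powr (q + 1) / \<delta>\<^sup>2 * ((3 / 4) powr (s * q) * (2 * \<delta>) * M)"
      by (simp only: mult_1)
    then show ?thesis using \<delta> by (simp add: C2_def power2_eq_square)
  qed
  finally show ?thesis by (simp add: \<delta>_def)
qed

text \<open>Too weak by the factor 1/(1 - |z|); it is the a priori growth that the Phragmen-Lindelof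
  argument takes as input at the vertex.\<close>

lemma crude_bound:
  assumes "cmod z < 1" shows "norm (F z) powr q \<le> C2 * (L / (1 - cmod z))"
proof (rule point_estimate[OF assms L(1)])
  have "(\<integral>\<^sup>+z'. b z' * indicator (ball z ((1 - cmod z) / 4)) z' \<partial>lborel) \<le> (\<integral>\<^sup>+z'. b z' \<partial>lborel)"
    by (intro nn_integral_mono) (auto split: split_indicator)
  then show "(\<integral>\<^sup>+z'. b z' * indicator (ball z ((1 - cmod z) / 4)) z' \<partial>lborel) \<le> ennreal L"
    using total_le by (rule order_trans)
qed

text \<open>On the sides of the cone, with \<delta> = 1 - |z|, the disc of radius \<delta>/4 about z
  is covered by the tents over the two arcs of length 2^(-n) adjacent to c, where 7 \<delta> \<le>
  2^(-n) \<le> 14 \<delta>. Their mass is at most 2 * 14 \<delta> L.\<close>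

lemma side_bound:
  assumes c: "c = of_int m / 2 ^ i" and z: "cmod z < 1" "cmod (z - zeta c) = 20 * (1 - cmod z)" "cmod (z - zeta c) \<le> 1 / 2 ^ i / 2"
  shows "norm (F z) powr q \<le> C2 * (28 * L)"
proof -
  define \<delta> where "\<delta> = 1 - cmod z"
  have \<delta>: "0 < \<delta>" using z by (simp add: \<delta>_def)
  have \<delta>i: "40 * \<delta> \<le> 1 / 2 ^ i" using z by (simp add: \<delta>_def)
  have "(1::real) / 2 ^ i \<le> 1" by simp
  then have "14 * \<delta> \<le> 1" using \<delta>i \<delta> by linarith
  \<comment> \<open>Points of the disc have arguments between 18/7 \<delta> and 11/2 \<delta> away
    from c and height at most 5/4 \<delta>; \<open>mem_tentI\<close> then asks for 27/4 \<delta> <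
    2^(-n), and 7 \<delta> \<le> 2^(-n) grants it.\<close>
  then obtain n :: nat where n: "1 / 2 ^ n \<le> 14 * \<delta>" "14 * \<delta> \<le> 2 * (1 / 2 ^ n)"
    using dyadic_scale[of "14 * \<delta>"] \<delta> by auto
  have "(1::real) / 2 ^ n < 1 / 2 ^ i" using n \<delta>i \<delta> by linarith
  then have "(2::real) ^ i < 2 ^ n" by (simp add: field_simps)
  then have "i < n" by simp
  \<comment> \<open>As n exceeds i, the point c is also an endpoint of arcs of generation n.\<close>
  define k where "k = m * 2 ^ (n - i)"
  have ck: "c = of_int k / 2 ^ n"
  proof -
    have "(2::real) ^ n = 2 ^ (n - i) * 2 ^ i" using \<open>i < n\<close> by (simp add: power_add[symmetric])
    then show ?thesis by (simp add: c k_def)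
  qed
  let ?R = "tent (zeta ` {of_int k / 2 ^ n..<(of_int k + 1) / 2 ^ n})"
  let ?L = "tent (zeta ` {of_int (k - 1) / 2 ^ n..<(of_int (k - 1) + 1) / 2 ^ n})"
  have "(\<integral>\<^sup>+z'. b z' * indicator (ball z (\<delta> / 4)) z' \<partial>lborel)
    \<le> (\<integral>\<^sup>+z'. b z' * indicator ?R z' + b z' * indicator ?L z' \<partial>lborel)"
  proof (intro nn_integral_mono)
    fix z'
    show "b z' * indicator (ball z (\<delta> / 4)) z' \<le> b z' * indicator ?R z' + b z' * indicator ?L z'"
    proof (cases "z' \<in> ball z (\<delta> / 4)")
      case True
      then have d: "cmod (z - z') < \<delta> / 4" by (simp add: dist_norm)
      define e where "e = 1 - cmod z'"
      have "\<bar>cmod z - cmod z'\<bar> \<le> cmod (z - z')" by (rule norm_triangle_ineq3)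
      then have e: "3 / 4 * \<delta> \<le> e" "e \<le> 5 / 4 * \<delta>" using d by (auto simp: e_def \<delta>_def abs_le_iff)
      then have z'1: "cmod z' < 1" using \<delta> by (simp add: e_def)
      obtain x where x: "\<bar>x - c\<bar> \<le> 1 / 2" "z' = of_real (cmod z') * zeta x" by (rule zeta_coordinates)
      have zx: "cmod (z' - zeta x) = e" unfolding e_def by (rule zeta_coordinates_dist[OF z'1 x(2)])
      have t1: "cmod (z - zeta c) \<le> cmod (z - z') + cmod (z' - zeta x) + cmod (zeta x - zeta c)"
        using norm_triangle_ineq[of "z - z'" "z' - zeta x"] norm_triangle_ineq[of "z - zeta x" "zeta x - zeta c"] by simp
      have t2: "cmod (zeta x - zeta c) \<le> cmod (z - zeta c) + cmod (z - z') + cmod (z' - zeta x)"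
        using norm_triangle_ineq4[of "z - zeta c" "z - zeta x"] norm_triangle_ineq[of "z - z'" "z' - zeta x"] by simp
      have z20: "cmod (z - zeta c) = 20 * \<delta>" using z by (simp add: \<delta>_def)
      have lower: "18 * \<delta> \<le> 7 * \<bar>x - c\<bar>" using norm_zeta_diff_le7[of x c] t1 d e zx z20 by argo
      have upper: "4 * \<bar>x - c\<bar> \<le> 22 * \<delta>" using norm_zeta_diff_ge[OF x(1)] t2 d e zx z20 \<delta> by argo
      have n7: "7 * \<delta> \<le> 1 / 2 ^ n" using n by simp
      have c1: "(of_int k + 1) / 2 ^ n = c + 1 / 2 ^ n" unfolding ck by (simp add: add_divide_distrib)
      have c2: "of_int (k - 1) / 2 ^ n = c - 1 / 2 ^ n" "(of_int (k - 1) + 1) / 2 ^ n = c"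
        unfolding ck by (simp_all add: diff_divide_distrib)
      show ?thesis
      proof (cases "c \<le> x")
        case cx: True
        then have "\<bar>x - c\<bar> = x - c" by simp
        then have "z' \<in> ?R" using lower upper e n7 \<delta>
          by (intro mem_tentI[OF z'1 x(2)]) (unfold c1 e_def[symmetric] ck[symmetric], argo+)
        then show ?thesis using True by simp
      next
        case False
        then have "\<bar>x - c\<bar> = c - x" by simp
        then have "z' \<in> ?L" using lower upper e n7 \<delta>
          by (intro mem_tentI[OF z'1 x(2)]) (unfold c2 e_def[symmetric], argo+)
        then show ?thesis using True by simp
      qed
    qed simp
  qed
  also have "\<dots> \<le> ennreal (L / 2 ^ n) + ennreal (L / 2 ^ n)"
  proof -
    have [measurable]: "?R \<in> sets borel" "?L \<in> sets borel" by (rule tent_borel_dyadic)+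
    have "(\<integral>\<^sup>+z'. b z' * indicator ?R z' + b z' * indicator ?L z' \<partial>lborel)
      = (\<integral>\<^sup>+z'. b z' * indicator ?R z' \<partial>lborel) + (\<integral>\<^sup>+z'. b z' * indicator ?L z' \<partial>lborel)"
      by (rule nn_integral_add) measurable
    then show ?thesis by (simp only:) (rule add_mono[OF tent_le tent_le])
  qed
  also have "\<dots> = ennreal (2 * (L / 2 ^ n))" using L by (simp add: ennreal_plus[symmetric] del: ennreal_plus)
  also have "\<dots> \<le> ennreal (28 * \<delta> * L)"
  proof (rule ennreal_leI)
    have "1 / 2 ^ n * L \<le> 14 * \<delta> * L" using n L by (intro mult_right_mono) auto
    then show "2 * (L / 2 ^ n) \<le> 28 * \<delta> * L" by simp
  qed
  finally have "norm (F z) powr q \<le> C2 * (28 * \<delta> * L / (1 - cmod z))"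
    using \<delta> L by (intro point_estimate[OF z(1)]) (auto simp: \<delta>_def)
  then show ?thesis using \<delta> by (simp add: \<delta>_def[symmetric])
qed

text \<open>At distance \<rho> = 2^(-i)/2 from a dyadic point with odd m, the arc of generation i -
  1 with midpoint c reaches from c - 2 \<rho> to c + 2 \<rho>, and its tent contains the disc about
  z. For i = 0 the total mass is used. The mass 4 \<rho> L with \<rho> \<le> 20 (1 - |z|) gives
  80.\<close>

lemma top_bound:
  assumes c: "c = of_int m / 2 ^ i" "i = 0 \<or> odd m"
    and z: "cmod z < 1" "cmod (z - zeta c) \<le> 20 * (1 - cmod z)" "cmod (z - zeta c) = 1 / 2 ^ i / 2"
  shows "norm (F z) powr q \<le> C2 * (80 * L)"
proof -
  define \<delta> where "\<delta> = 1 - cmod z"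
  have \<delta>: "0 < \<delta>" using z by (simp add: \<delta>_def)
  define \<rho> :: real where "\<rho> = 1 / 2 ^ i / 2"
  have \<rho>: "0 < \<rho>" "\<rho> \<le> 20 * \<delta>" "cmod (z - zeta c) = \<rho>" "1 / 2 ^ i = 2 * \<rho>"
    using z by (auto simp: \<rho>_def \<delta>_def)
  have \<delta>\<rho>: "\<delta> \<le> \<rho>" using norm_zeta_minus_ge[of z c] \<rho> by (simp add: \<delta>_def norm_minus_commute)
  have "(\<integral>\<^sup>+z'. b z' * indicator (ball z (\<delta> / 4)) z' \<partial>lborel) \<le> ennreal (4 * \<rho> * L)"
  proof (cases "i = 0")
    case True
    have "(\<integral>\<^sup>+z'. b z' * indicator (ball z (\<delta> / 4)) z' \<partial>lborel) \<le> (\<integral>\<^sup>+z'. b z' \<partial>lborel)"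
      by (intro nn_integral_mono) (auto split: split_indicator)
    also have "\<dots> \<le> ennreal L" by (rule total_le)
    also have "\<dots> \<le> ennreal (4 * \<rho> * L)" using True L by (intro ennreal_leI) (simp add: \<rho>_def)
    finally show ?thesis .
  next
    case False
    then have "odd m" using c by simp
    then obtain k where k: "m = 2 * k + 1" by (elim oddE)
    obtain j where j: "i = Suc j" using False by (cases i) auto
    have a1: "of_int k / 2 ^ j = c - 2 * \<rho>" "(of_int k + 1) / 2 ^ j = c + 2 * \<rho>"
      unfolding c k \<rho>_def j by (auto simp: field_simps)
    have a2: "L / 2 ^ j = 4 * \<rho> * L" unfolding \<rho>_def j by simp
    have "(\<integral>\<^sup>+z'. b z' * indicator (ball z (\<delta> / 4)) z' \<partial>lborel)
      \<le> (\<integral>\<^sup>+z'. b z' * indicator (tent (zeta ` {of_int k / 2 ^ j..<(of_int k + 1) / 2 ^ j})) z' \<partial>lborel)"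
    proof (intro nn_integral_mono mult_left_mono)
      fix z'
      have "z' \<in> tent (zeta ` {of_int k / 2 ^ j..<(of_int k + 1) / 2 ^ j})" if z': "z' \<in> ball z (\<delta> / 4)"
      proof -
        have d: "cmod (z - z') < \<delta> / 4" using z' by (simp add: dist_norm)
        define e where "e = 1 - cmod z'"
        have "\<bar>cmod z - cmod z'\<bar> \<le> cmod (z - z')" by (rule norm_triangle_ineq3)
        then have e: "3 / 4 * \<delta> \<le> e" "e \<le> 5 / 4 * \<delta>" using d by (auto simp: e_def \<delta>_def abs_le_iff)
        then have z'1: "cmod z' < 1" using \<delta> by (simp add: e_def)
        obtain x where x: "\<bar>x - c\<bar> \<le> 1 / 2" "z' = of_real (cmod z') * zeta x" by (rule zeta_coordinates)
        have zx: "cmod (z' - zeta x) = e" unfolding e_def by (rule zeta_coordinates_dist[OF z'1 x(2)])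
        have t2: "cmod (zeta x - zeta c) \<le> cmod (z - zeta c) + cmod (z - z') + cmod (z' - zeta x)"
          using norm_triangle_ineq4[of "z - zeta c" "z - zeta x"] norm_triangle_ineq[of "z - z'" "z' - zeta x"] by simp
        have "4 * \<bar>x - c\<bar> \<le> 5 / 2 * \<rho>" using norm_zeta_diff_ge[OF x(1)] t2 d e zx \<rho> \<delta>\<rho> by argo
        moreover have "x - c \<le> \<bar>x - c\<bar>" "c - x \<le> \<bar>x - c\<bar>" by auto
        ultimately have "c - 2 * \<rho> \<le> x - e" "x + e < c + 2 * \<rho>" using e \<delta>\<rho> \<rho>(1) by argo+
        then show ?thesis unfolding a1 e_def by (intro mem_tentI[OF z'1 x(2)])
      qed
      then show "indicator (ball z (\<delta> / 4)) z' \<le> (indicator (tent (zeta ` {of_int k / 2 ^ j..<(of_int k + 1) / 2 ^ j})) z' :: ennreal)"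
        by (auto split: split_indicator)
    qed auto
    also have "\<dots> \<le> ennreal (L / 2 ^ j)" by (rule tent_le)
    finally show ?thesis unfolding a2 .
  qed
  also have "\<dots> \<le> ennreal (80 * \<delta> * L)" using \<rho> L by (intro ennreal_leI mult_right_mono) auto
  finally have "norm (F z) powr q \<le> C2 * (80 * \<delta> * L / (1 - cmod z))"
    using \<delta> L by (intro point_estimate[OF z(1)]) (auto simp: \<delta>_def)
  then show ?thesis using \<delta> by (simp add: \<delta>_def[symmetric])
qed

text \<open>Tents over dyadic arcs say nothing about the Stolz angle at a dyadic point \<open>c\<close>. There the
  bound comes from a Phragmen-Lindelof argument: if \<open>w\<close> is \<open>1 - z\<close> rotated so that
  its zero is the dyadic point, the function \<open>h w\<^bsup>-s\<^esup>\<close> is controlled on the sides of a cone and grows at most polynomially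
  at its vertex, which the factor \<open>exp (- \<epsilon> / w)\<close> beats.\<close>

lemma cone_bound:
  assumes c: "c = of_int m / 2 ^ i" "i = 0 \<or> odd m"
    and z0: "cmod z0 < 1" "cmod (z0 - zeta c) < 20 * (1 - cmod z0)" "cmod (z0 - zeta c) < 1 / 2 ^ i / 2"
  shows "norm (F z0) powr q \<le> C3 * L"
proof -
  obtain l :: "'a \<Rightarrow> complex" where l: "\<And>x y. l (x + y) = l x + l y" "\<And>a x. l (a *\<^sub>C x) = a * l x"
    "\<And>x. cmod (l x) \<le> norm x" "l (h z0) = norm (h z0)"
    using Hahn_Banach_norming by blast
  have lhol: "(\<lambda>z. l (h z)) holomorphic_on disc"
    by (rule analytic_disc_functional[OF l(1-3) h])
  define \<rho> :: real where "\<rho> = 1 / 2 ^ i / 2"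
  \<comment> \<open>The rotated 1 - z. Its real part is at least 1 - |z|, so the principal logarithm
    yields analytic powers in the disc; in the cone |W| \<le> 20 Re W, whence Re (1/W) \<ge> 1/(20
    |W|).\<close>
  define W where "W z = 1 - cnj (zeta c) * z" for z
  have cW: "cmod (W z) = cmod (z - zeta c)" for z
  proof -
    have "cnj (zeta c) * zeta c = 1" using complex_norm_square[of "zeta c"] by (simp add: mult.commute)
    then have "W z = cnj (zeta c) * (zeta c - z)" by (simp add: W_def algebra_simps)
    then show ?thesis by (simp add: norm_mult norm_minus_commute)
  qed
  have ReW: "1 - cmod z \<le> Re (W z)" for z
    using complex_Re_le_cmod[of "cnj (zeta c) * z"] by (simp add: W_def norm_mult)
  define A where "A = (C2 * (80 * L)) powr (1 / q)"
  have A0: "0 \<le> A" by (simp add: A_def)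
  have FA: "norm (F z) \<le> A" if "norm (F z) powr q \<le> C2 * (80 * L)" for z
  proof -
    have "(norm (F z) powr q) powr (1 / q) \<le> A" unfolding A_def using that q by (intro powr_mono2) auto
    then show ?thesis using q by (simp add: powr_powr)
  qed
  \<comment> \<open>The analytic power W^(-s) stands in for the weight (1 - |z|)^(-s), at the price
    of 20^(-s) inside the cone.\<close>
  have scaled: "cmod (l (h z)) * cmod (W z) powr (- s) \<le> 20 powr (- s) * norm (F z)"
    if z: "cmod z < 1" "cmod (W z) \<le> 20 * (1 - cmod z)" for z
  proof -
    have "cmod (l (h z)) * cmod (W z) powr (- s) \<le> norm (h z) * (20 * (1 - cmod z)) powr (- s)"
      using z s l(3) by (intro mult_mono powr_mono2) auto
    also have "\<dots> = 20 powr (- s) * norm (F z)" 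
    proof -
      have "(20 * (1 - cmod z)) powr (- s) = 20 powr (- s) * (1 - cmod z) powr (- s)"
        by (rule powr_mult)
      then show ?thesis using norm_F[OF z(1)] by (simp only: mult_ac)
    qed
    finally show ?thesis .
  qed
  define w0 where "w0 = W z0"
  have w0: "0 < cmod w0"
  proof -
    have "1 - cmod z0 \<le> Re w0" unfolding w0_def by (rule ReW)
    also have "\<dots> \<le> cmod w0" by (rule complex_Re_le_cmod)
    finally show ?thesis using z0(1) by linarith
  qed
  have main: "cmod (l (h z0)) * cmod w0 powr (- s) * exp (- (\<epsilon> * Re (1 / w0))) \<le> 20 powr (- s) * A"
    if \<epsilon>: "0 < \<epsilon>" for \<epsilon> :: real
  proof -
    define f where "f z = l (h z) * exp (of_real (- s) * Ln (W z)) * exp (- (of_real \<epsilon> * (1 / W z)))" for z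
    \<comment> \<open>Inner cut-off of the cone: below |w0| to keep z0 inside, at most 1/4 so that
      the q-th root of 1/(4 \<eta>) does not exceed 1/(4 \<eta>), and at most \<epsilon>^2/400 so
      that (\<epsilon>/(40 \<eta>))^2 \<ge> 1/(4 \<eta>), by which the exponential beats the crude
      bound.\<close>
    define \<eta> where "\<eta> = min (cmod w0 / 2) (min (1 / 4) (\<epsilon>\<^sup>2 / 400))"
    have "\<eta> \<le> cmod w0 / 2" "\<eta> \<le> 1 / 4" "\<eta> \<le> \<epsilon>\<^sup>2 / 400" "0 < \<eta>"
      using w0 \<epsilon> by (simp_all add: \<eta>_def)
    then have \<eta>: "0 < \<eta>" "\<eta> < cmod w0" "\<eta> \<le> 1 / 4" "\<eta> \<le> \<epsilon>\<^sup>2 / 400"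
      using w0 by linarith+
    have cf: "cmod (f z) = cmod (l (h z)) * cmod (W z) powr (- s) * exp (- (\<epsilon> * Re (1 / W z)))" if "cmod z < 1" for z
    proof -
      have "W z \<noteq> 0" using ReW[of z] that by auto
      then have "cmod (exp (of_real (- s) * Ln (W z))) = cmod (W z) powr (- s)"
        by (simp add: powr_def Re_Ln)
      moreover have "Re (of_real e * y) = e * Re y" for e y by simp
      then have "cmod (exp (- (of_real \<epsilon> * (1 / W z)))) = exp (- (\<epsilon> * Re (1 / W z)))"
        by (simp only: norm_exp_eq_Re uminus_complex.sel)
      ultimately show ?thesis by (simp only: f_def norm_mult)
    qed
    define \<Omega> where "\<Omega> = {z. cmod (W z) < 20 * (1 - cmod z)} \<inter> {z. cmod (W z) < \<rho>} \<inter> {z. \<eta> < cmod (W z)}"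
    define \<Omega>' where "\<Omega>' = {z. cmod (W z) \<le> 20 * (1 - cmod z)} \<inter> {z. cmod (W z) \<le> \<rho>} \<inter> {z. \<eta> \<le> cmod (W z)}"
    have contW: "continuous_on S W" for S unfolding W_def by (intro continuous_intros)
    have "open \<Omega>" unfolding \<Omega>_def by (intro open_Int open_Collect_less continuous_intros contW)
    have "closed \<Omega>'" unfolding \<Omega>'_def by (intro closed_Int closed_Collect_le continuous_intros contW)
    moreover have "\<Omega> \<subseteq> \<Omega>'" by (auto simp: \<Omega>_def \<Omega>'_def)
    ultimately have cl: "closure \<Omega> \<subseteq> \<Omega>'" by (rule closure_minimal[rotated])
    have \<Omega>'disc: "cmod z < 1" if "z \<in> \<Omega>'" for z
    proof -
      have "0 < 20 * (1 - cmod z)" using that \<eta>(1) unfolding \<Omega>'_def by auto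
      then show ?thesis by simp
    qed
    have \<Omega>disc: "\<Omega> \<subseteq> disc"
      using \<Omega>'disc \<open>\<Omega> \<subseteq> \<Omega>'\<close> by (auto simp: subset_iff)
    have hol: "f holomorphic_on disc"
    proof -
      have "W z \<notin> \<real>\<^sub>\<le>\<^sub>0" if "cmod z < 1" for z
        using ReW[of z] that by (auto simp: complex_nonpos_Reals_iff)
      then have nn: "\<And>z. z \<in> disc \<Longrightarrow> W z \<notin> \<real>\<^sub>\<le>\<^sub>0" by simp
      then have nz: "\<And>z. z \<in> disc \<Longrightarrow> W z \<noteq> 0" by force
      have "W holomorphic_on disc" unfolding W_def by (intro holomorphic_intros)
      then show ?thesis unfolding f_def
        by (intro holomorphic_intros lhol) (use nn nz in auto)
    qed
    have "cmod (f z0) \<le> 20 powr (- s) * A"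
    proof (rule maximum_modulus_frontier[where S=\<Omega> and f=f])
      show "f holomorphic_on interior \<Omega>"
        by (rule holomorphic_on_subset[OF hol]) (use interior_subset \<Omega>disc in blast)
      show "continuous_on (closure \<Omega>) f"
        by (rule continuous_on_subset[OF holomorphic_on_imp_continuous_on[OF hol]]) (use cl \<Omega>'disc in \<open>auto simp: subset_iff\<close>)
      show "bounded \<Omega>"
        by (rule bounded_subset[OF bounded_ball[of 0 1]]) (use \<Omega>disc in \<open>simp add: disc_def\<close>)
      show "z0 \<in> \<Omega>" using z0 \<eta> by (auto simp: \<Omega>_def cW \<rho>_def w0_def)
      fix z assume "z \<in> frontier \<Omega>"
      then have "z \<in> closure \<Omega>" "z \<notin> \<Omega>" using \<open>open \<Omega>\<close> by (auto simp: frontier_def interior_open)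
      then have z: "z \<in> \<Omega>'" "z \<notin> \<Omega>" using cl by auto
      have z1: "cmod z < 1" by (rule \<Omega>'disc[OF z(1)])
      have zW: "cmod (W z) \<le> 20 * (1 - cmod z)" "cmod (W z) \<le> \<rho>" "\<eta> \<le> cmod (W z)"
        using z by (auto simp: \<Omega>'_def)
      have W0: "0 < cmod (W z)" using zW \<eta> by linarith
      have Re1: "1 / (20 * cmod (W z)) \<le> Re (1 / W z)"
      proof -
        have "cmod (W z) / 20 \<le> Re (W z)" using zW(1) ReW[of z] by argo
        then have "cmod (W z) / 20 / (cmod (W z))\<^sup>2 \<le> Re (W z) / (cmod (W z))\<^sup>2"
          by (intro divide_right_mono) auto
        moreover have "Re (1 / W z) = Re (W z) / (cmod (W z))\<^sup>2" by (simp add: Re_divide cmod_power2)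
        ultimately show ?thesis using W0 by (simp add: power2_eq_square)
      qed
      have "cmod (f z) \<le> 20 powr (- s) * norm (F z) * exp (- (\<epsilon> * Re (1 / W z)))"
        unfolding cf[OF z1] using scaled[OF z1 zW(1)] by (intro mult_right_mono) auto
      also have "\<dots> \<le> 20 powr (- s) * A"
      proof -
        \<comment> \<open>The frontier has three pieces: the sides, the outer arc, and the small arc
          near the vertex, where only \<open>crude_bound\<close> is at hand.\<close>
        consider "cmod (W z) = 20 * (1 - cmod z)" | "cmod (W z) = \<rho>" | "cmod (W z) = \<eta>"
          using z by (auto simp: \<Omega>_def \<Omega>'_def)
        then have "norm (F z) * exp (- (\<epsilon> * Re (1 / W z))) \<le> A"
        proof cases
          case 3
          have "norm (F z) powr q \<le> C2 * (L / (1 - cmod z))" by (rule crude_bound[OF z1])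
          also have "\<dots> \<le> C2 * (L / (\<eta> / 20))"
          proof -
            have "L / (1 - cmod z) \<le> L / (\<eta> / 20)"
              using zW(1) 3 \<eta> z1 L by (intro divide_left_mono) auto
            then show ?thesis using C2_pos by (intro mult_left_mono) auto
          qed
          also have "\<dots> = C2 * (80 * L) * (1 / (4 * \<eta>))" using \<eta> by simp
          finally have "(norm (F z) powr q) powr (1 / q) \<le> (C2 * (80 * L) * (1 / (4 * \<eta>))) powr (1 / q)"
            using q by (intro powr_mono2) auto
          then have "norm (F z) \<le> (C2 * (80 * L) * (1 / (4 * \<eta>))) powr (1 / q)" using q by (simp add: powr_powr)
          also have "\<dots> = A * (1 / (4 * \<eta>)) powr (1 / q)"
            unfolding A_def by (rule powr_mult)
          also have "(1 / (4 * \<eta>)) powr (1 / q) \<le> (1 / (4 * \<eta>)) powr 1"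
            using \<eta> q by (intro powr_mono) auto
          finally have "norm (F z) \<le> A * (1 / (4 * \<eta>))" using A0 \<eta> by (simp add: mult_left_mono)
          moreover have "exp (- (\<epsilon> * Re (1 / W z))) \<le> 4 * \<eta>"
          proof -
            let ?t = "\<epsilon> / (40 * \<eta>)"
            have t: "0 < ?t" using \<epsilon> \<eta> by simp
            have "1 / (4 * \<eta>) \<le> ?t\<^sup>2"
              using \<eta> by (simp add: power_divide power_mult_distrib divide_simps) (simp add: power2_eq_square field_simps)
            also have "\<dots> \<le> (exp ?t)\<^sup>2"
            proof (rule power_mono)
              show "?t \<le> exp ?t" using exp_ge_add_one_self[of ?t] by linarith
            qed (use t in linarith)
            also have "\<dots> = exp (\<epsilon> * (1 / (20 * \<eta>)))" by (simp add: exp_double[symmetric])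
            also have "\<dots> \<le> exp (\<epsilon> * Re (1 / W z))"
            proof -
              have "\<epsilon> * (1 / (20 * \<eta>)) \<le> \<epsilon> * Re (1 / W z)" using Re1 3 \<epsilon> by (intro mult_left_mono) auto
              then show ?thesis by (simp only: exp_le_cancel_iff)
            qed
            finally have "1 / (4 * \<eta>) \<le> exp (\<epsilon> * Re (1 / W z))" .
            then have "1 / exp (\<epsilon> * Re (1 / W z)) \<le> 1 / (1 / (4 * \<eta>))" using \<eta> by (intro divide_left_mono) auto
            then show ?thesis by (simp add: exp_minus inverse_eq_divide)
          qed
          ultimately have "norm (F z) * exp (- (\<epsilon> * Re (1 / W z))) \<le> (A * (1 / (4 * \<eta>))) * (4 * \<eta>)"
            using A0 \<eta> by (intro mult_mono) auto
          then show ?thesis using \<eta> by simp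
        next
          case 1
          then have "norm (F z) powr q \<le> C2 * (28 * L)"
            using zW(2) by (intro side_bound[OF c(1) z1]) (auto simp: cW \<rho>_def)
          also have "\<dots> \<le> C2 * (80 * L)" using C2_pos L by (intro mult_left_mono) auto
          finally have "norm (F z) \<le> A" by (rule FA)
          moreover have "0 \<le> Re (1 / W z)" by (rule order_trans[OF _ Re1]) simp
          then have "exp (- (\<epsilon> * Re (1 / W z))) \<le> 1" using \<epsilon> by simp
          ultimately have "norm (F z) * exp (- (\<epsilon> * Re (1 / W z))) \<le> A * 1" using A0 by (intro mult_mono) auto
          then show ?thesis by simp
        next
          case 2
          then have "norm (F z) powr q \<le> C2 * (80 * L)"
            using zW(1) by (intro top_bound[OF c z1]) (auto simp: cW \<rho>_def)
          then have "norm (F z) \<le> A" by (rule FA)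
          moreover have "0 \<le> Re (1 / W z)" by (rule order_trans[OF _ Re1]) simp
          then have "exp (- (\<epsilon> * Re (1 / W z))) \<le> 1" using \<epsilon> by simp
          ultimately have "norm (F z) * exp (- (\<epsilon> * Re (1 / W z))) \<le> A * 1" using A0 by (intro mult_mono) auto
          then show ?thesis by simp
        qed
        then show ?thesis by (simp add: mult.assoc mult_left_mono)
      qed
      finally show "norm (f z) \<le> 20 powr (- s) * A" .
    qed
    then show ?thesis using cf[OF z0(1)] by (simp add: w0_def)
  qed
  \<comment> \<open>At the fixed point z0 the exponential factor tends to 1 as \<epsilon> tends to
    0.\<close>
  have "((\<lambda>\<epsilon>. cmod (l (h z0)) * cmod w0 powr (- s) * exp (- (\<epsilon> * Re (1 / w0))))
     \<longlongrightarrow> cmod (l (h z0)) * cmod w0 powr (- s) * exp (- (0 * Re (1 / w0)))) (at_right 0)"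
    by (intro tendsto_intros)
  then have "cmod (l (h z0)) * cmod w0 powr (- s) * exp (- (0 * Re (1 / w0))) \<le> 20 powr (- s) * A"
    by (rule tendsto_upperbound) (use main in \<open>auto simp: eventually_at_filter\<close>)
  then have 1: "norm (h z0) * cmod w0 powr (- s) \<le> 20 powr (- s) * A" by (simp add: l(4))
  have "1 - cmod z0 \<le> cmod w0" unfolding w0_def using ReW[of z0] complex_Re_le_cmod[of "W z0"] by linarith
  then have "norm (h z0) * (1 - cmod z0) powr (- s) \<le> norm (h z0) * cmod w0 powr (- s)"
    using z0(1) s by (intro mult_left_mono powr_mono2) auto
  then have "norm (F z0) \<le> 20 powr (- s) * A" using 1 by (simp add: norm_F[OF z0(1)] mult.commute)
  then have "norm (F z0) powr q \<le> (20 powr (- s) * A) powr q" using q by (intro powr_mono2) auto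
  also have "\<dots> = 20 powr (- s * q) * (A powr q)" using A0 by (simp add: powr_mult powr_powr)
  also have "A powr q = C2 * (80 * L)" using q C2_pos L by (simp add: A_def powr_powr)
  finally show ?thesis by (simp add: C3_def mult_ac)
qed

end

section \<open>The Carleson condition on all boundary discs\<close>

lemma dyadic_reduce:
  fixes k :: int
  shows "\<exists>i\<le>j. \<exists>m. (of_int k / 2 ^ j :: real) = of_int m / 2 ^ i \<and> (i = 0 \<or> odd m)"
proof (induction j arbitrary: k)
  case (Suc j)
  show ?case
  proof (cases "odd k")
    case False
    then have "even k" by simp
    then obtain k' where k: "k = 2 * k'" by (elim evenE)
    then have "(of_int k / 2 ^ Suc j :: real) = of_int k' / 2 ^ j" by simp
    then show ?thesis using Suc[of k'] by (metis le_SucI)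
  qed blast
qed simp

text \<open>Where 1 - |z| is about t/2^k the cone lies in a disc of radius 16 t/2^k, which
  contributes 256 pi t/2^k. The sum 512 pi t is below 1700 t.\<close>

lemma nn_integral_inverse_cone:
  fixes c :: real
  assumes t: "0 < t" "t \<le> 1"
  defines "V \<equiv> {z. cmod z < 1 \<and> cmod (z - zeta c) \<le> 8 * (1 - cmod z) \<and> 1 - cmod z < t}"
  shows "(\<integral>\<^sup>+z. ennreal (1 / (1 - cmod z)) * indicator V z \<partial>lborel) \<le> ennreal (1700 * t)"
proof -
  let ?u = "\<lambda>k z. ennreal (2 ^ k / t) * indicator (cball (zeta c) (16 * t / 2 ^ k)) z"
  have [measurable]: "cball a r \<in> sets borel" for a :: complex and r by simp
  have "(\<integral>\<^sup>+z. ennreal (1 / (1 - cmod z)) * indicator V z \<partial>lborel) \<le> (\<integral>\<^sup>+z. (\<Sum>k. ?u k z) \<partial>lborel)"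
  proof (intro nn_integral_mono)
    fix z
    show "ennreal (1 / (1 - cmod z)) * indicator V z \<le> (\<Sum>k. ?u k z)"
    proof (cases "z \<in> V")
      case True
      then have z: "0 < 1 - cmod z" "1 - cmod z < t" "cmod (z - zeta c) \<le> 8 * (1 - cmod z)" by (auto simp: V_def)
      obtain n :: nat where n: "1 / 2 ^ n \<le> (1 - cmod z) / t" "(1 - cmod z) / t \<le> 2 * (1 / 2 ^ n)"
        using dyadic_scale[of "(1 - cmod z) / t"] z t by auto
      have "t / 2 ^ n \<le> 1 - cmod z" using n(1) t by (simp add: field_simps)
      then have "1 / (1 - cmod z) \<le> 1 / (t / 2 ^ n)" using z t by (intro divide_left_mono) auto
      moreover have "1 - cmod z \<le> 2 * t / 2 ^ n" using n(2) t by (simp add: field_simps)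
      then have "cmod (z - zeta c) \<le> 16 * t / 2 ^ n" using z by simp
      then have "z \<in> cball (zeta c) (16 * t / 2 ^ n)" by (simp add: dist_norm norm_minus_commute)
      ultimately have "ennreal (1 / (1 - cmod z)) * indicator V z \<le> ?u n z"
        using True by (simp add: ennreal_leI)
      also have "u n z \<le> (\<Sum>k. u k z)" for u :: "nat \<Rightarrow> complex \<Rightarrow> ennreal"
        using sum_le_suminf[of "\<lambda>k. u k z" "{n}"] by simp
      finally show ?thesis .
    qed simp
  qed
  also have "\<dots> = (\<Sum>k. \<integral>\<^sup>+z. ?u k z \<partial>lborel)" by (rule nn_integral_suminf) measurable
  also have "\<dots> = (\<Sum>k. ennreal (256 * pi * t * (1 / 2) ^ k))"
  proof (rule suminf_cong)
    fix k
    have "(\<integral>\<^sup>+z. ?u k z \<partial>lborel) = ennreal (2 ^ k / t) * ennreal (pi * (16 * t / 2 ^ k)\<^sup>2)"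
      using t by (simp add: nn_integral_cmult_indicator emeasure_cball_complex)
    also have "\<dots> = ennreal (2 ^ k / t * (pi * (16 * t / 2 ^ k)\<^sup>2))" using t by (intro ennreal_mult[symmetric]) auto
    also have "2 ^ k / t * (pi * (16 * t / 2 ^ k)\<^sup>2) = 256 * pi * t * (1 / 2) ^ k"
      using t by (simp add: power2_eq_square power_one_over)
    finally show "(\<integral>\<^sup>+z. ?u k z \<partial>lborel) = ennreal (256 * pi * t * (1 / 2) ^ k)" .
  qed
  also have "\<dots> = ennreal (256 * pi * t * 2)"
  proof (rule suminf_ennreal_eq)
    have "(\<lambda>k. (1 / 2 :: real) ^ k) sums (1 / (1 - 1 / 2))" by (rule geometric_sums) simp
    then have "(\<lambda>k. (1 / 2 :: real) ^ k) sums 2" by simp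
    then show "(\<lambda>k. 256 * pi * t * (1 / 2) ^ k) sums (256 * pi * t * 2)" by (rule sums_mult)
  qed (use t in auto)
  also have "\<dots> \<le> ennreal (1700 * t)" using t pi_approx by (intro ennreal_leI) auto
  finally show ?thesis .
qed

context tent_class
begin

text \<open>A small disc is split at a dyadic point c of comparable scale near its centre: what lies
  to the right or left of c is in the tents over the two adjacent arcs, and the rest is in a cone at
  c, where \<open>cone_bound\<close> holds.\<close>

lemma carleson_b: "carleson b (ennreal (C4 * L))"
  unfolding carleson_def
proof (intro conjI allI impI)
  show "b \<in> borel_measurable borel" by measurable
  show "b z = 0" if "1 \<le> cmod z" for z using that by (simp add: dens_def)
  fix x0 t :: real assume t: "0 < t"
  have C3L: "0 \<le> C3 * L" using C3_pos L by simp
  show "(\<integral>\<^sup>+z. b z * indicator (ball (zeta x0) t) z \<partial>lborel) \<le> ennreal (C4 * L) * ennreal t"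
  proof (cases "1 / 32 \<le> t")
    case True
    have "(\<integral>\<^sup>+z. b z * indicator (ball (zeta x0) t) z \<partial>lborel) \<le> (\<integral>\<^sup>+z. b z \<partial>lborel)"
      by (intro nn_integral_mono) (auto split: split_indicator)
    also have "\<dots> \<le> ennreal L" by (rule total_le)
    also have "\<dots> \<le> ennreal (C4 * L * t)"
    proof (rule ennreal_leI)
      have "64 * (1 / 32) \<le> C4 * t" using True C3_pos by (intro mult_mono) (auto simp: C4_def)
      then have "1 * L \<le> C4 * t * L" using L by (intro mult_right_mono) auto
      then show "L \<le> C4 * L * t" by (simp add: mult_ac)
    qed
    also have "\<dots> = ennreal (C4 * L) * ennreal t" using t L C3_pos by (intro ennreal_mult) (auto simp: C4_def)
    finally show ?thesis .
  next
    case False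
    then have t32: "32 * t \<le> 1" by simp
    \<comment> \<open>The scale e = 2^(-n) is at least 16 t so that the cone up to height t, of
      extent 8 t, stays within e/2 as \<open>cone_bound\<close> requires; it is at most 32 t so that
      each tent costs no more than 32 L t.\<close>
    obtain n :: nat where n: "1 / 2 ^ n \<le> 32 * t" "32 * t \<le> 2 * (1 / 2 ^ n)"
      using dyadic_scale[of "32 * t"] t t32 by auto
    define e :: real where "e = 1 / 2 ^ n"
    have e: "e \<le> 32 * t" "16 * t \<le> e" "0 < e" using n by (auto simp: e_def)
    \<comment> \<open>The nearest grid point: |c - x0| \<le> e/2, so arguments within t/2 of x0,
      enlarged by heights below t, stay within e of c.\<close>
    define k where "k = round (2 ^ n * x0)"
    define c where "c = real_of_int k / 2 ^ n"
    have "\<bar>of_int k - 2 ^ n * x0\<bar> \<le> 1 / 2" unfolding k_def by (rule of_int_round_abs_le)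
    then have "\<bar>of_int k - 2 ^ n * x0\<bar> * e \<le> 1 / 2 * e" using e by (intro mult_right_mono) auto
    moreover have "\<bar>of_int k - 2 ^ n * x0\<bar> * e = \<bar>(of_int k - 2 ^ n * x0) * e\<bar>" using e by (simp add: abs_mult)
    moreover have "(of_int k - 2 ^ n * x0) * e = c - x0" by (simp add: c_def e_def field_simps)
    ultimately have cx0: "\<bar>c - x0\<bar> \<le> e / 2" by simp
    \<comment> \<open>\<open>cone_bound\<close> wants c in lowest terms, the generation in which it
      first appears as a grid point.\<close>
    obtain i m where im: "i \<le> n" "c = of_int m / 2 ^ i" "i = 0 \<or> odd m"
      using dyadic_reduce[of n k] unfolding c_def by blast
    have ei: "e \<le> 1 / 2 ^ i" unfolding e_def using im(1) by (intro divide_left_mono power_increasing) auto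
    let ?R = "tent (zeta ` {of_int k / 2 ^ n..<(of_int k + 1) / 2 ^ n})"
    let ?L = "tent (zeta ` {of_int (k - 1) / 2 ^ n..<(of_int (k - 1) + 1) / 2 ^ n})"
    let ?V = "{z. cmod z < 1 \<and> cmod (z - zeta c) \<le> 8 * (1 - cmod z) \<and> 1 - cmod z < t}"
    have [measurable]: "?R \<in> sets borel" "?L \<in> sets borel" by (rule tent_borel_dyadic)+
    have [measurable]: "?V \<in> sets borel" by measurable
    have c1: "of_int k / 2 ^ n = c" "(of_int k + 1) / 2 ^ n = c + e" by (simp_all add: c_def e_def add_divide_distrib)
    have c2: "of_int (k - 1) / 2 ^ n = c - e" "(of_int (k - 1) + 1) / 2 ^ n = c"
      by (simp_all add: c_def e_def diff_divide_distrib)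
    have "(\<integral>\<^sup>+z. b z * indicator (ball (zeta x0) t) z \<partial>lborel)
      \<le> (\<integral>\<^sup>+z. b z * indicator ?R z + (b z * indicator ?L z + b z * indicator ?V z) \<partial>lborel)"
    proof (intro nn_integral_mono)
      fix z
      show "b z * indicator (ball (zeta x0) t) z \<le> b z * indicator ?R z + (b z * indicator ?L z + b z * indicator ?V z)"
      proof (cases "z \<in> ball (zeta x0) t \<and> cmod z < 1")
        case True
        then have z: "cmod (z - zeta x0) < t" "cmod z < 1" by (auto simp: dist_norm norm_minus_commute)
        define \<delta> where "\<delta> = 1 - cmod z"
        have \<delta>: "0 < \<delta>" "\<delta> < t"
          using z norm_zeta_minus_ge[of z x0] by (auto simp: \<delta>_def norm_minus_commute)
        obtain x where x: "\<bar>x - x0\<bar> \<le> 1 / 2" "z = of_real (cmod z) * zeta x" by (rule zeta_coordinates)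
        have zx: "cmod (z - zeta x) = \<delta>" unfolding \<delta>_def by (rule zeta_coordinates_dist[OF z(2) x(2)])
        have "cmod (zeta x - zeta x0) \<le> cmod (z - zeta x0) + cmod (z - zeta x)"
          using norm_triangle_ineq4[of "z - zeta x0" "z - zeta x"] by simp
        then have xx0: "\<bar>x - x0\<bar> < t / 2" using norm_zeta_diff_ge[OF x(1)] zx z \<delta> by argo
        have tri: "x - x0 \<le> \<bar>x - x0\<bar>" "x0 - x \<le> \<bar>x - x0\<bar>" "c - x0 \<le> \<bar>c - x0\<bar>" "x0 - c \<le> \<bar>c - x0\<bar>" by auto
        have zR: "z \<in> ?R" if "c + \<delta> \<le> x"
          using that tri xx0 cx0 e \<delta> unfolding c1
          by (intro mem_tentI[OF z(2) x(2)]) (unfold \<delta>_def[symmetric], argo+)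
        have zL: "z \<in> ?L" if "x + \<delta> < c"
          using that tri xx0 cx0 e \<delta> unfolding c2
          by (intro mem_tentI[OF z(2) x(2)]) (unfold \<delta>_def[symmetric], argo+)
        have zV: "z \<in> ?V" if "\<not> c + \<delta> \<le> x" "\<not> x + \<delta> < c"
        proof -
          have "\<bar>x - c\<bar> \<le> \<delta>" using that by (simp add: abs_le_iff)
          then have "cmod (zeta x - zeta c) \<le> 7 * \<delta>" using norm_zeta_diff_le7[of x c] by simp
          then have "cmod (z - zeta c) \<le> 8 * \<delta>"
            using zx norm_triangle_ineq[of "z - zeta x" "zeta x - zeta c"] by simp
          then show ?thesis using z \<delta> by (simp add: \<delta>_def)
        qed
        consider "z \<in> ?R" | "z \<in> ?L" | "z \<in> ?V" using zR zL zV by blast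
        then show ?thesis
        proof cases
          case 1
          then have "b z * indicator (ball (zeta x0) t) z \<le> b z * indicator ?R z" by (simp add: mult_left_le indicator_def)
          then show ?thesis by (rule order_trans) simp
        next
          case 2
          then have "b z * indicator (ball (zeta x0) t) z \<le> b z * indicator ?L z" by (simp add: mult_left_le indicator_def)
          then show ?thesis by (rule order_trans) (simp add: add_increasing add_increasing2)
        next
          case 3
          then have "b z * indicator (ball (zeta x0) t) z \<le> b z * indicator ?V z" by (simp add: mult_left_le indicator_def)
          then show ?thesis by (rule order_trans) (simp add: add_increasing add_increasing2)
        qed
      next
        case False
        then have eq0: "b z * indicator (ball (zeta x0) t) z = 0" by (auto simp: dens_def)
        show ?thesis unfolding eq0 by (rule zero_le)
      qed
    qed
    also have "\<dots> = (\<integral>\<^sup>+z. b z * indicator ?R z \<partial>lborel) + ((\<integral>\<^sup>+z. b z * indicator ?L z \<partial>lborel) + (\<integral>\<^sup>+z. b z * indicator ?V z \<partial>lborel))"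
      by (subst nn_integral_add, measurable, subst nn_integral_add, measurable)
    also have "\<dots> \<le> ennreal (L / 2 ^ n) + (ennreal (L / 2 ^ n) + ennreal (C3 * L) * ennreal (1700 * t))"
    proof (intro add_mono)
      show "(\<integral>\<^sup>+z. b z * indicator ?R z \<partial>lborel) \<le> ennreal (L / 2 ^ n)" by (rule tent_le)
      show "(\<integral>\<^sup>+z. b z * indicator ?L z \<partial>lborel) \<le> ennreal (L / 2 ^ n)" by (rule tent_le)
      have "(\<integral>\<^sup>+z. b z * indicator ?V z \<partial>lborel) \<le> (\<integral>\<^sup>+z. ennreal (C3 * L) * (ennreal (1 / (1 - cmod z)) * indicator ?V z) \<partial>lborel)"
      proof (intro nn_integral_mono)
        fix z
        show "b z * indicator ?V z \<le> ennreal (C3 * L) * (ennreal (1 / (1 - cmod z)) * indicator ?V z)"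
        proof (cases "z \<in> ?V")
          case True
          then have z: "cmod z < 1" "cmod (z - zeta c) \<le> 8 * (1 - cmod z)" "1 - cmod z < t" by auto
          have "cmod (z - zeta c) < e / 2" using z e by argo
          also have "e / 2 \<le> 1 / 2 ^ i / 2" using ei by (rule divide_right_mono) simp
          finally have "cmod (z - zeta c) < 1 / 2 ^ i / 2" .
          moreover have "cmod (z - zeta c) < 20 * (1 - cmod z)" using z by argo
          ultimately have "norm (F z) powr q \<le> C3 * L" using z(1) by (intro cone_bound[OF im(2,3)])
          then have "norm (F z) powr q / (1 - cmod z) \<le> C3 * L / (1 - cmod z)" using z by (intro divide_right_mono) auto
          then have "b z \<le> ennreal (C3 * L * (1 / (1 - cmod z)))" using z by (simp add: dens_def ennreal_leI)
          also have "\<dots> = ennreal (C3 * L) * ennreal (1 / (1 - cmod z))" using z C3L by (intro ennreal_mult) auto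
          finally show ?thesis using True by simp
        qed simp
      qed
      also have "\<dots> = ennreal (C3 * L) * (\<integral>\<^sup>+z. ennreal (1 / (1 - cmod z)) * indicator ?V z \<partial>lborel)"
        by (rule nn_integral_cmult) measurable
      also have "\<dots> \<le> ennreal (C3 * L) * ennreal (1700 * t)"
        using t t32 by (intro mult_left_mono nn_integral_inverse_cone) auto
      finally show "(\<integral>\<^sup>+z. b z * indicator ?V z \<partial>lborel) \<le> ennreal (C3 * L) * ennreal (1700 * t)" .
    qed
    also have "\<dots> = ennreal (L / 2 ^ n + (L / 2 ^ n + C3 * L * (1700 * t)))"
      using L t C3L by (simp add: ennreal_mult[symmetric] ennreal_plus[symmetric] del: ennreal_plus)
    also have "\<dots> \<le> ennreal (C4 * L * t)"
    proof (rule ennreal_leI)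
      have "L * e \<le> L * (32 * t)" using e L by (intro mult_left_mono) auto
      then have "L / 2 ^ n \<le> 32 * L * t" by (simp add: e_def)
      moreover have "C4 * L * t = 64 * L * t + C3 * L * (1700 * t)" by (simp add: C4_def algebra_simps)
      ultimately show "L / 2 ^ n + (L / 2 ^ n + C3 * L * (1700 * t)) \<le> C4 * L * t" by linarith
    qed
    also have "\<dots> = ennreal (C4 * L) * ennreal t" using t L C3_pos by (intro ennreal_mult) (auto simp: C4_def)
    finally show ?thesis .
  qed
qed

end

section \<open>Products\<close>

lemma ennpow_power: "0 < n \<Longrightarrow> ennpow a (1 / real n) ^ n = a"
proof (cases a)
  case (real r)
  assume n: "0 < n"
  have "(r powr (1 / real n)) ^ n = r"
  proof (cases "r = 0")
    case False
    then have "(r powr (1 / real n)) ^ n = (r powr (1 / real n)) powr real n"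
      using real by (subst powr_realpow) auto
    then show ?thesis using n real False by (simp add: powr_powr)
  qed (use n in simp)
  then show ?thesis using real by (simp add: ennpow_ennreal ennreal_power)
qed (simp add: power_eq_top_ennreal)

text \<open>The pointwise bound of the area integral by 16 Q^(q/p - 1/n) B, raised to the power p/q,
  is split by u^(1-\<theta>) y^\<theta> \<le> u + y with u = Q, y = (B/l)^n and \<theta> = p/(q n).
  This does the work of Hoelder's inequality; l of the size of the Carleson constant balances the
  two terms.\<close>

lemma TL_product:
  fixes s p q :: real
  assumes s: "s < 0" and p: "0 < p" and q: "1 \<le> q"
  obtains C where "\<And>(g :: complex \<Rightarrow> complex) (h :: complex \<Rightarrow> 'a::complex_banach).
    in_Hp p g \<Longrightarrow> in_Finf s q h \<Longrightarrow>
    in_F s p q (\<lambda>z. g z *\<^sub>C h z) \<and> F_norm s p q (\<lambda>z. g z *\<^sub>C h z) \<le> C * Hp_norm p g * Finf_norm s q h"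
proof -
  obtain j :: nat where j: "p / q < 2 ^ j" using real_arch_pow[of 2 "p / q"] by auto
  define n :: nat where "n = 2 ^ j"
  have n: "0 < n" "p / q < real n" using j by (auto simp: n_def)
  define \<theta> where "\<theta> = p / (q * real n)"
  have \<theta>: "0 < \<theta>" "\<theta> < 1" using n p q by (auto simp: \<theta>_def field_simps)
  obtain bc where bc: "balay_const j = ennreal bc" "0 \<le> bc"
    using balay_const_less_top[of j] by (cases "balay_const j") auto
  define d where "d = 16 powr (p / q) * (1 + bc) * 10240000"
  have d: "0 < d" using bc by (simp add: d_def)
  \<comment> \<open>The locale constant depends on s and q alone, so C can be named before g and h
    are given.\<close>
  define K4 where "K4 = tent_class.C4 s q"
  show thesis
  proof (rule that[of "d powr (1 / p) * K4 powr (1 / q)"])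
    fix g :: "complex \<Rightarrow> complex" and h :: "complex \<Rightarrow> 'a"
    assume g: "in_Hp p g" and h: "in_Finf s q h"
    define L where "L = enn2real (tent_inf_sup q (TL_weight s h))"
    have L: "0 \<le> L" "tent_inf_sup q (TL_weight s h) = ennreal L"
      using h by (auto simp: L_def in_Finf_def)
    interpret tent_class s q L h
      using s q h L by unfold_locales (auto simp: in_Finf_def)
    have K4: "0 \<le> K4" using C3_pos by (simp add: K4_def C4_def)
    have cb: "carleson b (ennreal (K4 * L))" unfolding K4_def by (rule carleson_b)
    define S where "S = enn2real (Hp_sup p g)"
    have S: "0 \<le> S" "Hp_sup p g = ennreal S" using g by (auto simp: S_def in_Hp_def)
    have ghol: "g holomorphic_on disc" using g by (simp add: in_Hp_def analytic_disc_complex_iff)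
    have an: "analytic_disc (\<lambda>z. g z *\<^sub>C h z)"
      using g h by (intro analytic_disc_scaleC) (auto simp: in_Hp_def in_Finf_def)
    define G where "G = TL_weight s (\<lambda>z. g z *\<^sub>C h z)"
    have dG: "dens q G z = ennreal (cmod (g z) powr q) * b z" for z
      unfolding G_def by (rule dens_TL_weight_scaleC)
    obtain Q where Q: "Q \<in> borel_measurable borel"
      "\<And>x z. cmod z < 1 \<Longrightarrow> cmod (z - zeta x) \<le> 8 * (1 - cmod z) \<Longrightarrow> ennreal (cmod (g z) powr p) \<le> Q x"
      "(\<integral>\<^sup>+x. Q x \<partial>circ) \<le> 10240000 * Hp_sup p g"
      by (rule nontangential_majorant[OF p g]) blast
    note Q(1)[measurable]
    have [measurable]: "Q \<in> borel_measurable circ" by (rule measurable_circ[OF Q(1)])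
    \<comment> \<open>Its majorant Q^(1/n) is in L^n, as \<open>balay_power\<close> wants, and since
      q > p/n the remaining power of |g| is estimated by Q pointwise.\<close>
    define \<gamma> where "\<gamma> z = indicator disc z * ennreal (cmod (g z) powr (p / real n))" for z
    have \<gamma>_meas [measurable]: "\<gamma> \<in> borel_measurable borel"
    proof -
      have "(\<lambda>z. indicator disc z *\<^sub>R (cmod (g z) powr (p / real n))) \<in> borel_measurable borel"
        using p n by (intro borel_measurable_continuous_on_indicator continuous_on_powr' continuous_intros
            holomorphic_on_imp_continuous_on ghol) auto
      then have "(\<lambda>z. ennreal (indicator disc z *\<^sub>R (cmod (g z) powr (p / real n)))) \<in> borel_measurable borel" by measurable
      also have "(\<lambda>z. ennreal (indicator disc z *\<^sub>R (cmod (g z) powr (p / real n)))) = \<gamma>"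
        by (auto simp: \<gamma>_def fun_eq_iff split: split_indicator)
      finally show ?thesis .
    qed
    have pw: "ennreal (cmod (g z) powr (p * r)) \<le> ennpow (Q x) r"
      if "cmod z < 1" "cmod (z - zeta x) \<le> 8 * (1 - cmod z)" "0 \<le> r" for z x r
      using ennpow_mono[OF Q(2)[OF that(1,2)] that(3)] by (simp add: ennpow_ennreal powr_powr)
    have nt: "ntmaj \<gamma> (\<lambda>x. ennpow (Q x) (1 / real n))"
      unfolding ntmaj_def
    proof (intro conjI allI impI)
      fix x z assume z: "cmod z < 1" "cmod (z - zeta x) \<le> 8 * (1 - cmod z)"
      show "\<gamma> z \<le> ennpow (Q x) (1 / real n)" using pw[OF z, of "1 / real n"] z by (simp add: \<gamma>_def)
    qed measurable
    define B where "B x = balay b \<gamma> (zeta x)" for x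
    have B_meas [measurable]: "B \<in> borel_measurable circ"
    proof (rule measurable_circ)
      show "B \<in> borel_measurable borel" unfolding B_def by measurable
    qed
    \<comment> \<open>The Carleson constant K4 L may be 0, whereas l is to be a divisor; so l is any
      positive number above it.\<close>
    have Bn: "(\<integral>\<^sup>+x. B x ^ n \<partial>circ) \<le> ennreal bc * ennreal (l ^ n) * (\<integral>\<^sup>+x. Q x \<partial>circ)"
      if l: "K4 * L \<le> l" "0 < l" for l
    proof -
      have "(\<integral>\<^sup>+x. B x ^ n \<partial>circ) \<le> balay_const j * ennreal (K4 * L) ^ n * (\<integral>\<^sup>+x. ennpow (Q x) (1 / real n) ^ n \<partial>circ)"
        unfolding B_def n_def using balay_power[OF cb _ nt, of j] by (simp add: n_def)
      also have "(\<integral>\<^sup>+x. ennpow (Q x) (1 / real n) ^ n \<partial>circ) = (\<integral>\<^sup>+x. Q x \<partial>circ)"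
        using n by (simp add: ennpow_power)
      also have "balay_const j * ennreal (K4 * L) ^ n * (\<integral>\<^sup>+x. Q x \<partial>circ) \<le> balay_const j * ennreal l ^ n * (\<integral>\<^sup>+x. Q x \<partial>circ)"
        using l by (intro mult_right_mono mult_left_mono power_mono ennreal_leI) auto
      finally show ?thesis using l by (simp add: bc ennreal_power)
    qed
    have A_le: "Aq_q q G (zeta x) \<le> 16 * ennpow (Q x) (q / p - 1 / real n) * B x" if x: "x \<in> {0..1}" for x
    proof -
      let ?E = "ennpow (Q x) (q / p - 1 / real n)"
      have ex: "0 \<le> q / p - 1 / real n" using n p q by (simp add: field_simps)
      have "Aq_q q G (zeta x) \<le> (\<integral>\<^sup>+z. 16 * ?E * (\<gamma> z * b z * ennreal (bker z (zeta x))) \<partial>lborel)"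
        unfolding Aq_q_eq[OF x]
      proof (intro nn_integral_mono)
        fix z
        show "dens q G z * ennreal (1 / (1 - cmod z)) * st x z \<le> 16 * ?E * (\<gamma> z * b z * ennreal (bker z (zeta x)))"
        proof (cases "cmod z < 1 \<and> z \<in> stolz (zeta x)")
          case True
          then have z: "cmod z < 1" and zs: "z \<in> stolz (zeta x)" by auto
          have d3: "cmod (z - zeta x) \<le> 3 * (1 - cmod z)" by (rule stolz_dist[OF norm_zeta zs])
          have d8: "cmod (z - zeta x) \<le> 8 * (1 - cmod z)" using d3 z by argo
          have "p * (q / p - 1 / real n) + p / real n = q" using p by (simp add: right_diff_distrib)
          then have "ennreal (cmod (g z) powr q) = ennreal (cmod (g z) powr (p * (q / p - 1 / real n))) * ennreal (cmod (g z) powr (p / real n))"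
            by (simp add: ennreal_mult[symmetric] powr_add[symmetric])
          also have "\<dots> \<le> ?E * \<gamma> z"
            using pw[OF z d8 ex] z by (intro mult_mono) (auto simp: \<gamma>_def)
          finally have 1: "ennreal (cmod (g z) powr q) \<le> ?E * \<gamma> z" .
          \<comment> \<open>In a Stolz angle \<open>edist\<close> is at most 1 + 3 times 1 - |z|, so
            1/(1 - |z|) is at most 4^2 = 16 times \<open>bker\<close>.\<close>
          have "edist z (zeta x) \<le> 4 * (1 - cmod z)" using d3 z by (simp add: edist_def)
          then have "(edist z (zeta x))\<^sup>2 \<le> (4 * (1 - cmod z))\<^sup>2" by (intro power_mono) auto
          moreover have "0 < edist z (zeta x)" using z by (auto simp: edist_def intro!: add_pos_nonneg)
          ultimately have "(1 - cmod z) / (4 * (1 - cmod z))\<^sup>2 \<le> bker z (zeta x)"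
            using z by (simp add: bker_def divide_left_mono)
          moreover have sq4: "a / (4 * a)\<^sup>2 = 1 / a / 16" if "0 < a" for a :: real
            using that by (simp add: power2_eq_square)
          have "(1 - cmod z) / (4 * (1 - cmod z))\<^sup>2 = 1 / (1 - cmod z) / 16" by (rule sq4) (use z in simp)
          ultimately have "1 / (1 - cmod z) / 16 \<le> bker z (zeta x)" by simp
          then have "1 / (1 - cmod z) \<le> 16 * bker z (zeta x)" by (simp only: pos_divide_le_eq zero_less_numeral mult.commute)
          then have "ennreal (1 / (1 - cmod z)) \<le> ennreal (16 * bker z (zeta x))" by (rule ennreal_leI)
          then have 2: "ennreal (1 / (1 - cmod z)) \<le> 16 * ennreal (bker z (zeta x))" by (simp add: ennreal_mult)
          have "dens q G z * ennreal (1 / (1 - cmod z)) \<le> (?E * \<gamma> z * b z) * (16 * ennreal (bker z (zeta x)))"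
            unfolding dG by (intro mult_mono 1 2) auto
          then show ?thesis using True x by (simp add: st_def ac_simps)
        qed (auto simp: dens_def st_def)
      qed
      also have "\<dots> = 16 * ?E * B x"
        unfolding B_def balay_def by (rule nn_integral_cmult) measurable
      finally show ?thesis .
    qed
    have ptw: "ennpow (Aq_q q G (zeta x)) (p / q) \<le> ennreal (16 powr (p / q) * l powr (p / q)) * (Q x + ennreal (1 / l ^ n) * B x ^ n)"
      if x: "x \<in> {0..1}" and l: "0 < l" for x l
    proof (cases "Q x = top \<or> B x = top")
      case True
      have T: "Q x + ennreal (1 / l ^ n) * B x ^ n = top"
        using True l n by (auto simp: power_eq_top_ennreal ennreal_mult_top top_power_ennreal)
      show ?thesis unfolding T using l by (simp add: ennreal_mult_top)
    next
      case False
      then obtain u v where u: "Q x = ennreal u" "0 \<le> u" and v: "B x = ennreal v" "0 \<le> v"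
        by (cases "Q x"; cases "B x") auto
      define y where "y = v ^ n / l ^ n"
      have y: "0 \<le> y" using v l by (simp add: y_def)
      have pq: "0 < p / q" using p q by simp
      have "ennpow (Aq_q q G (zeta x)) (p / q) \<le> ennpow (ennreal (16 * u powr (q / p - 1 / real n) * v)) (p / q)"
        using A_le[OF x] pq u v by (intro ennpow_mono) (auto simp: ennpow_ennreal ennreal_mult)
      also have "\<dots> = ennreal ((16 * u powr (q / p - 1 / real n) * v) powr (p / q))"
        using v by (intro ennpow_ennreal) auto
      also have "\<dots> \<le> ennreal (16 powr (p / q) * l powr (p / q) * (u + y))"
      proof (rule ennreal_leI)
        have "(16 * u powr (q / p - 1 / real n) * v) powr (p / q)
          = 16 powr (p / q) * u powr ((q / p - 1 / real n) * (p / q)) * v powr (p / q)"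
          by (simp add: powr_mult powr_powr)
        also have "(q / p - 1 / real n) * (p / q) = 1 - \<theta>"
          using p q n by (simp add: \<theta>_def field_simps)
        also have "v powr (p / q) = l powr (p / q) * y powr \<theta>"
        proof -
          have "y = (v / l) ^ n" by (simp add: y_def power_divide)
          then have "y powr \<theta> = ((v / l) ^ n) powr \<theta>" by simp
          also have "\<dots> = (v / l) powr (real n * \<theta>)"
            using v l n \<theta> by (cases "v = 0") (auto simp: powr_realpow[symmetric] powr_powr)
          also have "real n * \<theta> = p / q" using n by (simp add: \<theta>_def)
          finally have "y powr \<theta> = (v / l) powr (p / q)" .
          then show ?thesis using l v by (simp add: powr_mult[symmetric])
        qed
        also have "16 powr (p / q) * u powr (1 - \<theta>) * (l powr (p / q) * y powr \<theta>)
          = 16 powr (p / q) * l powr (p / q) * (u powr (1 - \<theta>) * y powr \<theta>)" by (simp only: mult_ac)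
        also have "\<dots> \<le> 16 powr (p / q) * l powr (p / q) * (u + y)"
        proof (intro mult_left_mono)
          have "u powr (1 - \<theta>) * y powr \<theta> \<le> (u + y) powr (1 - \<theta>) * (u + y) powr \<theta>"
            using u y \<theta> by (intro mult_mono powr_mono2) auto
          also have "\<dots> = u + y" using u y by (simp add: powr_add[symmetric])
          finally show "u powr (1 - \<theta>) * y powr \<theta> \<le> u + y" .
        qed auto
        finally show "(16 * u powr (q / p - 1 / real n) * v) powr (p / q) \<le> 16 powr (p / q) * l powr (p / q) * (u + y)" .
      qed
      also have "\<dots> = ennreal (16 powr (p / q) * l powr (p / q)) * (ennreal u + ennreal y)"
        unfolding ennreal_plus[OF u(2) y, symmetric] using u y by (intro ennreal_mult) auto
      also have "ennreal y = ennreal (1 / l ^ n) * B x ^ n"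
        using v l by (simp add: y_def ennreal_power ennreal_mult[symmetric])
      finally show ?thesis unfolding u(1) .
    qed
    have bound: "tent_int p q G \<le> ennreal (d * l powr (p / q) * S)" if l: "K4 * L \<le> l" "0 < l" for l
    proof -
      let ?K = "16 powr (p / q) * l powr (p / q)"
      have "tent_int p q G \<le> (\<integral>\<^sup>+x. ennreal ?K * (Q x + ennreal (1 / l ^ n) * B x ^ n) \<partial>circ)"
        unfolding tent_int_circ using ptw[OF _ l(2)] by (intro nn_integral_mono) simp
      also have "\<dots> = ennreal ?K * ((\<integral>\<^sup>+x. Q x \<partial>circ) + ennreal (1 / l ^ n) * (\<integral>\<^sup>+x. B x ^ n \<partial>circ))"
        by (simp add: nn_integral_cmult nn_integral_add)
      also have "\<dots> \<le> ennreal ?K * ((\<integral>\<^sup>+x. Q x \<partial>circ) + ennreal (1 / l ^ n) * (ennreal bc * ennreal (l ^ n) * (\<integral>\<^sup>+x. Q x \<partial>circ)))"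
        by (intro mult_left_mono add_left_mono Bn l) auto
      also have "ennreal (1 / l ^ n) * (ennreal bc * ennreal (l ^ n) * (\<integral>\<^sup>+x. Q x \<partial>circ)) = ennreal bc * (\<integral>\<^sup>+x. Q x \<partial>circ)"
      proof -
        have "ennreal (1 / l ^ n) * ennreal (l ^ n) = 1" using l by (simp add: ennreal_mult[symmetric])
        then show ?thesis by (metis mult.assoc mult.left_commute mult_1)
      qed
      also have "(\<integral>\<^sup>+x. Q x \<partial>circ) + ennreal bc * (\<integral>\<^sup>+x. Q x \<partial>circ) = ennreal (1 + bc) * (\<integral>\<^sup>+x. Q x \<partial>circ)"
        using bc by (simp add: ennreal_plus distrib_right)
      also have "ennreal ?K * (ennreal (1 + bc) * (\<integral>\<^sup>+x. Q x \<partial>circ)) \<le> ennreal ?K * (ennreal (1 + bc) * (10240000 * Hp_sup p g))"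
        by (intro mult_left_mono Q(3)) auto
      also have "\<dots> = ennreal (?K * ((1 + bc) * (10240000 * S)))"
      proof -
        have "10240000 * Hp_sup p g = ennreal (10240000 * S)" using S by (simp add: ennreal_mult')
        then show ?thesis using bc S by (simp add: ennreal_mult)
      qed
      also have "?K * ((1 + bc) * (10240000 * S)) = d * l powr (p / q) * S" by (simp add: d_def)
      finally show ?thesis .
    qed
    have K4L: "0 \<le> K4 * L" using K4 L by simp
    \<comment> \<open>Passage to l = K4 L, the value 0 included, by continuity of the power with
      positive exponent p/q.\<close>
    have "((\<lambda>\<epsilon>. ennreal (d * (K4 * L + \<epsilon>) powr (p / q) * S)) \<longlongrightarrow> ennreal (d * (K4 * L + 0) powr (p / q) * S)) (at_right 0)"
    proof (intro tendsto_ennrealI tendsto_mult tendsto_powr' tendsto_add tendsto_const tendsto_ident_at)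
      show "K4 * L + 0 \<noteq> 0 \<or> 0 < p / q \<and> (\<forall>\<^sub>F \<epsilon> in at_right 0. 0 \<le> K4 * L + \<epsilon>)"
        using p q K4L by (auto simp: eventually_at_filter)
    qed
    moreover have "\<forall>\<^sub>F \<epsilon> in at_right 0. tent_int p q G \<le> ennreal (d * (K4 * L + \<epsilon>) powr (p / q) * S)"
      using eventually_at_right_less[of "0::real"] by eventually_elim (use K4L in \<open>intro bound; simp\<close>)
    ultimately have final: "tent_int p q G \<le> ennreal (d * (K4 * L) powr (p / q) * S)"
      using tendsto_lowerbound[of _ _ "at_right (0::real)"] by fastforce
    have inF: "in_F s p q (\<lambda>z. g z *\<^sub>C h z)"
      unfolding in_F_def using an order_le_less_trans[OF final] by (simp add: G_def)
    have "F_norm s p q (\<lambda>z. g z *\<^sub>C h z) = enn2real (tent_int p q G) powr (1 / p)"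
      unfolding F_norm_def tent_norm_def G_def[symmetric] using p by (intro enn2real_ennpow) simp
    also have "\<dots> \<le> (d * (K4 * L) powr (p / q) * S) powr (1 / p)"
    proof (rule powr_mono2)
      show "enn2real (tent_int p q G) \<le> d * (K4 * L) powr (p / q) * S"
        using d S by (intro enn2real_leI final) auto
    qed (use p in auto)
    also have "\<dots> = d powr (1 / p) * (K4 * L) powr (1 / q) * S powr (1 / p)"
      using p by (simp add: powr_mult powr_powr)
    also have "(K4 * L) powr (1 / q) = K4 powr (1 / q) * L powr (1 / q)" by (rule powr_mult)
    also have "S powr (1 / p) = Hp_norm p g"
      unfolding Hp_norm_def S_def using p by (intro enn2real_ennpow[symmetric]) simp
    also have "L powr (1 / q) = Finf_norm s q h"
      unfolding Finf_norm_def tent_inf_norm_def L_def using q by (intro enn2real_ennpow[symmetric]) simp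
    finally have "F_norm s p q (\<lambda>z. g z *\<^sub>C h z) \<le> d powr (1 / p) * K4 powr (1 / q) * Hp_norm p g * Finf_norm s q h"
      by (simp only: mult_ac)
    then show "in_F s p q (\<lambda>z. g z *\<^sub>C h z) \<and> F_norm s p q (\<lambda>z. g z *\<^sub>C h z)
      \<le> d powr (1 / p) * K4 powr (1 / q) * Hp_norm p g * Finf_norm s q h"
      using inF by blast
  qed
qed

theorem mainTheorem1:
  fixes s p q :: real
  assumes "s < 0" and "0 < p" and "1 \<le> q"
  shows "(\<exists>C. \<forall>f :: complex \<Rightarrow> 'a::complex_banach. in_F s p q f \<longrightarrow>
            (\<exists>g h. in_Hp p g \<and> outer g \<and> in_Finf s q h \<and>
                   (\<forall>z\<in>disc. f z = g z *\<^sub>C h z) \<and>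
                   Hp_norm p g * Finf_norm s q h \<le> C * F_norm s p q f))
       \<and> (\<exists>C. \<forall>(g :: complex \<Rightarrow> complex) (h :: complex \<Rightarrow> 'a). in_Hp p g \<and> in_Finf s q h \<longrightarrow>
            in_F s p q (\<lambda>z. g z *\<^sub>C h z) \<and>
            F_norm s p q (\<lambda>z. g z *\<^sub>C h z) \<le> C * Hp_norm p g * Finf_norm s q h)"
proof
  show "\<exists>C. \<forall>f :: complex \<Rightarrow> 'a. in_F s p q f \<longrightarrow>
            (\<exists>g h. in_Hp p g \<and> outer g \<and> in_Finf s q h \<and>
                   (\<forall>z\<in>disc. f z = g z *\<^sub>C h z) \<and>
                   Hp_norm p g * Finf_norm s q h \<le> C * F_norm s p q f)"
  proof (rule exI[of _ "256 powr (1 / p) * (13 * 2600 powr (2 * q / p)) powr (1 / q)"], intro allI impI)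
    fix f :: "complex \<Rightarrow> 'a" assume f: "in_F s p q f"
    show "\<exists>g h. in_Hp p g \<and> outer g \<and> in_Finf s q h \<and> (\<forall>z\<in>disc. f z = g z *\<^sub>C h z) \<and>
       Hp_norm p g * Finf_norm s q h \<le> 256 powr (1 / p) * (13 * 2600 powr (2 * q / p)) powr (1 / q) * F_norm s p q f"
      by (rule TL_factorization[OF assms f]) blast
  qed
  obtain C where "\<And>(g :: complex \<Rightarrow> complex) (h :: complex \<Rightarrow> 'a). in_Hp p g \<Longrightarrow> in_Finf s q h \<Longrightarrow>
    in_F s p q (\<lambda>z. g z *\<^sub>C h z) \<and> F_norm s p q (\<lambda>z. g z *\<^sub>C h z) \<le> C * Hp_norm p g * Finf_norm s q h"
    by (rule TL_product[OF assms]) blast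
  then show "\<exists>C. \<forall>(g :: complex \<Rightarrow> complex) (h :: complex \<Rightarrow> 'a). in_Hp p g \<and> in_Finf s q h \<longrightarrow>
      in_F s p q (\<lambda>z. g z *\<^sub>C h z) \<and>
      F_norm s p q (\<lambda>z. g z *\<^sub>C h z) \<le> C * Hp_norm p g * Finf_norm s q h" by blast
qed

end
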